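(* Let $\gamma\in(0,\infty)$ and $\alpha\in(\tfrac14,\tfrac12)$, and set $$s(\gamma)=\begin{cases}0,&\gamma\in(0,2\alpha),\\ \tfrac12-\tfrac\alpha\gamma,&\gamma\in[2\alpha,1),\\ \tfrac12-\alpha,&\gamma\in[1,\tfrac1{2\alpha}),\\ \tfrac12(1-\tfrac1\gamma),&\gamma\in[\tfrac1{2\alpha},2),\\ \tfrac14,&\gamma\in[2,\infty).\end{cases}$$ For every admissible curve $\Gamma$ with Hölder exponent $\alpha$ and every $s>s(\gamma)$, $\lim_{t\to0^+}P_\gamma f(\Gamma(x,t),t)=f(x)$ for a.e. $x\in\mathbb{R}$, for all $f\in H^s(\mathbb{R})$. Conversely, there exists an admissible curve $\Gamma$ with Hölder exponent $\alpha$ such that for every $s<s(\gamma)$ there is $f\in H^s(\mathbb{R})$ for which this a.e. convergence fails.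
   Context: For $\gamma>0$, $f\in H^s(\mathbb{R})$, $\Gamma:\mathbb{R}\times[-1,1]\to\mathbb{R}$ and $t\in[0,1]$, define $$P_\gamma f(\Gamma(x,t),t)=\frac1{2\pi}\int_{\mathbb{R}}e^{i(\Gamma(x,t)\xi+t|\xi|^2)}e^{-t^\gamma|\xi|^2}\hat f(\xi)\,d\xi,$$ where $\hat f(\xi)=\int e^{-ix\xi}f(x)\,dx$. An admissible curve with Hölder exponent $\alpha\in(0,1]$ is a continuous $\Gamma:\mathbb{R}\times[-1,1]\to\mathbb{R}$ with $\Gamma(x,0)=x$, bilipschitz in $x$: $C_1|x-x'|\le|\Gamma(x,t)-\Gamma(x',t)|\le C_2|x-x'|$ for all $t\in[-1,1]$, $x,x'\in\mathbb{R}$, and $\alpha$-Hölder in $t$: $|\Gamma(x,t)-\Gamma(x,t')|\le C_3|t-t'|^\alpha$ for all $x\in\mathbb{R}$, $t,t'\in[-1,1]$, with constants $C_1,C_2,C_3>0$.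
   Formalization: The converse is stated only for 0 ≤ s < s(γ): for s < 0 elements of H^s need not be functions, so f(x) is undefined; when s(γ) > 0 negative s follows from s = 0, and when s(γ) = 0 the converse is empty. *)

theory Defs
  imports "HOL-Analysis.Analysis"
begin

definition L2_fun :: "(real \<Rightarrow> complex) \<Rightarrow> bool" where
  "L2_fun f \<longleftrightarrow> f \<in> borel_measurable lborel \<and> integrable lborel (\<lambda>x. (cmod (f x))\<^sup>2)"

definition fourier_L2 :: "(real \<Rightarrow> complex) \<Rightarrow> (real \<Rightarrow> complex) \<Rightarrow> bool" where
  "fourier_L2 f g \<longleftrightarrow> L2_fun f \<and> L2_fun g \<and>
     ((\<lambda>R. integral\<^sup>L lborel
         (\<lambda>\<xi>. (cmod (g \<xi> - integral\<^sup>L lborel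
             (\<lambda>x. indicator {-R..R} x * exp (- (\<i> * complex_of_real (x * \<xi>))) * f x)))\<^sup>2))
       \<longlongrightarrow> 0) at_top"

text \<open>f belongs to H^s(R) with Fourier transform g (s \<ge> 0 is the relevant range).\<close>
definition sobolev_with_fourier :: "real \<Rightarrow> (real \<Rightarrow> complex) \<Rightarrow> (real \<Rightarrow> complex) \<Rightarrow> bool" where
  "sobolev_with_fourier s f g \<longleftrightarrow> fourier_L2 f g \<and>
     integrable lborel (\<lambda>\<xi>. (1 + \<xi>\<^sup>2) powr s * (cmod (g \<xi>))\<^sup>2)"

text \<open>P_gamma f (y, t), expressed through hat f = g.\<close>
definition P_gamma :: "real \<Rightarrow> (real \<Rightarrow> complex) \<Rightarrow> real \<Rightarrow> real \<Rightarrow> complex" where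
  "P_gamma \<gamma> g y t = complex_of_real (1 / (2 * pi)) * integral\<^sup>L lborel
     (\<lambda>\<xi>. exp (\<i> * complex_of_real (y * \<xi> + t * \<xi>\<^sup>2))
           * complex_of_real (exp (- (t powr \<gamma>) * \<xi>\<^sup>2)) * g \<xi>)"

definition admissible_curve :: "real \<Rightarrow> (real \<Rightarrow> real \<Rightarrow> real) \<Rightarrow> bool" where
  "admissible_curve \<alpha> \<Gamma> \<longleftrightarrow>
     continuous_on (UNIV \<times> {-1..1}) (\<lambda>(x, t). \<Gamma> x t) \<and>
     (\<forall>x. \<Gamma> x 0 = x) \<and>
     (\<exists>C1 C2 C3. C1 > 0 \<and> C2 > 0 \<and> C3 > 0 \<and>
        (\<forall>t\<in>{-1..1}. \<forall>x x'. C1 * \<bar>x - x'\<bar> \<le> \<bar>\<Gamma> x t - \<Gamma> x' t\<bar> \<and>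
                              \<bar>\<Gamma> x t - \<Gamma> x' t\<bar> \<le> C2 * \<bar>x - x'\<bar>) \<and>
        (\<forall>x. \<forall>t\<in>{-1..1}. \<forall>t'\<in>{-1..1}. \<bar>\<Gamma> x t - \<Gamma> x t'\<bar> \<le> C3 * \<bar>t - t'\<bar> powr \<alpha>))"

definition s_crit :: "real \<Rightarrow> real \<Rightarrow> real" where
  "s_crit \<alpha> \<gamma> =
     (if \<gamma> < 2 * \<alpha> then 0
      else if \<gamma> < 1 then 1/2 - \<alpha> / \<gamma>
      else if \<gamma> < 1 / (2 * \<alpha>) then 1/2 - \<alpha>
      else if \<gamma> < 2 then (1/2) * (1 - 1 / \<gamma>)
      else 1/4)"

definition conv_ae :: "real \<Rightarrow> (real \<Rightarrow> real \<Rightarrow> real) \<Rightarrow> (real \<Rightarrow> complex) \<Rightarrow> (real \<Rightarrow> complex) \<Rightarrow> bool" where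
  "conv_ae \<gamma> \<Gamma> f g \<longleftrightarrow>
     (AE x in lborel. ((\<lambda>t. P_gamma \<gamma> g (\<Gamma> x t) t) \<longlongrightarrow> f x) (at_right 0))"

end

theory Submission
  imports Defs "HOL-Probability.Probability" "HOL-Real_Asymp.Real_Asymp"
begin

text \<open>
  Upper bound. On frequencies of size at most \<open>N\<close> insert the cutoff \<open>exp (- \<xi>\<^sup>2 / N\<^sup>2)\<close>. After linearising the
  supremum over times, \<open>T T\<^sup>*\<close> has the kernel
  \<open>\<integral> exp (\<i> (a \<xi> + b \<xi>\<^sup>2)) exp (- c \<xi>\<^sup>2) d\<xi>\<close> with \<open>a = \<Gamma> y t' - \<Gamma> x t\<close>, \<open>b = t' - t\<close>,
  \<open>c = t powr \<gamma> + t' powr \<gamma> + 2 / N\<^sup>2\<close>, an explicit Gaussian. Either \<open>\<bar>x - y\<bar>\<close> is at most a multiple of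
  \<open>\<bar>b\<bar> powr \<alpha>\<close>, and the size \<open>(c\<^sup>2 + b\<^sup>2) powr (- 1/4)\<close> of the kernel suffices, or \<open>\<bar>a\<bar>\<close> is comparable with
  \<open>\<bar>x - y\<bar>\<close> and the Gaussian decays. In both cases the kernel is at most a multiple of
  \<open>N powr (2 \<sigma>) * \<bar>x - y\<bar> powr (- \<beta>)\<close> with \<open>\<beta> < 1\<close>, for every \<open>\<sigma> > s_crit \<alpha> \<gamma>\<close>, and Schur's test gives a
  maximal inequality. The maximal functions of the dyadic pieces of \<open>g\<close> are summable almost
  everywhere, so that the limit may be taken term by term.

  Lower bound. A sum of \<open>M\<close> Gaussian bumps at frequencies in arithmetic progression with step
  \<open>2 \<pi> / L\<close> has small norm, but its evolution is of size one wherever all phases agree. For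
  \<open>\<gamma> < 1 / (2 \<alpha>)\<close> the curve \<open>x - \<bar>t\<bar> powr \<alpha>\<close> meets \<open>L \<int>\<close> before dispersion sets in; otherwise the
  vertical line suffices, since the evolution itself transports the packet. A lacunary sum of such
  packets oscillates as \<open>t\<close> tends to \<open>0\<close>.\<close>

section \<open>Gaussian integrals\<close>

text \<open>The cases of \<open>s_crit\<close> reflect competing demands. Where the curve bridges
  the distance, \<open>\<beta> < 1\<close> requires
  \<open>min 1 \<gamma> * (1 - 2 * \<sigma>) < 2 * \<alpha>\<close>; elsewhere a Gaussian is traded
  for a power \<open>q < 1\<close> of the distance, at a price in \<open>N\<close> that depends on
  whether dispersion or damping dominates. For \<gamma> at least 1 the two demands exchange roles at
  1 / (2 \<alpha>), which lies below 2 because \<alpha> > 1/4. In the lower bound, averaging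
  \<open>M\<close> separated bumps gives a squared norm of order \<open>1 / M\<close>, so a packet
  at frequency about \<open>N\<close> costs \<open>N powr (2 * s) / M\<close>; the construction
  reaches \<open>M\<close> of order \<open>N powr p\<close> with
  \<open>p = 2 * s_crit \<alpha> \<gamma>\<close>.

  The obstacle in identifying the limit is that \<open>f\<close> and \<open>g\<close> are tied only
  by an L2 limit of truncated integrals. Instead of a density argument, the time-zero values of the
  bands are summed and compared with \<open>f\<close> through integrals over intervals. This takes
  Plancherel only as an inequality, one more instance of the kernel bound.\<close>

lemma borel_measurable_cnj [measurable (raw)]:
  "f \<in> borel_measurable M \<Longrightarrow> (\<lambda>x. cnj (f x)) \<in> borel_measurable M"
  by (rule borel_measurable_continuous_on[where f = cnj]) (auto intro: continuous_intros)

lemma iexp_diff: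
  "exp (\<i> * complex_of_real p) * exp (- (\<i> * complex_of_real q)) = exp (\<i> * complex_of_real (p - q))"
  by (simp add: exp_add[symmetric] algebra_simps)

text \<open>A rescaling of the characteristic function of the standard normal law. The argument
  \<open>t = a / sqrt (2 * c)\<close> is the one for which the substitution
  \<open>sqrt (2*c) * x\<close> turns \<open>t\<close> times the variable into
  \<open>a * x\<close>.\<close>

lemma gaussian_fourier:
  fixes a c :: real
  assumes c: "c > 0"
  shows "has_bochner_integral lborel
     (\<lambda>x. exp (\<i> * complex_of_real (a * x)) * complex_of_real (exp (- (c * x\<^sup>2))))
     (complex_of_real (sqrt (pi / c) * exp (- a\<^sup>2 / (4 * c))))"
proof -
  define t where "t = a / sqrt (2 * c)"
  have ch: "char std_normal_distribution t = complex_of_real (exp (- (t\<^sup>2) / 2))"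
    by (simp add: char_std_normal_distribution)
  have int0: "integrable lborel (\<lambda>x. std_normal_density x *\<^sub>R exp (\<i> * complex_of_real (t * x)))"
  proof (rule Bochner_Integration.integrable_bound)
    show "integrable lborel std_normal_density"
      using integrable_normal_density[of 1 0] by simp
  qed (auto simp: norm_mult)
  have "char std_normal_distribution t = (LINT x|std_normal_distribution. exp (\<i> * complex_of_real (t * x)))"
    by (simp add: char_def)
  also have "\<dots> = (LINT x|lborel. std_normal_density x *\<^sub>R exp (\<i> * complex_of_real (t * x)))"
    by (subst integral_density) auto
  finally have I0: "(LINT x|lborel. std_normal_density x *\<^sub>R exp (\<i> * complex_of_real (t * x)))
     = complex_of_real (exp (- (t\<^sup>2) / 2))" using ch by simp
  have H0: "has_bochner_integral lborel (\<lambda>x. std_normal_density x *\<^sub>R exp (\<i> * complex_of_real (t * x)))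
     (complex_of_real (exp (- (t\<^sup>2) / 2)))"
    using int0 I0 by (simp add: has_bochner_integral_iff)
  have sc: "sqrt (2*c) > 0" using c by simp
  have H1: "has_bochner_integral lborel (\<lambda>x. std_normal_density (0 + sqrt (2*c) * x) *\<^sub>R exp (\<i> * complex_of_real (t * (0 + sqrt (2*c) * x))))
     (complex_of_real (exp (- (t\<^sup>2) / 2)) /\<^sub>R \<bar>sqrt (2*c)\<bar>)"
    using lborel_has_bochner_integral_real_affine_iff[of "sqrt (2*c)" "\<lambda>x. std_normal_density x *\<^sub>R exp (\<i> * complex_of_real (t * x))" _ 0] H0 sc
    by simp
  have e1: "t * (0 + sqrt (2*c) * x) = a * x" for x using sc by (simp add: t_def)
  have e2: "std_normal_density (0 + sqrt (2*c) * x) = exp (- (c * x\<^sup>2)) / sqrt (2*pi)" for x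
    using c by (simp add: std_normal_density_def power_mult_distrib)
  have e3: "t\<^sup>2 / 2 = a\<^sup>2 / (4*c)" using c by (simp add: t_def power_divide)
  have "has_bochner_integral lborel (\<lambda>x. complex_of_real (sqrt (2*pi)) * (std_normal_density (0 + sqrt (2*c) * x) *\<^sub>R exp (\<i> * complex_of_real (t * (0 + sqrt (2*c) * x)))))
     (complex_of_real (sqrt (2*pi)) * (complex_of_real (exp (- (t\<^sup>2) / 2)) /\<^sub>R \<bar>sqrt (2*c)\<bar>))"
    using H1 by (intro has_bochner_integral_mult_right) auto
  moreover have "complex_of_real (sqrt (2*pi)) * (std_normal_density (0 + sqrt (2*c) * x) *\<^sub>R exp (\<i> * complex_of_real (t * (0 + sqrt (2*c) * x))))
     = exp (\<i> * complex_of_real (a * x)) * complex_of_real (exp (- (c * x\<^sup>2)))" for x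
    unfolding e1 e2 by (simp add: scaleR_conv_of_real)
  moreover have "complex_of_real (sqrt (2*pi)) * (complex_of_real (exp (- (t\<^sup>2) / 2)) /\<^sub>R \<bar>sqrt (2*c)\<bar>)
     = complex_of_real (sqrt (pi / c) * exp (- a\<^sup>2 / (4 * c)))"
  proof -
    have "sqrt (2*pi) / sqrt (2*c) = sqrt (pi / c)" using c by (simp add: real_sqrt_divide[symmetric])
    then have "sqrt (2*pi) * (exp (- (t\<^sup>2) / 2) / sqrt (2*c)) = sqrt (pi / c) * exp (- a\<^sup>2 / (4 * c))"
      using e3 by (metis (no_types, lifting) minus_divide_left mult.commute times_divide_eq_left)
    moreover have "complex_of_real A * (complex_of_real E /\<^sub>R \<bar>B\<bar>) = complex_of_real (A * (E / B))"
      if "B > 0" for A B E :: real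
      using that by (simp add: scaleR_conv_of_real field_simps)
    ultimately show ?thesis using sc by metis
  qed
  ultimately show ?thesis by simp
qed

lemma gaussian_fourier_integral:
  fixes a c :: real
  assumes "c > 0"
  shows "(LINT x|lborel. exp (\<i> * complex_of_real (a * x)) * complex_of_real (exp (- (c * x\<^sup>2))))
      = complex_of_real (sqrt (pi / c) * exp (- a\<^sup>2 / (4 * c)))"
  using gaussian_fourier[OF assms] by (rule has_bochner_integral_integral_eq)

lemma gaussian_has_integral:
  fixes c m :: real
  assumes c: "c > 0"
  shows "has_bochner_integral lborel (\<lambda>x. exp (- (c * (x - m)\<^sup>2))) (sqrt (pi / c))"
proof -
  have "has_bochner_integral lborel (\<lambda>x. Re (exp (\<i> * complex_of_real (0 * x)) * complex_of_real (exp (- (c * x\<^sup>2)))))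
     (Re (complex_of_real (sqrt (pi / c) * exp (- 0\<^sup>2 / (4 * c)))))"
    by (rule has_bochner_integral_bounded_linear[OF bounded_linear_Re gaussian_fourier[OF c]])
  then have "has_bochner_integral lborel (\<lambda>x. exp (- (c * x\<^sup>2))) (sqrt (pi / c))" by simp
  then show ?thesis
    using lborel_has_bochner_integral_real_affine_iff[of 1 "\<lambda>x. exp (- (c * x\<^sup>2))" "sqrt (pi / c)" "-m"]
    by simp
qed

lemma integrable_gaussian:
  fixes c m :: real
  assumes "c > 0"
  shows "integrable lborel (\<lambda>x. exp (- (c * (x - m)\<^sup>2)))" "integrable lborel (\<lambda>x. exp (- (c * x\<^sup>2)))"
  using gaussian_has_integral[OF assms, of m] gaussian_has_integral[OF assms, of 0]
  by (auto simp: has_bochner_integral_iff)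

text \<open>Fubini for \<open>F x * cnj (F y)\<close> in the variables \<open>y\<close> and
  \<open>u = x - y\<close>. Absolute integrability is clear because translation does not change the
  integral of the norm.\<close>

lemma integral_autocorrelation:
  fixes F :: "real \<Rightarrow> complex"
  assumes F: "integrable lborel F"
  shows "(LINT x|lborel. F x) * cnj (LINT x|lborel. F x) = (LINT u|lborel. LINT y|lborel. F (y + u) * cnj (F y))"
proof -
  have [measurable]: "F \<in> borel_measurable borel" using F by auto
  have tr: "integrable lborel (\<lambda>u. F (y + u))" "(LINT u|lborel. F (y + u)) = (LINT u|lborel. F u)" for y
    using lborel_integrable_real_affine_iff[of 1 F y] lborel_integral_real_affine[of 1 F y] F by auto
  have trn: "(LINT u|lborel. norm (F (y + u))) = (LINT u|lborel. norm (F u))" for y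
    using lborel_integral_real_affine[of 1 "\<lambda>u. norm (F u)" y] by auto
  have I: "integrable (lborel \<Otimes>\<^sub>M lborel) (\<lambda>(y, u). F (y + u) * cnj (F y))"
  proof (rule lborel_pair.Fubini_integrable)
    show "integrable lborel (\<lambda>x. LINT y|lborel. norm (case (x, y) of (y, u) \<Rightarrow> F (y + u) * cnj (F y)))"
      using F by (simp add: norm_mult trn)
    show "AE x in lborel. integrable lborel (\<lambda>y. case (x, y) of (y, u) \<Rightarrow> F (y + u) * cnj (F y))"
      using tr by auto
  qed measurable
  have "(LINT u|lborel. LINT y|lborel. F (y + u) * cnj (F y)) = (LINT y|lborel. LINT u|lborel. F (y + u) * cnj (F y))"
    using lborel_pair.Fubini_integral[OF I] by simp
  also have "\<dots> = (LINT x|lborel. F x) * (LINT y|lborel. cnj (F y))"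
    by (simp add: tr)
  finally show ?thesis by (simp add: complex_cnj_cnj)
qed

text \<open>Multiplying the integral by its conjugate and translating one variable turns the quadratic
  phase into a linear one, so that only real Gaussians remain.\<close>
lemma gaussian_chirp_norm:
  fixes a b c :: real
  assumes c: "c > 0"
  shows "(cmod (LINT x|lborel. exp (\<i> * complex_of_real (a * x + b * x\<^sup>2)) * complex_of_real (exp (- (c * x\<^sup>2)))))\<^sup>2
     = pi / sqrt (c\<^sup>2 + b\<^sup>2) * exp (- (a\<^sup>2 * c) / (2 * (c\<^sup>2 + b\<^sup>2)))"
proof -
  define F where "F x = exp (\<i> * complex_of_real (a * x + b * x\<^sup>2)) * complex_of_real (exp (- (c * x\<^sup>2)))" for x
  define D where "D = c\<^sup>2 + b\<^sup>2"
  have D: "D > 0" using c by (simp add: D_def sum_power2_gt_zero_iff)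
  have F: "integrable lborel F"
    unfolding F_def
    by (rule Bochner_Integration.integrable_bound[OF integrable_gaussian(2)[OF c]]) (auto simp: norm_mult)
  have inner: "(LINT y|lborel. F (y + u) * cnj (F y)) =
      complex_of_real (sqrt (pi / (2*c))) * (exp (\<i> * complex_of_real (a * u)) * complex_of_real (exp (- (D / (2 * c) * u\<^sup>2))))" for u
  proof -
    define k where "k = exp (\<i> * complex_of_real (a * u)) * complex_of_real (exp (- (c * u\<^sup>2 / 2)))"
    \<comment> \<open>Centring the pair at its midpoint, with arguments \<open>y + u/2\<close> and
      \<open>y - u/2\<close>, removes the cross term from the Gaussian exponent and leaves the phase
      \<open>a * u + 2*b*u*y\<close>, which is linear in \<open>y\<close>.\<close>
    have pt: "F (y - u/2 + u) * cnj (F (y - u/2)) = k * (exp (\<i> * complex_of_real (2*b*u * y)) * complex_of_real (exp (- ((2*c) * y\<^sup>2))))" for y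
    proof -
      have e1: "(a * (y - u/2 + u) + b * (y - u/2 + u)\<^sup>2) - (a * (y - u/2) + b * (y - u/2)\<^sup>2) = a * u + 2*b*u*y"
        by (simp add: power2_eq_square algebra_simps)
      have e2: "- (c * (y - u/2 + u)\<^sup>2) - (c * (y - u/2)\<^sup>2) = - (c * u\<^sup>2 / 2) - ((2*c) * y\<^sup>2)"
        by (simp add: power2_eq_square algebra_simps)
      have "F (y - u/2 + u) * cnj (F (y - u/2)) =
         exp (\<i> * complex_of_real (a * (y - u/2 + u) + b * (y - u/2 + u)\<^sup>2)) * exp (- (\<i> * complex_of_real (a * (y - u/2) + b * (y - u/2)\<^sup>2)))
          * complex_of_real (exp (- (c * (y - u/2 + u)\<^sup>2)) * exp (- (c * (y - u/2)\<^sup>2)))"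
        unfolding F_def by (simp add: exp_cnj)
      also have "\<dots> = exp (\<i> * complex_of_real ((a * (y - u/2 + u) + b * (y - u/2 + u)\<^sup>2) - (a * (y - u/2) + b * (y - u/2)\<^sup>2)))
          * complex_of_real (exp (- (c * (y - u/2 + u)\<^sup>2) - (c * (y - u/2)\<^sup>2)))"
        unfolding iexp_diff by (simp only: exp_add[symmetric] diff_conv_add_uminus)
      also have "\<dots> = k * (exp (\<i> * complex_of_real (2*b*u * y)) * complex_of_real (exp (- ((2*c) * y\<^sup>2))))"
      proof -
        have "exp (\<i> * complex_of_real (a * u + 2*b*u*y)) = exp (\<i> * complex_of_real (a * u)) * exp (\<i> * complex_of_real (2*b*u * y))"
          by (simp add: distrib_left exp_add)
        moreover have "exp (- (c * u\<^sup>2 / 2) - ((2*c) * y\<^sup>2)) = exp (- (c * u\<^sup>2 / 2)) * exp (- ((2*c) * y\<^sup>2))"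
          by (simp add: exp_add[symmetric])
        ultimately show ?thesis unfolding e1 e2 k_def by simp
      qed
      finally show ?thesis .
    qed
    have "(LINT y|lborel. F (y + u) * cnj (F y)) = (LINT y|lborel. F (y - u/2 + u) * cnj (F (y - u/2)))"
      using lborel_integral_real_affine[of 1 "\<lambda>y. F (y + u) * cnj (F y)" "-u/2"] by simp
    also have "\<dots> = k * complex_of_real (sqrt (pi / (2*c)) * exp (- (2*b*u)\<^sup>2 / (4 * (2*c))))"
      unfolding pt using gaussian_fourier_integral[of "2*c" "2*b*u"] c by simp
    also have "\<dots> = complex_of_real (sqrt (pi / (2*c))) * (exp (\<i> * complex_of_real (a * u)) *
        complex_of_real (exp (- (2*b*u)\<^sup>2 / (4 * (2*c))) * exp (- (c * u\<^sup>2 / 2))))"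
      by (simp add: k_def)
    also have "exp (- (2*b*u)\<^sup>2 / (4 * (2*c))) * exp (- (c * u\<^sup>2 / 2)) = exp (- (D / (2 * c) * u\<^sup>2))"
    proof -
      have "- (2*b*u)\<^sup>2 / (4 * (2*c)) + - (c * u\<^sup>2 / 2) = - (D / (2 * c) * u\<^sup>2)"
        using c by (simp add: D_def field_simps power2_eq_square)
      then show ?thesis by (metis exp_add)
    qed
    finally show ?thesis .
  qed
  have "complex_of_real ((cmod (LINT x|lborel. F x))\<^sup>2) = (LINT u|lborel. LINT y|lborel. F (y + u) * cnj (F y))"
    unfolding integral_autocorrelation[OF F, symmetric] by (simp add: complex_mult_cnj cmod_power2)
  also have "\<dots> = complex_of_real (sqrt (pi / (2*c))) * complex_of_real (sqrt (pi / (D/(2*c))) * exp (- a\<^sup>2 / (4 * (D/(2*c)))))"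
    unfolding inner using gaussian_fourier_integral[of "D/(2*c)" a] c D by simp
  also have "\<dots> = complex_of_real (sqrt (pi / (2*c)) * sqrt (pi / (D/(2*c))) * exp (- a\<^sup>2 / (4 * (D/(2*c)))))"
    by simp
  also have "sqrt (pi / (2*c)) * sqrt (pi / (D/(2*c))) = pi / sqrt D"
    using c D by (simp add: real_sqrt_mult real_sqrt_divide)
  also have "- a\<^sup>2 / (4 * (D/(2*c))) = - (a\<^sup>2 * c) / (2 * D)"
    using c D by (simp add: field_simps)
  finally show ?thesis unfolding F_def D_def of_real_eq_iff .
qed

section \<open>The \<open>T T\<^sup>*\<close> method\<close>

lemma nn_integral_shift_real:
  fixes f :: "real \<Rightarrow> ennreal"
  assumes [measurable]: "f \<in> borel_measurable borel"
  shows "(\<integral>\<^sup>+y. f (x - y) \<partial>lborel) = (\<integral>\<^sup>+y. f y \<partial>lborel)" "(\<integral>\<^sup>+y. f (y - x) \<partial>lborel) = (\<integral>\<^sup>+y. f y \<partial>lborel)"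
  using nn_integral_real_affine[of f "-1" x] nn_integral_real_affine[of f 1 "-x"] by simp_all

text \<open>The product \<open>\<bar>w x\<bar> * \<bar>w y\<bar>\<close> is at most half the sum of
  the squares, and each half integrates to the same value by translation invariance. Stated with
  extended values, it presupposes no integrability of the double integral.\<close>

lemma schur_test_convolution:
  fixes w k :: "real \<Rightarrow> real"
  assumes [measurable]: "w \<in> borel_measurable borel" "k \<in> borel_measurable borel"
    and k: "\<And>z. k z \<ge> 0"
  shows "(\<integral>\<^sup>+x. \<integral>\<^sup>+y. ennreal (\<bar>w x\<bar> * \<bar>w y\<bar> * k (x - y)) \<partial>lborel \<partial>lborel)
      \<le> (\<integral>\<^sup>+z. ennreal (k z) \<partial>lborel) * (\<integral>\<^sup>+x. ennreal ((w x)\<^sup>2) \<partial>lborel)"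
proof -
  have am: "\<bar>w x\<bar> * \<bar>w y\<bar> * k (x - y) \<le> (1/2) * ((w x)\<^sup>2 * k (x - y)) + (1/2) * ((w y)\<^sup>2 * k (x - y))" for x y
  proof -
    have "\<bar>w x\<bar> * \<bar>w y\<bar> \<le> (1/2) * (w x)\<^sup>2 + (1/2) * (w y)\<^sup>2"
      using sum_squares_bound[of "\<bar>w x\<bar>" "\<bar>w y\<bar>"] by simp
    from mult_right_mono[OF this k[of "x - y"]] show ?thesis by (simp add: algebra_simps)
  qed
  let ?K = "\<integral>\<^sup>+z. ennreal (k z) \<partial>lborel" and ?W = "\<integral>\<^sup>+x. ennreal ((w x)\<^sup>2) \<partial>lborel"
  have half: "ennreal ((1/2) * (u * v)) = ennreal (1/2) * (ennreal u * ennreal v)" if "u \<ge> 0" "v \<ge> 0" for u v :: real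
  proof -
    have "0 \<le> (1/2::real)" "0 \<le> u * v" using that by auto
    then show ?thesis using that by (simp only: ennreal_mult)
  qed
  have 1: "(\<integral>\<^sup>+x. \<integral>\<^sup>+y. ennreal ((1/2) * ((w x)\<^sup>2 * k (x - y))) \<partial>lborel \<partial>lborel) = ennreal (1/2) * (?K * ?W)"
    using k by (simp only: half zero_le_power2)
      (simp add: nn_integral_cmult nn_integral_multc nn_integral_shift_real(1)[of "\<lambda>z. ennreal (k z)"] mult.commute del: ennreal_half)
  have "(\<integral>\<^sup>+x. \<integral>\<^sup>+y. ennreal ((1/2) * ((w y)\<^sup>2 * k (x - y))) \<partial>lborel \<partial>lborel)
     = (\<integral>\<^sup>+y. \<integral>\<^sup>+x. ennreal ((1/2) * ((w y)\<^sup>2 * k (x - y))) \<partial>lborel \<partial>lborel)"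
    by (rule lborel_pair.Fubini') measurable
  also have "\<dots> = ennreal (1/2) * (?K * ?W)"
    using k by (simp only: half zero_le_power2)
      (simp add: nn_integral_cmult nn_integral_multc nn_integral_shift_real(2)[of "\<lambda>z. ennreal (k z)"] mult.commute del: ennreal_half)
  finally have 2: "(\<integral>\<^sup>+x. \<integral>\<^sup>+y. ennreal ((1/2) * ((w y)\<^sup>2 * k (x - y))) \<partial>lborel \<partial>lborel) = ennreal (1/2) * (?K * ?W)" .
  have "(\<integral>\<^sup>+x. \<integral>\<^sup>+y. ennreal (\<bar>w x\<bar> * \<bar>w y\<bar> * k (x - y)) \<partial>lborel \<partial>lborel)
     \<le> (\<integral>\<^sup>+x. \<integral>\<^sup>+y. ennreal ((1/2) * ((w x)\<^sup>2 * k (x - y))) + ennreal ((1/2) * ((w y)\<^sup>2 * k (x - y))) \<partial>lborel \<partial>lborel)"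
    using am k by (intro nn_integral_mono) (simp flip: ennreal_plus)
  also have "\<dots> = (\<integral>\<^sup>+x. \<integral>\<^sup>+y. ennreal ((1/2) * ((w x)\<^sup>2 * k (x - y))) \<partial>lborel \<partial>lborel)
      + (\<integral>\<^sup>+x. \<integral>\<^sup>+y. ennreal ((1/2) * ((w y)\<^sup>2 * k (x - y))) \<partial>lborel \<partial>lborel)"
    by (simp add: nn_integral_add)
  also have "\<dots> = (ennreal (1/2) + ennreal (1/2)) * (?K * ?W)"
    unfolding 1 2 by (simp only: distrib_right)
  also have "ennreal (1/2) + ennreal (1/2) = 1" by (simp flip: ennreal_plus del: ennreal_half)
  finally show ?thesis by simp
qed

text \<open>The squared modulus is expanded into a double integral over \<open>x\<close> and
  \<open>y\<close>; Fubini exposes the kernel, to which the Schur test applies. The majorant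
  \<open>\<rho>\<close> serves absolute convergence only and does not enter the final bound. The
  kernel bound is asked off the diagonal, a null set, since it is later applied with a
  \<open>k\<close> that models a singularity there, and only on a set \<open>A\<close> that carries
  \<open>w\<close>.\<close>

lemma TT_star_bound:
  fixes \<phi> :: "real \<Rightarrow> real \<Rightarrow> complex" and w :: "real \<Rightarrow> complex" and k \<rho> :: "real \<Rightarrow> real"
  assumes phi[measurable]: "(\<lambda>(x, \<xi>). \<phi> x \<xi>) \<in> borel_measurable (borel \<Otimes>\<^sub>M borel)"
    and rho: "\<And>x \<xi>. cmod (\<phi> x \<xi>) \<le> \<rho> \<xi>" and rho2: "integrable lborel (\<lambda>\<xi>. (\<rho> \<xi>)\<^sup>2)"
    and w1: "integrable lborel w" and w2: "integrable lborel (\<lambda>x. (cmod (w x))\<^sup>2)"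
    and wA: "\<And>x. x \<notin> A \<Longrightarrow> w x = 0"
    and K: "\<And>x y. x \<in> A \<Longrightarrow> y \<in> A \<Longrightarrow> x \<noteq> y \<Longrightarrow> cmod (LINT \<xi>|lborel. \<phi> x \<xi> * cnj (\<phi> y \<xi>)) \<le> k (x - y)"
    and k0: "\<And>z. k z \<ge> 0" and ki: "integrable lborel k" and kk: "(LINT z|lborel. k z) \<le> \<kappa>"
  shows "integrable lborel (\<lambda>\<xi>. (cmod (LINT x|lborel. \<phi> x \<xi> * w x))\<^sup>2)" (is ?I)
    and "(LINT \<xi>|lborel. (cmod (LINT x|lborel. \<phi> x \<xi> * w x))\<^sup>2) \<le> \<kappa> * (LINT x|lborel. (cmod (w x))\<^sup>2)" (is ?J)
proof -
  have [measurable]: "w \<in> borel_measurable borel" "k \<in> borel_measurable borel" using w1 ki by auto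
  have [measurable]: "\<phi> x \<in> borel_measurable borel" for x
    using measurable_compose[OF measurable_Pair1' phi, of x] by simp
  define V where "V \<xi> = (LINT x|lborel. \<phi> x \<xi> * w x)" for \<xi>
  have V[measurable]: "V \<in> borel_measurable borel"
  proof -
    have "(\<lambda>\<xi>. LINT x|lborel. \<phi> x \<xi> * w x) \<in> borel_measurable lborel"
      by (rule lborel.borel_measurable_lebesgue_integral) measurable
    then show ?thesis by (simp add: V_def[abs_def])
  qed
  have rho0: "\<rho> \<xi> \<ge> 0" for \<xi> using rho[of 0 \<xi>] norm_ge_zero order_trans by blast
  have F1: "integrable lborel (\<lambda>x. \<phi> x \<xi> * w x)" for \<xi>
  proof (rule Bochner_Integration.integrable_bound)
    show "integrable lborel (\<lambda>x. \<rho> \<xi> * norm (w x))" using w1 by simp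
    show "(\<lambda>x. \<phi> x \<xi> * w x) \<in> borel_measurable lborel"
      using measurable_compose[OF measurable_Pair2' phi, of \<xi>] by simp
    show "AE x in lborel. norm (\<phi> x \<xi> * w x) \<le> norm (\<rho> \<xi> * norm (w x))"
      using rho rho0 by (auto simp: norm_mult intro!: AE_I2 mult_right_mono)
  qed
  have Vb: "cmod (V \<xi>) \<le> \<rho> \<xi> * (LINT x|lborel. norm (w x))" for \<xi>
  proof -
    have "cmod (V \<xi>) \<le> (LINT x|lborel. norm (\<phi> x \<xi> * w x))" unfolding V_def by (rule integral_norm_bound)
    also have "\<dots> \<le> (LINT x|lborel. \<rho> \<xi> * norm (w x))"
      using F1[of \<xi>, THEN integrable_norm] w1 rho by (intro integral_mono) (auto simp: norm_mult intro: mult_right_mono)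
    finally show ?thesis by simp
  qed
  show I: ?I
    unfolding V_def[symmetric]
  proof (rule Bochner_Integration.integrable_bound)
    show "integrable lborel (\<lambda>\<xi>. (LINT x|lborel. norm (w x))\<^sup>2 * (\<rho> \<xi>)\<^sup>2)" using rho2 by simp
    show "AE \<xi> in lborel. norm ((cmod (V \<xi>))\<^sup>2) \<le> norm ((LINT x|lborel. norm (w x))\<^sup>2 * (\<rho> \<xi>)\<^sup>2)"
      using power_mono[OF Vb norm_ge_zero, where n = 2] by (auto simp: power_mult_distrib mult.commute)
  qed simp
  define G where "G = (\<lambda>p::real\<times>real. w (fst p) * cnj (w (snd p)))"
  have [measurable]: "G \<in> borel_measurable borel"
    unfolding G_def borel_prod[symmetric] by measurable
  have Gi: "integrable lborel G"
    unfolding lborel_prod[symmetric]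
  proof (rule lborel_pair.Fubini_integrable)
    show "G \<in> borel_measurable (lborel \<Otimes>\<^sub>M lborel)" by (simp add: lborel_prod)
    show "integrable lborel (\<lambda>x. LINT y|lborel. norm (G (x, y)))"
      using w1 by (simp add: G_def norm_mult)
    show "AE x in lborel. integrable lborel (\<lambda>y. G (x, y))" using w1 by (simp add: G_def)
  qed
  define H where "H = (\<lambda>p \<xi>. G p * (\<phi> (fst p) \<xi> * cnj (\<phi> (snd p) \<xi>)))"
  have phim: "(\<lambda>q. \<phi> (f q) (g q)) \<in> borel_measurable M" if [measurable]: "f \<in> borel_measurable M" "g \<in> borel_measurable M" for f g and M :: "'b measure"
    using measurable_compose[OF measurable_Pair[OF that(1) that(2)] phi] by simp
  have Hm: "(\<lambda>(p, \<xi>). H p \<xi>) \<in> borel_measurable (lborel \<Otimes>\<^sub>M lborel)"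
  proof -
    have a: "(\<lambda>q::(real\<times>real)\<times>real. \<phi> (fst (fst q)) (snd q)) \<in> borel_measurable (borel \<Otimes>\<^sub>M borel)"
      and b: "(\<lambda>q::(real\<times>real)\<times>real. \<phi> (snd (fst q)) (snd q)) \<in> borel_measurable (borel \<Otimes>\<^sub>M borel)"
      by (rule phim; simp add: borel_prod[symmetric])+
    show ?thesis unfolding H_def case_prod_beta using a b by measurable
  qed
  have pp: "cmod (\<phi> x \<xi> * cnj (\<phi> y \<xi>)) \<le> (\<rho> \<xi>)\<^sup>2" for x y \<xi>
    using mult_mono[OF rho[of x \<xi>] rho[of y \<xi>]] rho0 by (simp add: norm_mult power2_eq_square)
  have ppi: "integrable lborel (\<lambda>\<xi>. \<phi> x \<xi> * cnj (\<phi> y \<xi>))" for x y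
    using pp by (intro Bochner_Integration.integrable_bound[OF rho2]) auto
  have Hi: "integrable (lborel \<Otimes>\<^sub>M lborel) (\<lambda>(p, \<xi>). H p \<xi>)"
  proof (rule lborel_pair.Fubini_integrable[OF Hm])
    show "AE p in lborel. integrable lborel (\<lambda>\<xi>. case (p, \<xi>) of (p, \<xi>) \<Rightarrow> H p \<xi>)"
      using ppi by (simp add: H_def)
    show "integrable lborel (\<lambda>p. LINT \<xi>|lborel. norm (case (p, \<xi>) of (p, \<xi>) \<Rightarrow> H p \<xi>))"
    proof (rule Bochner_Integration.integrable_bound)
      show "integrable lborel (\<lambda>p. norm (G p) * (LINT \<xi>|lborel. (\<rho> \<xi>)\<^sup>2))" using Gi by simp
      show "(\<lambda>p. LINT \<xi>|lborel. norm (case (p, \<xi>) of (p, \<xi>) \<Rightarrow> H p \<xi>)) \<in> borel_measurable lborel"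
        using Hm by (intro lborel.borel_measurable_lebesgue_integral) (simp add: case_prod_beta)
      have "(LINT \<xi>|lborel. norm (H p \<xi>)) \<le> norm (G p) * (LINT \<xi>|lborel. (\<rho> \<xi>)\<^sup>2)" for p
      proof -
        have "(LINT \<xi>|lborel. norm (H p \<xi>)) \<le> (LINT \<xi>|lborel. norm (G p) * (\<rho> \<xi>)\<^sup>2)"
          unfolding H_def using pp ppi[THEN integrable_norm] rho2
          by (intro integral_mono) (auto simp: norm_mult[of "G p"] intro: mult_left_mono)
        then show ?thesis by simp
      qed
      then show "AE p in lborel. norm (LINT \<xi>|lborel. norm (case (p, \<xi>) of (p, \<xi>) \<Rightarrow> H p \<xi>)) \<le> norm (norm (G p) * (LINT \<xi>|lborel. (\<rho> \<xi>)\<^sup>2))"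
        by (auto simp: abs_mult intro: order_trans)
    qed
  qed
  have VV: "complex_of_real ((cmod (V \<xi>))\<^sup>2) = (LINT p|lborel. H p \<xi>)" for \<xi>
  proof -
    have Pi: "integrable (lborel \<Otimes>\<^sub>M lborel) (\<lambda>(x, y). (\<phi> x \<xi> * w x) * cnj (\<phi> y \<xi> * w y))"
    proof (rule lborel_pair.Fubini_integrable)
      have "(\<lambda>p. \<phi> (fst p) \<xi>) \<in> borel_measurable (borel \<Otimes>\<^sub>M borel)" "(\<lambda>p. \<phi> (snd p) \<xi>) \<in> borel_measurable (borel \<Otimes>\<^sub>M borel)"
        by (rule phim; simp)+
      then show "(\<lambda>(x, y). (\<phi> x \<xi> * w x) * cnj (\<phi> y \<xi> * w y)) \<in> borel_measurable (lborel \<Otimes>\<^sub>M lborel)"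
        unfolding case_prod_beta by measurable
      show "integrable lborel (\<lambda>x. LINT y|lborel. norm (case (x, y) of (x, y) \<Rightarrow> (\<phi> x \<xi> * w x) * cnj (\<phi> y \<xi> * w y)))"
        using F1[of \<xi>, THEN integrable_norm] by (simp add: norm_mult[of "\<phi> _ \<xi> * w _"] del: complex_cnj_mult)
      show "AE x in lborel. integrable lborel (\<lambda>y. case (x, y) of (x, y) \<Rightarrow> (\<phi> x \<xi> * w x) * cnj (\<phi> y \<xi> * w y))"
        using F1[of \<xi>] by (simp del: complex_cnj_mult)
    qed
    have "(LINT p|lborel. H p \<xi>) = (LINT p|(lborel \<Otimes>\<^sub>M lborel). (case p of (x, y) \<Rightarrow> (\<phi> x \<xi> * w x) * cnj (\<phi> y \<xi> * w y)))"
      unfolding lborel_prod by (simp add: H_def G_def case_prod_beta mult_ac)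
    also have "\<dots> = (LINT x|lborel. LINT y|lborel. (\<phi> x \<xi> * w x) * cnj (\<phi> y \<xi> * w y))"
      using lborel_pair.integral_fst'[OF Pi] by simp
    also have "\<dots> = V \<xi> * cnj (V \<xi>)"
      unfolding V_def by (simp del: complex_cnj_mult)
    finally show ?thesis by (simp add: complex_mult_cnj cmod_power2)
  qed
  define KK where "KK p = (LINT \<xi>|lborel. H p \<xi>)" for p
  have "complex_of_real (LINT \<xi>|lborel. (cmod (V \<xi>))\<^sup>2) = (LINT \<xi>|lborel. LINT p|lborel. H p \<xi>)"
    unfolding VV[symmetric] by (rule integral_complex_of_real[symmetric])
  also have "\<dots> = (LINT p|lborel. KK p)"
    unfolding KK_def by (rule lborel_pair.Fubini_integral[OF Hi])
  finally have E: "complex_of_real (LINT \<xi>|lborel. (cmod (V \<xi>))\<^sup>2) = (LINT p|lborel. KK p)" .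
  have KKi: "integrable lborel KK"
    unfolding KK_def using lborel_pair.integrable_fst'[OF Hi] by simp
  have [measurable]: "KK \<in> borel_measurable borel" using KKi by auto
  have KKb: "cmod (KK (x, y)) \<le> \<bar>cmod (w x)\<bar> * \<bar>cmod (w y)\<bar> * k (x - y)" if "x \<noteq> y" for x y
  proof (cases "x \<in> A \<and> y \<in> A")
    case True
    then show ?thesis using K[of x y] that
      by (simp add: KK_def H_def G_def norm_mult mult_left_mono)
  next
    case False
    then show ?thesis using wA k0 by (auto simp: KK_def H_def G_def)
  qed
  have "ennreal (LINT \<xi>|lborel. (cmod (V \<xi>))\<^sup>2) = ennreal (cmod (LINT p|lborel. KK p))"
    unfolding E[symmetric] norm_of_real by simp
  also have "\<dots> \<le> (\<integral>\<^sup>+p. ennreal (norm (KK p)) \<partial>(lborel \<Otimes>\<^sub>M lborel))"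
    unfolding lborel_prod by (rule integral_norm_bound_ennreal[OF KKi])
  also have "\<dots> = (\<integral>\<^sup>+x. \<integral>\<^sup>+y. ennreal (norm (KK (x, y))) \<partial>lborel \<partial>lborel)"
    by (rule lborel.nn_integral_fst[symmetric]) (simp add: lborel_prod)
  also have "\<dots> \<le> (\<integral>\<^sup>+x. \<integral>\<^sup>+y. ennreal (\<bar>cmod (w x)\<bar> * \<bar>cmod (w y)\<bar> * k (x - y)) \<partial>lborel \<partial>lborel)"
  proof (rule nn_integral_mono, rule nn_integral_mono_AE)
    fix x :: real
    show "AE y in lborel. ennreal (norm (KK (x, y))) \<le> ennreal (\<bar>cmod (w x)\<bar> * \<bar>cmod (w y)\<bar> * k (x - y))"
      by (rule AE_mp[OF AE_lborel_singleton[of x] AE_I2]) (use KKb[of x] in \<open>auto intro!: ennreal_leI\<close>)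
  qed
  also have "\<dots> \<le> (\<integral>\<^sup>+z. ennreal (k z) \<partial>lborel) * (\<integral>\<^sup>+x. ennreal ((cmod (w x))\<^sup>2) \<partial>lborel)"
    by (rule schur_test_convolution) (use k0 in auto)
  also have "\<dots> = ennreal ((LINT z|lborel. k z) * (LINT x|lborel. (cmod (w x))\<^sup>2))"
    using k0 ki w2 by (simp add: nn_integral_eq_integral ennreal_mult')
  finally have "(LINT \<xi>|lborel. (cmod (V \<xi>))\<^sup>2) \<le> (LINT z|lborel. k z) * (LINT x|lborel. (cmod (w x))\<^sup>2)"
    using k0 by (subst (asm) ennreal_le_iff) (auto intro!: mult_nonneg_nonneg integral_nonneg_AE)
  also have "\<dots> \<le> \<kappa> * (LINT x|lborel. (cmod (w x))\<^sup>2)"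
    using kk by (intro mult_right_mono) auto
  finally show ?J unfolding V_def .
qed


text \<open>The dual form of the preceding bound, with the arithmetic-geometric inequality in the role of
  the Cauchy--Schwarz inequality.\<close>
lemma TT_star_dual_bound:
  fixes \<phi> :: "real \<Rightarrow> real \<Rightarrow> complex" and h :: "real \<Rightarrow> complex" and k \<rho> :: "real \<Rightarrow> real"
  assumes phi[measurable]: "(\<lambda>(x, \<xi>). \<phi> x \<xi>) \<in> borel_measurable (borel \<Otimes>\<^sub>M borel)"
    and rho: "\<And>x \<xi>. cmod (\<phi> x \<xi>) \<le> \<rho> \<xi>" and rho2: "integrable lborel (\<lambda>\<xi>. (\<rho> \<xi>)\<^sup>2)"
    and h[measurable]: "h \<in> borel_measurable borel" and h2: "integrable lborel (\<lambda>x. (cmod (h x))\<^sup>2)"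
    and A[measurable]: "A \<in> sets borel" and A2: "emeasure lborel A < \<infinity>"
    and K: "\<And>x y. x \<in> A \<Longrightarrow> y \<in> A \<Longrightarrow> x \<noteq> y \<Longrightarrow> cmod (LINT \<xi>|lborel. \<phi> x \<xi> * cnj (\<phi> y \<xi>)) \<le> k (x - y)"
    and k0: "\<And>z. k z \<ge> 0" and ki: "integrable lborel k" and kk: "(LINT z|lborel. k z) \<le> \<kappa>" and kappa: "\<kappa> > 0"
  shows "integrable lborel (\<lambda>x. indicator A x * (cmod (LINT \<xi>|lborel. cnj (\<phi> x \<xi>) * h \<xi>))\<^sup>2)" (is ?I)
    and "(LINT x|lborel. indicator A x * (cmod (LINT \<xi>|lborel. cnj (\<phi> x \<xi>) * h \<xi>))\<^sup>2) \<le> \<kappa> * (LINT x|lborel. (cmod (h x))\<^sup>2)" (is ?J)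
proof -
  have phix[measurable]: "\<phi> x \<in> borel_measurable borel" for x
    using measurable_compose[OF measurable_Pair1' phi, of x] by simp
  have rho0: "\<rho> \<xi> \<ge> 0" for \<xi> using rho[of 0 \<xi>] norm_ge_zero order_trans by blast
  have bi: "integrable lborel (\<lambda>\<xi>. (\<rho> \<xi>)\<^sup>2 / 2 + (cmod (h \<xi>))\<^sup>2 / 2)" using rho2 h2 by auto
  have pb: "norm (cnj (\<phi> x \<xi>) * h \<xi>) \<le> (\<rho> \<xi>)\<^sup>2 / 2 + (cmod (h \<xi>))\<^sup>2 / 2" for x \<xi>
  proof -
    have "norm (cnj (\<phi> x \<xi>) * h \<xi>) \<le> \<rho> \<xi> * cmod (h \<xi>)"
      using rho by (auto simp: norm_mult intro: mult_right_mono)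
    also have "\<dots> \<le> (\<rho> \<xi>)\<^sup>2 / 2 + (cmod (h \<xi>))\<^sup>2 / 2"
      using sum_squares_bound[of "\<rho> \<xi>" "cmod (h \<xi>)"] by simp
    finally show ?thesis .
  qed
  have phi_i: "integrable lborel (\<lambda>\<xi>. cnj (\<phi> x \<xi>) * h \<xi>)" for x
    using pb by (intro Bochner_Integration.integrable_bound[OF bi] AE_I2) (auto intro: order_trans)
  define T where "T x = (LINT \<xi>|lborel. cnj (\<phi> x \<xi>) * h \<xi>)" for x
  \<comment> \<open>A uniform bound on \<open>T\<close>. Together with the finite measure of
    \<open>A\<close> it puts the restriction \<open>w\<close> into L1 and L2, so the norm that is
    absorbed at the end is known to be finite.\<close>
  define B where "B = (LINT \<xi>|lborel. (\<rho> \<xi>)\<^sup>2 / 2 + (cmod (h \<xi>))\<^sup>2 / 2)"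
  have TB: "cmod (T x) \<le> B" for x
    unfolding T_def B_def
    by (rule order_trans[OF integral_norm_bound integral_mono[OF integrable_norm[OF phi_i] bi pb]])
  have [measurable]: "T \<in> borel_measurable borel"
  proof -
    have "(\<lambda>(x,\<xi>). cnj (\<phi> x \<xi>) * h \<xi>) \<in> borel_measurable (borel \<Otimes>\<^sub>M lborel)"
      using borel_measurable_cnj[OF phi] unfolding case_prod_beta by measurable
    then have "(\<lambda>x. LINT \<xi>|lborel. cnj (\<phi> x \<xi>) * h \<xi>) \<in> borel_measurable borel"
      by (rule lborel.borel_measurable_lebesgue_integral)
    then show ?thesis by (simp add: T_def[abs_def])
  qed
  \<comment> \<open>The dual pairing is tested against the function to be estimated itself, so the
    square of its norm becomes the integral of \<open>V \<xi> * cnj (h \<xi>)\<close>.\<close>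
  define w where "w x = indicator A x * T x" for x
  have [measurable]: "w \<in> borel_measurable borel" unfolding w_def[abs_def] by measurable
  have iA: "integrable lborel (\<lambda>x. indicator A x * c)" for c :: real
    using A2 by (intro integrable_mult_left integrable_real_indicator) auto
  have wB: "cmod (w x) \<le> indicator A x * B" for x using TB by (simp add: w_def indicator_def)
  have w1: "integrable lborel w"
    using order_trans[OF wB abs_ge_self] by (intro Bochner_Integration.integrable_bound[OF iA[of B]] AE_I2) auto
  have w2': "indicator A x * (cmod (T x))\<^sup>2 = (cmod (w x))\<^sup>2" for x by (simp add: w_def indicator_def)
  have w2: "integrable lborel (\<lambda>x. (cmod (w x))\<^sup>2)"
  proof (rule Bochner_Integration.integrable_bound[OF iA[of "B\<^sup>2"]])
    have "(cmod (w x))\<^sup>2 \<le> indicator A x * B\<^sup>2" for x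
      using power_mono[OF TB[of x], of 2] by (simp add: w_def indicator_def)
    then show "AE x in lborel. norm ((cmod (w x))\<^sup>2) \<le> norm (indicat_real A x * B\<^sup>2)" by auto
  qed simp
  show ?I unfolding T_def[symmetric] w2' by (rule w2)
  define V where "V \<xi> = (LINT x|lborel. \<phi> x \<xi> * w x)" for \<xi>
  note tt = TT_star_bound[OF phi rho rho2 w1 w2 _ K k0 ki kk, folded V_def]
  have V2: "integrable lborel (\<lambda>\<xi>. (cmod (V \<xi>))\<^sup>2)"
    and VJ: "(LINT \<xi>|lborel. (cmod (V \<xi>))\<^sup>2) \<le> \<kappa> * (LINT x|lborel. (cmod (w x))\<^sup>2)"
    by (rule tt; simp add: w_def)+
  have Hi: "integrable (lborel \<Otimes>\<^sub>M lborel) (\<lambda>(x, \<xi>). w x * (\<phi> x \<xi> * cnj (h \<xi>)))"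
  proof (rule lborel_pair.Fubini_integrable)
    show Hm: "(\<lambda>(x, \<xi>). w x * (\<phi> x \<xi> * cnj (h \<xi>))) \<in> borel_measurable (lborel \<Otimes>\<^sub>M lborel)"
      using phi unfolding case_prod_beta by measurable
    show "AE x in lborel. integrable lborel (\<lambda>\<xi>. case (x, \<xi>) of (x, \<xi>) \<Rightarrow> w x * (\<phi> x \<xi> * cnj (h \<xi>)))"
      using phi_i[THEN complex_integrable_cnj[THEN iffD2]] by simp
    show "integrable lborel (\<lambda>x. LINT \<xi>|lborel. norm (case (x, \<xi>) of (x, \<xi>) \<Rightarrow> w x * (\<phi> x \<xi> * cnj (h \<xi>))))"
    proof (rule Bochner_Integration.integrable_bound)
      show "integrable lborel (\<lambda>x. norm (w x) * B)" using w1 by simp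
      show "(\<lambda>x. LINT \<xi>|lborel. norm (case (x, \<xi>) of (x, \<xi>) \<Rightarrow> w x * (\<phi> x \<xi> * cnj (h \<xi>)))) \<in> borel_measurable lborel"
        using Hm by (intro lborel.borel_measurable_lebesgue_integral) (simp add: case_prod_beta)
      have "(LINT \<xi>|lborel. norm (w x * (\<phi> x \<xi> * cnj (h \<xi>)))) \<le> norm (w x) * B" for x
      proof -
        have "(LINT \<xi>|lborel. norm (cnj (\<phi> x \<xi>) * h \<xi>)) \<le> B"
          unfolding B_def by (rule integral_mono[OF integrable_norm[OF phi_i] bi pb])
        then have "norm (w x) * (LINT \<xi>|lborel. norm (cnj (\<phi> x \<xi>) * h \<xi>)) \<le> norm (w x) * B"
          by (intro mult_left_mono) auto
        then show ?thesis by (simp add: norm_mult)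
      qed
      moreover have "B \<ge> 0" using TB[of 0] norm_ge_zero order_trans by blast
      ultimately show "AE x in lborel. norm (LINT \<xi>|lborel. norm (case (x, \<xi>) of (x, \<xi>) \<Rightarrow> w x * (\<phi> x \<xi> * cnj (h \<xi>)))) \<le> norm (norm (w x) * B)"
        by (auto simp: abs_mult)
    qed
  qed
  have "complex_of_real (LINT x|lborel. (cmod (w x))\<^sup>2) = (LINT x|lborel. w x * cnj (w x))"
    by (subst integral_complex_of_real[symmetric]) (simp add: complex_mult_cnj cmod_power2)
  also have "\<dots> = (LINT x|lborel. LINT \<xi>|lborel. w x * (\<phi> x \<xi> * cnj (h \<xi>)))"
  proof (rule Bochner_Integration.integral_cong)
    fix x
    have "cnj (T x) = (LINT \<xi>|lborel. \<phi> x \<xi> * cnj (h \<xi>))"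
      unfolding T_def by (subst Bochner_Integration.integral_cnj[symmetric]) (simp del: Bochner_Integration.integral_cnj)
    moreover have "w x * cnj (w x) = w x * cnj (T x)" by (simp add: w_def indicator_def)
    ultimately show "w x * cnj (w x) = (LINT \<xi>|lborel. w x * (\<phi> x \<xi> * cnj (h \<xi>)))" by simp
  qed simp
  also have "\<dots> = (LINT \<xi>|lborel. LINT x|lborel. w x * (\<phi> x \<xi> * cnj (h \<xi>)))"
    by (rule lborel_pair.Fubini_integral[OF Hi, symmetric])
  also have "\<dots> = (LINT \<xi>|lborel. V \<xi> * cnj (h \<xi>))"
  proof (rule Bochner_Integration.integral_cong)
    fix \<xi>
    have "w x * (\<phi> x \<xi> * cnj (h \<xi>)) = (\<phi> x \<xi> * w x) * cnj (h \<xi>)" for x by simp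
    then show "(LINT x|lborel. w x * (\<phi> x \<xi> * cnj (h \<xi>))) = V \<xi> * cnj (h \<xi>)"
      unfolding V_def by (simp only: integral_mult_left_zero)
  qed simp
  finally have E: "complex_of_real (LINT x|lborel. (cmod (w x))\<^sup>2) = (LINT \<xi>|lborel. V \<xi> * cnj (h \<xi>))" .
  have Vm: "V \<in> borel_measurable borel"
  proof -
    have "(\<lambda>(\<xi>,x). \<phi> x \<xi> * w x) \<in> borel_measurable (borel \<Otimes>\<^sub>M lborel)"
      using measurable_compose[OF measurable_Pair[OF measurable_snd measurable_fst] phi] unfolding case_prod_beta by measurable
    then have "(\<lambda>\<xi>. LINT x|lborel. \<phi> x \<xi> * w x) \<in> borel_measurable borel"
      by (rule lborel.borel_measurable_lebesgue_integral)
    then show ?thesis by (simp add: V_def[abs_def])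
  qed
  note [measurable] = Vm
  \<comment> \<open>The weights \<open>1 / (2*\<kappa>)\<close> and \<open>\<kappa> / 2\<close> are
    balanced so that the bound on \<open>V\<close> returns exactly half of the norm of
    \<open>w\<close>, which moves to the left-hand side.\<close>
  have vi: "integrable lborel (\<lambda>\<xi>. (cmod (V \<xi>))\<^sup>2 / (2*\<kappa>) + \<kappa> / 2 * (cmod (h \<xi>))\<^sup>2)" using V2 h2 by auto
  have vb: "norm (V \<xi> * cnj (h \<xi>)) \<le> (cmod (V \<xi>))\<^sup>2 / (2*\<kappa>) + \<kappa> / 2 * (cmod (h \<xi>))\<^sup>2" for \<xi>
  proof -
    have "2 * (cmod (V \<xi>) / sqrt \<kappa>) * (sqrt \<kappa> * cmod (h \<xi>)) \<le> (cmod (V \<xi>) / sqrt \<kappa>)\<^sup>2 + (sqrt \<kappa> * cmod (h \<xi>))\<^sup>2"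
      by (rule sum_squares_bound)
    then show ?thesis using kappa by (simp add: norm_mult power_divide power_mult_distrib field_simps)
  qed
  have vhi: "integrable lborel (\<lambda>\<xi>. V \<xi> * cnj (h \<xi>))"
    using order_trans[OF vb abs_ge_self] by (intro Bochner_Integration.integrable_bound[OF vi] AE_I2) auto
  have "(LINT x|lborel. (cmod (w x))\<^sup>2) = cmod (LINT \<xi>|lborel. V \<xi> * cnj (h \<xi>))"
    unfolding E[symmetric] norm_of_real by simp
  also have "\<dots> \<le> (LINT \<xi>|lborel. (cmod (V \<xi>))\<^sup>2 / (2*\<kappa>) + \<kappa> / 2 * (cmod (h \<xi>))\<^sup>2)"
    by (rule order_trans[OF integral_norm_bound integral_mono[OF integrable_norm[OF vhi] vi vb]])
  also have "\<dots> = (LINT \<xi>|lborel. (cmod (V \<xi>))\<^sup>2) / (2*\<kappa>) + \<kappa> / 2 * (LINT \<xi>|lborel. (cmod (h \<xi>))\<^sup>2)"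
    using V2 h2 by simp
  also have "(LINT \<xi>|lborel. (cmod (V \<xi>))\<^sup>2) / (2*\<kappa>) \<le> (\<kappa> * (LINT x|lborel. (cmod (w x))\<^sup>2)) / (2*\<kappa>)"
    using VJ kappa by (intro divide_right_mono) auto
  finally have "(LINT x|lborel. (cmod (w x))\<^sup>2) \<le> (LINT x|lborel. (cmod (w x))\<^sup>2) / 2 + \<kappa> / 2 * (LINT \<xi>|lborel. (cmod (h \<xi>))\<^sup>2)"
    using kappa by simp
  then show ?J unfolding T_def[symmetric] w2' by simp
qed

section \<open>Square-integrable Fourier transforms\<close>

lemma le_one_plus_square: "(x::real) \<le> 1 + x\<^sup>2"
proof -
  have "2 * x \<le> 1 + x\<^sup>2" using sum_squares_bound[of 1 x] by simp
  then show ?thesis using zero_le_power2[of x] by linarith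
qed

lemma AE_summable_norm:
  fixes F :: "nat \<Rightarrow> real \<Rightarrow> complex"
  assumes Fi: "\<And>k. integrable lborel (F k)" and sumF: "summable (\<lambda>k. LINT x|lborel. norm (F k x))"
  shows "AE x in lborel. summable (\<lambda>k. norm (F k x))"
proof -
  have [measurable]: "F k \<in> borel_measurable borel" for k using borel_measurable_integrable[OF Fi[of k]] by simp
  have "(\<integral>\<^sup>+x. (\<Sum>k. ennreal (norm (F k x))) \<partial>lborel) = (\<Sum>k. \<integral>\<^sup>+x. ennreal (norm (F k x)) \<partial>lborel)"
    by (rule nn_integral_suminf) measurable
  also have "\<dots> = (\<Sum>k. ennreal (LINT x|lborel. norm (F k x)))"
    using Fi by (intro suminf_cong nn_integral_eq_integral) auto
  also have "\<dots> = ennreal (\<Sum>k. LINT x|lborel. norm (F k x))"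
    by (rule suminf_ennreal2[OF _ sumF]) (auto intro: Bochner_Integration.integral_nonneg)
  finally have "(\<integral>\<^sup>+x. (\<Sum>k. ennreal (norm (F k x))) \<partial>lborel) \<noteq> \<infinity>" by simp
  then have "AE x in lborel. (\<Sum>k. ennreal (norm (F k x))) \<noteq> \<infinity>"
    by (intro nn_integral_PInf_AE) auto
  then show ?thesis
    by eventually_elim (rule summable_suminf_not_top, auto)
qed

lemma fatou_bound:
  fixes f :: "nat \<Rightarrow> 'a \<Rightarrow> real"
  assumes f: "\<And>n. integrable M (f n)" and f0: "\<And>n x. f n x \<ge> 0" and C: "\<And>n. (LINT x|M. f n x) \<le> C"
    and gm: "g \<in> borel_measurable M" and g0: "\<And>x. g x \<ge> 0" and lim: "AE x in M. (\<lambda>n. f n x) \<longlonglongrightarrow> g x"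
  shows "integrable M g" "(LINT x|M. g x) \<le> C"
proof -
  have [measurable]: "f n \<in> borel_measurable M" for n by (rule borel_measurable_integrable[OF f])
  have C0: "C \<ge> 0" by (rule order_trans[OF Bochner_Integration.integral_nonneg C[of 0]]) (rule f0)
  have "(\<integral>\<^sup>+x. ennreal (g x) \<partial>M) = (\<integral>\<^sup>+x. liminf (\<lambda>n. ennreal (f n x)) \<partial>M)"
  proof (rule nn_integral_cong_AE)
    show "AE x in M. ennreal (g x) = liminf (\<lambda>n. ennreal (f n x))"
      using lim by eventually_elim (rule lim_imp_Liminf[symmetric], auto)
  qed
  also have "\<dots> \<le> liminf (\<lambda>n. \<integral>\<^sup>+x. ennreal (f n x) \<partial>M)"
    by (rule nn_integral_liminf) auto
  also have "\<dots> \<le> liminf (\<lambda>n::nat. ennreal C)"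
    using f f0 C by (intro Liminf_mono always_eventually allI) (simp add: nn_integral_eq_integral ennreal_leI)
  also have "\<dots> = ennreal C" by (simp add: Liminf_const)
  finally have le: "(\<integral>\<^sup>+x. ennreal (g x) \<partial>M) \<le> ennreal C" .
  show gi: "integrable M g"
    using le g0 gm by (intro integrableI_nonneg) (auto simp: top_unique less_top[symmetric])
  show "(LINT x|M. g x) \<le> C"
    using le C0 g0 by (simp add: nn_integral_eq_integral[OF gi])
qed

section \<open>Absolutely convergent Fourier integrals\<close>

definition fourier_int :: "(real \<Rightarrow> complex) \<Rightarrow> real \<Rightarrow> complex" where
  "fourier_int u \<xi> = (LINT x|lborel. exp (- (\<i> * complex_of_real (x * \<xi>))) * u x)"

lemma cmod_exp_minus_i [simp]: "cmod (exp (- (\<i> * complex_of_real r))) = 1"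
  using norm_exp_i_times[of "-r"] by simp

lemma fourier_int_integrable:
  "integrable lborel u \<Longrightarrow> integrable lborel (\<lambda>x. exp (- (\<i> * complex_of_real (x * \<xi>))) * u x)"
  by (rule Bochner_Integration.integrable_bound[where f = u]) (auto simp: norm_mult)

lemma fourier_int_measurable [measurable]: "u \<in> borel_measurable borel \<Longrightarrow> fourier_int u \<in> borel_measurable borel"
proof -
  assume [measurable]: "u \<in> borel_measurable borel"
  have "(\<lambda>\<xi>. LINT x|lborel. exp (- (\<i> * complex_of_real (x * \<xi>))) * u x) \<in> borel_measurable borel"
    by (rule lborel.borel_measurable_lebesgue_integral) measurable
  then show ?thesis by (simp add: fourier_int_def[abs_def])
qed

lemma fourier_int_bound:
  assumes "integrable lborel u"
  shows "cmod (fourier_int u \<xi>) \<le> (LINT x|lborel. norm (u x))"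
  unfolding fourier_int_def
  by (rule order_trans[OF integral_norm_bound]) (simp add: norm_mult)

text \<open>The phase is damped by \<open>exp (- (e n * \<xi>\<^sup>2))\<close>. The resulting
  kernel is a Gaussian in \<open>x - y\<close> whose mass is \<open>2 * pi\<close> for every
  \<open>n\<close>, so \<open>TT_star_bound\<close> gives a uniform constant, and Fatou removes the
  damping.\<close>

lemma plancherel_le:
  fixes u :: "real \<Rightarrow> complex"
  assumes u1: "integrable lborel u" and u2: "integrable lborel (\<lambda>x. (cmod (u x))\<^sup>2)"
  shows "integrable lborel (\<lambda>\<xi>. (cmod (fourier_int u \<xi>))\<^sup>2)"
    and "(LINT \<xi>|lborel. (cmod (fourier_int u \<xi>))\<^sup>2) \<le> 2 * pi * (LINT x|lborel. (cmod (u x))\<^sup>2)"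
proof -
  have [measurable]: "u \<in> borel_measurable borel" using u1 by auto
  define e where "e n = 1 / real (Suc n)" for n
  have e: "e n > 0" for n by (simp add: e_def)
  have elim: "e \<longlonglongrightarrow> 0" unfolding e_def[abs_def] by (rule LIMSEQ_Suc[OF lim_1_over_n])
  define \<phi> where "\<phi> n x \<xi> = exp (- (\<i> * complex_of_real (x * \<xi>))) * complex_of_real (exp (- (e n * \<xi>\<^sup>2)))" for n x \<xi>
  have key: "integrable lborel (\<lambda>\<xi>. (cmod (LINT x|lborel. \<phi> n x \<xi> * u x))\<^sup>2)
     \<and> (LINT \<xi>|lborel. (cmod (LINT x|lborel. \<phi> n x \<xi> * u x))\<^sup>2) \<le> (2*pi) * (LINT x|lborel. (cmod (u x))\<^sup>2)" for n
  proof -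
    define c where "c = 2 * e n"
    define k where "k z = sqrt (pi / c) * exp (- (1 / (4 * c) * z\<^sup>2))" for z
    have c: "c > 0" using e by (simp add: c_def)
    have kb: "has_bochner_integral lborel k (sqrt (pi / c) * sqrt (pi / (1 / (4*c))))"
      unfolding k_def using gaussian_has_integral[of "1/(4*c)" 0] c by (intro has_bochner_integral_mult_right) auto
    have kval: "sqrt (pi / c) * sqrt (pi / (1 / (4*c))) = 2 * pi"
      using c by (simp add: real_sqrt_mult real_sqrt_divide)
    have m: "(\<lambda>(x, \<xi>). \<phi> n x \<xi>) \<in> borel_measurable (borel \<Otimes>\<^sub>M borel)"
      unfolding \<phi>_def by measurable
    have r: "cmod (\<phi> n x \<xi>) \<le> exp (- (e n * \<xi>\<^sup>2))" for x \<xi> by (simp add: \<phi>_def norm_mult)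
    have r2: "(exp (- (e n * \<xi>\<^sup>2)))\<^sup>2 = exp (- (c * \<xi>\<^sup>2))" for \<xi>
      by (simp add: c_def power2_eq_square exp_add[symmetric])
    have ri: "integrable lborel (\<lambda>\<xi>. (exp (- (e n * \<xi>\<^sup>2)))\<^sup>2)"
      unfolding r2 by (rule integrable_gaussian(2)[OF c])
    have K: "cmod (LINT \<xi>|lborel. \<phi> n x \<xi> * cnj (\<phi> n y \<xi>)) \<le> k (x - y)" for x y
    proof -
      have "\<phi> n x \<xi> * cnj (\<phi> n y \<xi>) = exp (\<i> * complex_of_real ((y - x) * \<xi>)) * complex_of_real (exp (- (c * \<xi>\<^sup>2)))" for \<xi>
      proof -
        have "\<phi> n x \<xi> * cnj (\<phi> n y \<xi>) = (exp (\<i> * complex_of_real (y * \<xi>)) * exp (- (\<i> * complex_of_real (x * \<xi>)))) * complex_of_real ((exp (- (e n * \<xi>\<^sup>2)))\<^sup>2)"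
          by (simp add: \<phi>_def exp_cnj power2_eq_square)
        then show ?thesis unfolding iexp_diff r2 by (simp add: left_diff_distrib)
      qed
      then have "(LINT \<xi>|lborel. \<phi> n x \<xi> * cnj (\<phi> n y \<xi>)) = complex_of_real (sqrt (pi / c) * exp (- (y - x)\<^sup>2 / (4 * c)))"
        using gaussian_fourier_integral[OF c, of "y - x"] by simp
      then show ?thesis using c by (simp add: k_def norm_mult power2_commute)
    qed
    have "integrable lborel k" "(LINT z|lborel. k z) \<le> 2 * pi"
      using kb kval by (auto simp: has_bochner_integral_iff)
    from TT_star_bound[OF m r ri u1 u2 _ K _ this, of UNIV] c show ?thesis by (auto simp: k_def)
  qed
  have pull: "(cmod (LINT x|lborel. \<phi> n x \<xi> * u x))\<^sup>2 = (cmod (fourier_int u \<xi>))\<^sup>2 * (exp (- (e n * \<xi>\<^sup>2)))\<^sup>2" for n \<xi>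
  proof -
    have "\<phi> n x \<xi> * u x = (exp (- (\<i> * complex_of_real (x * \<xi>))) * u x) * complex_of_real (exp (- (e n * \<xi>\<^sup>2)))" for x
      by (simp add: \<phi>_def)
    then have "(LINT x|lborel. \<phi> n x \<xi> * u x) = fourier_int u \<xi> * complex_of_real (exp (- (e n * \<xi>\<^sup>2)))"
      by (simp only: integral_mult_left_zero fourier_int_def)
    then show ?thesis by (simp add: norm_mult power_mult_distrib)
  qed
  have lim: "(\<lambda>n. (cmod (LINT x|lborel. \<phi> n x \<xi> * u x))\<^sup>2) \<longlonglongrightarrow> (cmod (fourier_int u \<xi>))\<^sup>2" for \<xi>
  proof -
    have "(\<lambda>n. (cmod (fourier_int u \<xi>))\<^sup>2 * (exp (- (e n * \<xi>\<^sup>2)))\<^sup>2) \<longlonglongrightarrow> (cmod (fourier_int u \<xi>))\<^sup>2 * (exp (- (0 * \<xi>\<^sup>2)))\<^sup>2"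
      by (intro tendsto_intros elim)
    then show ?thesis unfolding pull by simp
  qed
  note fb = fatou_bound[where f = "\<lambda>n \<xi>. (cmod (LINT x|lborel. \<phi> n x \<xi> * u x))\<^sup>2",
      OF conjunct1[OF key] zero_le_power2 conjunct2[OF key] _ zero_le_power2 AE_I2[OF lim]]
  show "integrable lborel (\<lambda>\<xi>. (cmod (fourier_int u \<xi>))\<^sup>2)" by (rule fb) measurable
  show "(LINT \<xi>|lborel. (cmod (fourier_int u \<xi>))\<^sup>2) \<le> 2 * pi * (LINT x|lborel. (cmod (u x))\<^sup>2)" by (rule fb) measurable
qed

lemma truncated_fourier:
  "(LINT x|lborel. indicator A x * exp (- (\<i> * complex_of_real (x * \<xi>))) * f x) = fourier_int (\<lambda>x. indicator A x * f x) \<xi>"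
  unfolding fourier_int_def by (simp add: mult_ac)

text \<open>The truncation error is the transform of the tail \<open>u R\<close> outside
  \<open>{-R..R}\<close>. Its norm is at most that of the tail by \<open>plancherel_le\<close>, and
  the tail tends to zero by dominated convergence.\<close>

lemma fourier_L2_fourier_int:
  assumes f1: "integrable lborel f" and f2: "integrable lborel (\<lambda>x. (cmod (f x))\<^sup>2)"
  shows "fourier_L2 f (fourier_int f)"
proof -
  have [measurable]: "f \<in> borel_measurable borel" using f1 by auto
  define u where "u R x = indicator (- {-R..R}) x * f x" for R x
  have nu: "(cmod (u R x))\<^sup>2 = indicator (- {-R..R}) x * (cmod (f x))\<^sup>2" for R x by (simp add: u_def indicator_def)
  have u1: "integrable lborel (u R)" for R
    unfolding u_def by (rule Bochner_Integration.integrable_bound[OF f1]) (auto simp: indicator_def)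
  have u2: "integrable lborel (\<lambda>x. (cmod (u R x))\<^sup>2)" for R
    unfolding nu by (rule Bochner_Integration.integrable_bound[OF f2]) (auto simp: indicator_def)
  have diff: "fourier_int f \<xi> - fourier_int (\<lambda>x. indicator {-R..R} x * f x) \<xi> = fourier_int (u R) \<xi>" for R \<xi>
  proof -
    have i: "integrable lborel (\<lambda>x. indicator {-R..R} x * f x)"
      by (rule Bochner_Integration.integrable_bound[OF f1]) (auto simp: indicator_def)
    show ?thesis unfolding fourier_int_def u_def
      by (subst Bochner_Integration.integral_diff[symmetric, OF fourier_int_integrable[OF f1] fourier_int_integrable[OF i]])
         (auto intro!: Bochner_Integration.integral_cong simp: indicator_def)
  qed
  have [measurable]: "u R \<in> borel_measurable borel" for R using u1 by auto
  have A: "AE x in lborel. ((\<lambda>R. (cmod (u R x))\<^sup>2) \<longlongrightarrow> 0) at_top"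
  proof (rule AE_I2, rule tendsto_eventually)
    fix x :: real
    show "\<forall>\<^sub>F R in at_top. (cmod (u R x))\<^sup>2 = 0"
      using eventually_ge_at_top[of "\<bar>x\<bar>"] by eventually_elim (auto simp: u_def indicator_def)
  qed
  have B: "\<forall>\<^sub>F R in at_top. AE x in lborel. norm ((cmod (u R x))\<^sup>2) \<le> (cmod (f x))\<^sup>2"
    by (auto simp: nu indicator_def)
  have "((\<lambda>R. LINT x|lborel. (cmod (u R x))\<^sup>2) \<longlongrightarrow> (LINT x|(lborel :: real measure). (0::real))) at_top"
    by (rule integral_dominated_convergence_at_top[OF _ _ f2 A B]) auto
  then have "((\<lambda>R. 2 * pi * (LINT x|lborel. (cmod (u R x))\<^sup>2)) \<longlongrightarrow> 2 * pi * (LINT x|(lborel :: real measure). (0::real))) at_top"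
    by (rule tendsto_mult_left)
  then have l0: "((\<lambda>R. 2 * pi * (LINT x|lborel. (cmod (u R x))\<^sup>2)) \<longlongrightarrow> 0) at_top" by simp
  have "((\<lambda>R. LINT \<xi>|lborel. (cmod (fourier_int (u R) \<xi>))\<^sup>2) \<longlongrightarrow> 0) at_top"
  proof (rule tendsto_sandwich[OF _ _ tendsto_const l0])
    show "\<forall>\<^sub>F R in at_top. 0 \<le> (LINT \<xi>|lborel. (cmod (fourier_int (u R) \<xi>))\<^sup>2)"
      by (intro always_eventually allI Bochner_Integration.integral_nonneg) auto
    show "\<forall>\<^sub>F R in at_top. (LINT \<xi>|lborel. (cmod (fourier_int (u R) \<xi>))\<^sup>2) \<le> 2 * pi * (LINT x|lborel. (cmod (u R x))\<^sup>2)"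
      using plancherel_le(2)[OF u1 u2] by (intro always_eventually allI)
  qed
  then show ?thesis
    unfolding fourier_L2_def L2_fun_def truncated_fourier diff using f2 plancherel_le(1)[OF f1 f2]
    by (intro conjI) (auto simp del: fourier_int_def)
qed

lemma fourier_multiplication_formula:
  assumes u: "integrable lborel u" and q: "integrable lborel q"
  shows "(LINT \<xi>|lborel. fourier_int u \<xi> * q \<xi>) = (LINT x|lborel. u x * fourier_int q x)"
proof -
  have [measurable]: "u \<in> borel_measurable borel" "q \<in> borel_measurable borel" using u q by auto
  have Hi: "integrable (lborel \<Otimes>\<^sub>M lborel) (\<lambda>(x, \<xi>). exp (- (\<i> * complex_of_real (x * \<xi>))) * u x * q \<xi>)"
  proof (rule lborel_pair.Fubini_integrable)
    show "AE x in lborel. integrable lborel (\<lambda>\<xi>. case (x, \<xi>) of (x, \<xi>) \<Rightarrow> exp (- (\<i> * complex_of_real (x * \<xi>))) * u x * q \<xi>)"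
    proof (rule AE_I2)
      fix x
      have "integrable lborel (\<lambda>\<xi>. u x * (exp (- (\<i> * complex_of_real (\<xi> * x))) * q \<xi>))"
        using fourier_int_integrable[OF q] by simp
      then show "integrable lborel (\<lambda>\<xi>. case (x, \<xi>) of (x, \<xi>) \<Rightarrow> exp (- (\<i> * complex_of_real (x * \<xi>))) * u x * q \<xi>)"
        by (simp add: mult_ac)
    qed
    show "integrable lborel (\<lambda>x. LINT \<xi>|lborel. norm (case (x, \<xi>) of (x, \<xi>) \<Rightarrow> exp (- (\<i> * complex_of_real (x * \<xi>))) * u x * q \<xi>))"
      using u q by (simp add: norm_mult)
  qed measurable
  have "(LINT \<xi>|lborel. fourier_int u \<xi> * q \<xi>) = (LINT \<xi>|lborel. LINT x|lborel. exp (- (\<i> * complex_of_real (x * \<xi>))) * u x * q \<xi>)"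
    unfolding fourier_int_def by simp
  also have "\<dots> = (LINT x|lborel. LINT \<xi>|lborel. exp (- (\<i> * complex_of_real (x * \<xi>))) * u x * q \<xi>)"
    by (rule lborel_pair.Fubini_integral[OF Hi])
  also have "\<dots> = (LINT x|lborel. u x * fourier_int q x)"
  proof (rule Bochner_Integration.integral_cong)
    fix x
    have "exp (- (\<i> * complex_of_real (x * \<xi>))) * u x * q \<xi> = u x * (exp (- (\<i> * complex_of_real (\<xi> * x))) * q \<xi>)" for \<xi>
      by (simp add: mult_ac)
    then show "(LINT \<xi>|lborel. exp (- (\<i> * complex_of_real (x * \<xi>))) * u x * q \<xi>) = u x * fourier_int q x"
      unfolding fourier_int_def by (simp only: integral_mult_right_zero)
  qed simp
  finally show ?thesis .
qed


section \<open>Parseval's identity against indicators of intervals\<close>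

lemma interval_indicator_L1_L2:
  fixes a b :: real
  shows "integrable lborel (indicator {a..b} :: real \<Rightarrow> complex)"
    and "integrable lborel (\<lambda>x. (cmod (indicator {a..b} x))\<^sup>2)"
proof -
  have *: "integrable lborel (indicator {a..b} :: real \<Rightarrow> real)"
    by (rule integrable_real_indicator) (auto simp: emeasure_lborel_Icc_eq)
  show "integrable lborel (indicator {a..b} :: real \<Rightarrow> complex)"
    by (rule Bochner_Integration.integrable_bound[OF *]) (auto simp: indicator_def)
  have "(cmod (indicator {a..b} x))\<^sup>2 = indicator {a..b} x" for x by (simp add: indicator_def)
  then show "integrable lborel (\<lambda>x. (cmod (indicator {a..b} x))\<^sup>2)" using * by simp
qed

text \<open>Up to the factor \<open>2 * pi\<close> this is the heat flow of an indicator. The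
  substitution \<open>y = x + 2 * sqrt (e n) * z\<close> makes the weight \<open>G\<close>
  independent of \<open>n\<close>, so dominated convergence applies wherever the indicator is
  continuous; the two endpoints are left out.\<close>

lemma heat_average_interval:
  fixes a b :: real and e :: "nat \<Rightarrow> real"
  assumes e: "\<And>n. e n > 0" and elim: "e \<longlonglongrightarrow> 0"
  defines "B \<equiv> \<lambda>n x. LINT y|lborel. indicator {a..b} y * (sqrt (pi / e n) * exp (- (x - y)\<^sup>2 / (4 * e n)))"
  shows "\<bar>B n x\<bar> \<le> 2 * pi" and "x \<noteq> a \<Longrightarrow> x \<noteq> b \<Longrightarrow> (\<lambda>n. B n x) \<longlonglongrightarrow> 2 * pi * indicator {a..b} x"
proof -
  define G where "G z = 2 * sqrt pi * exp (- (1 * (z - 0)\<^sup>2))" for z :: real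
  have "has_bochner_integral lborel G (2 * sqrt pi * sqrt (pi / 1))"
    unfolding G_def by (intro has_bochner_integral_mult_right gaussian_has_integral) auto
  then have Gi: "integrable lborel G" and GI: "(LINT z|lborel. G z) = 2 * pi"
    by (auto simp: has_bochner_integral_iff)
  have [measurable]: "G \<in> borel_measurable borel" using Gi by auto
  have G0: "G z \<ge> 0" for z by (simp add: G_def)
  have B: "B n x = (LINT z|lborel. indicator {a..b} (x + 2 * sqrt (e n) * z) * G z)" for n x
  proof -
    have s: "sqrt (e n) > 0" using e by simp
    have sub: "sqrt (pi / e n) * exp (- (x - (x + 2 * sqrt (e n) * z))\<^sup>2 / (4 * e n)) * (2 * sqrt (e n)) = G z" for z
    proof -
      have "(x - (x + 2 * sqrt (e n) * z))\<^sup>2 / (4 * e n) = z\<^sup>2" using e[of n] by (simp add: power_mult_distrib)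
      moreover have "sqrt (pi / e n) * (2 * sqrt (e n)) = 2 * sqrt pi" using s by (simp add: real_sqrt_divide)
      ultimately show ?thesis unfolding G_def by (simp add: mult_ac)
    qed
    have "B n x = 2 * sqrt (e n) * (LINT z|lborel. indicator {a..b} (x + 2 * sqrt (e n) * z) * (sqrt (pi / e n) * exp (- (x - (x + 2 * sqrt (e n) * z))\<^sup>2 / (4 * e n))))"
      unfolding B_def
      using lborel_integral_real_affine[of "2 * sqrt (e n)" "\<lambda>y. indicator {a..b} y * (sqrt (pi / e n) * exp (- (x - y)\<^sup>2 / (4 * e n)))" x] s
      by simp
    also have "\<dots> = (LINT z|lborel. (indicator {a..b} (x + 2 * sqrt (e n) * z) * (sqrt (pi / e n) * exp (- (x - (x + 2 * sqrt (e n) * z))\<^sup>2 / (4 * e n)))) * (2 * sqrt (e n)))"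
      by (subst integral_mult_left_zero) (rule mult.commute)
    also have "\<dots> = (LINT z|lborel. indicator {a..b} (x + 2 * sqrt (e n) * z) * G z)"
      by (simp only: mult.assoc sub[unfolded mult.assoc])
    finally show ?thesis .
  qed
  have bi: "integrable lborel (\<lambda>z. indicator {a..b} (x + 2 * sqrt (e n) * z) * G z)" for n x
    by (rule Bochner_Integration.integrable_bound[OF Gi]) (auto simp: indicator_def)
  have "\<bar>B n x\<bar> \<le> (LINT z|lborel. norm (indicator {a..b} (x + 2 * sqrt (e n) * z) * G z))"
    unfolding B using integral_norm_bound[of lborel "\<lambda>z. indicator {a..b} (x + 2 * sqrt (e n) * z) * G z"] by simp
  also have "\<dots> \<le> (LINT z|lborel. G z)"
    by (rule integral_mono[OF integrable_norm[OF bi] Gi]) (auto simp: indicator_def G0)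
  finally show "\<bar>B n x\<bar> \<le> 2 * pi" unfolding GI .
  show "(\<lambda>n. B n x) \<longlonglongrightarrow> 2 * pi * indicator {a..b} x" if x: "x \<noteq> a" "x \<noteq> b"
  proof -
    have "x \<notin> frontier {a..b}" using x by (auto simp: frontier_def)
    then have cont: "isCont (indicator {a..b} :: real \<Rightarrow> real) x" by (simp add: isCont_indicator)
    have "(\<lambda>n. LINT z|lborel. indicator {a..b} (x + 2 * sqrt (e n) * z) * G z) \<longlonglongrightarrow> (LINT z|lborel. indicator {a..b} x * G z)"
    proof (rule integral_dominated_convergence[where w = G])
      show "AE z in lborel. (\<lambda>n. indicator {a..b} (x + 2 * sqrt (e n) * z) * G z) \<longlonglongrightarrow> indicator {a..b} x * G z"
      proof (rule AE_I2)
        fix z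
        have "(\<lambda>n. x + 2 * sqrt (e n) * z) \<longlonglongrightarrow> x + 2 * sqrt 0 * z"
          by (intro tendsto_intros elim)
        then have "(\<lambda>n. x + 2 * sqrt (e n) * z) \<longlonglongrightarrow> x" by simp
        from isCont_tendsto_compose[OF cont this]
        show "(\<lambda>n. indicator {a..b} (x + 2 * sqrt (e n) * z) * G z) \<longlonglongrightarrow> indicator {a..b} x * G z"
          by (rule tendsto_mult_right)
      qed
      show "AE z in lborel. norm (indicator {a..b} (x + 2 * sqrt (e n) * z) * G z) \<le> G z" for n
        by (auto simp: indicator_def G0)
    qed (auto intro: Gi)
    then show ?thesis unfolding B by (simp add: GI mult.commute)
  qed
qed

text \<open>The transform of an indicator decays too slowly to be integrable, so it is multiplied by
  a Gaussian before \<open>fourier_multiplication_formula\<close> is used. On the other side the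
  regularised transform becomes the average of \<open>heat_average_interval\<close>, and both sides
  converge under fixed majorants.\<close>

lemma fourier_pairing_interval:
  fixes u :: "real \<Rightarrow> complex" and a b :: real
  assumes u1: "integrable lborel u" and u2: "integrable lborel (\<lambda>x. (cmod (u x))\<^sup>2)"
  shows "(LINT \<xi>|lborel. fourier_int u \<xi> * cnj (fourier_int (indicator {a..b}) \<xi>))
     = complex_of_real (2 * pi) * (LINT x|lborel. indicator {a..b} x * u x)"
proof -
  define e where "e n = 1 / real (Suc n)" for n
  have e: "e n > 0" for n by (simp add: e_def)
  have elim: "e \<longlonglongrightarrow> 0" unfolding e_def[abs_def] by (rule LIMSEQ_Suc[OF lim_1_over_n])
  define v :: "real \<Rightarrow> complex" where "v = indicator {a..b}"
  have v1: "integrable lborel v" and v2: "integrable lborel (\<lambda>x. (cmod (v x))\<^sup>2)"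
    unfolding v_def by (rule interval_indicator_L1_L2)+
  have [measurable]: "u \<in> borel_measurable borel" "v \<in> borel_measurable borel" using u1 v1 by auto
  define B where "B n x = (LINT y|lborel. indicator {a..b} y * (sqrt (pi / e n) * exp (- (x - y)\<^sup>2 / (4 * e n))))" for n x
  note Bb = heat_average_interval[where a = a and b = b, OF e elim, folded B_def]
  define q where "q n \<xi> = cnj (fourier_int v \<xi>) * complex_of_real (exp (- (e n * \<xi>\<^sup>2)))" for n \<xi>
  have [measurable]: "q n \<in> borel_measurable borel" for n unfolding q_def[abs_def] by measurable
  have qi: "integrable lborel (q n)" for n
  proof (rule Bochner_Integration.integrable_bound)
    show "integrable lborel (\<lambda>\<xi>. (LINT x|lborel. norm (v x)) * exp (- (e n * \<xi>\<^sup>2)))"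
      using integrable_gaussian(2)[OF e] by simp
    show "AE \<xi> in lborel. norm (q n \<xi>) \<le> norm ((LINT x|lborel. norm (v x)) * exp (- (e n * \<xi>\<^sup>2)))"
      using order_trans[OF fourier_int_bound[OF v1] abs_ge_self] by (auto simp: q_def norm_mult abs_mult intro!: mult_right_mono)
  qed simp
  have qB: "fourier_int (q n) x = complex_of_real (B n x)" for n x
  proof -
    define p where "p \<xi> = exp (\<i> * complex_of_real (x * \<xi>)) * complex_of_real (exp (- (e n * \<xi>\<^sup>2)))" for \<xi>
    have p1: "integrable lborel p"
      unfolding p_def using gaussian_fourier[OF e] by (auto simp: has_bochner_integral_iff)
    have ph: "fourier_int p y = complex_of_real (sqrt (pi / e n) * exp (- (x - y)\<^sup>2 / (4 * e n)))" for y
    proof -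
      have "exp (- (\<i> * complex_of_real (\<xi> * y))) * p \<xi> = exp (\<i> * complex_of_real ((x - y) * \<xi>)) * complex_of_real (exp (- (e n * \<xi>\<^sup>2)))" for \<xi>
      proof -
        have "exp (- (\<i> * complex_of_real (\<xi> * y))) * p \<xi> = (exp (\<i> * complex_of_real (x * \<xi>)) * exp (- (\<i> * complex_of_real (y * \<xi>)))) * complex_of_real (exp (- (e n * \<xi>\<^sup>2)))"
          by (simp add: p_def mult_ac)
        then show ?thesis unfolding iexp_diff by (simp add: left_diff_distrib)
      qed
      then show ?thesis unfolding fourier_int_def using gaussian_fourier_integral[OF e, of "x - y" n] by simp
    qed
    have "exp (- (\<i> * complex_of_real (\<xi> * x))) * q n \<xi> = cnj (fourier_int v \<xi> * p \<xi>)" for \<xi>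
      by (simp add: q_def p_def exp_cnj mult_ac)
    then have "fourier_int (q n) x = (LINT \<xi>|lborel. cnj (fourier_int v \<xi> * p \<xi>))"
      by (simp only: fourier_int_def)
    also have "\<dots> = cnj (LINT \<xi>|lborel. fourier_int v \<xi> * p \<xi>)"
      by (rule Bochner_Integration.integral_cnj)
    also have "(LINT \<xi>|lborel. fourier_int v \<xi> * p \<xi>) = (LINT y|lborel. v y * fourier_int p y)"
      by (rule fourier_multiplication_formula[OF v1 p1])
    also have "\<dots> = (LINT y|lborel. complex_of_real (indicator {a..b} y * (sqrt (pi / e n) * exp (- (x - y)\<^sup>2 / (4 * e n)))))"
      unfolding ph by (rule Bochner_Integration.integral_cong) (auto simp: v_def indicator_def)
    also have "\<dots> = complex_of_real (B n x)"
      unfolding B_def by (rule integral_complex_of_real)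
    finally show ?thesis by simp
  qed
  have Bm[measurable]: "(\<lambda>x. complex_of_real (B n x)) \<in> borel_measurable borel" for n
    unfolding qB[symmetric] by measurable
  have eq: "(LINT \<xi>|lborel. fourier_int u \<xi> * q n \<xi>) = (LINT x|lborel. u x * complex_of_real (B n x))" for n
    unfolding qB[symmetric] by (rule fourier_multiplication_formula[OF u1 qi])
  have L: "(\<lambda>n. LINT \<xi>|lborel. fourier_int u \<xi> * q n \<xi>) \<longlonglongrightarrow> (LINT \<xi>|lborel. fourier_int u \<xi> * cnj (fourier_int v \<xi>))"
  proof (rule integral_dominated_convergence)
    show "integrable lborel (\<lambda>\<xi>. (cmod (fourier_int u \<xi>))\<^sup>2 / 2 + (cmod (fourier_int v \<xi>))\<^sup>2 / 2)"
      using plancherel_le(1)[OF u1 u2] plancherel_le(1)[OF v1 v2] by auto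
    show "AE \<xi> in lborel. (\<lambda>n. fourier_int u \<xi> * q n \<xi>) \<longlonglongrightarrow> fourier_int u \<xi> * cnj (fourier_int v \<xi>)"
    proof (rule AE_I2)
      fix \<xi>
      have "(\<lambda>n. fourier_int u \<xi> * q n \<xi>) \<longlonglongrightarrow> fourier_int u \<xi> * (cnj (fourier_int v \<xi>) * complex_of_real (exp (- (0 * \<xi>\<^sup>2))))"
        unfolding q_def by (intro tendsto_intros elim)
      then show "(\<lambda>n. fourier_int u \<xi> * q n \<xi>) \<longlonglongrightarrow> fourier_int u \<xi> * cnj (fourier_int v \<xi>)" by simp
    qed
    show "AE \<xi> in lborel. norm (fourier_int u \<xi> * q n \<xi>) \<le> (cmod (fourier_int u \<xi>))\<^sup>2 / 2 + (cmod (fourier_int v \<xi>))\<^sup>2 / 2" for n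
    proof (rule AE_I2)
      fix \<xi>
      have "exp (- (e n * \<xi>\<^sup>2)) \<le> 1" using e[of n] by (simp add: less_imp_le)
      then have "norm (fourier_int u \<xi> * q n \<xi>) \<le> cmod (fourier_int u \<xi>) * cmod (fourier_int v \<xi>)"
        by (auto simp: q_def norm_mult intro!: mult_left_mono mult_right_le_one_le)
      also have "\<dots> \<le> (cmod (fourier_int u \<xi>))\<^sup>2 / 2 + (cmod (fourier_int v \<xi>))\<^sup>2 / 2"
        using sum_squares_bound[of "cmod (fourier_int u \<xi>)" "cmod (fourier_int v \<xi>)"] by simp
      finally show "norm (fourier_int u \<xi> * q n \<xi>) \<le> (cmod (fourier_int u \<xi>))\<^sup>2 / 2 + (cmod (fourier_int v \<xi>))\<^sup>2 / 2" .
    qed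
  qed measurable
  have R: "(\<lambda>n. LINT x|lborel. u x * complex_of_real (B n x)) \<longlonglongrightarrow> (LINT x|lborel. complex_of_real (2 * pi) * (indicator {a..b} x * u x))"
  proof (rule integral_dominated_convergence)
    show "integrable lborel (\<lambda>x. norm (u x) * (2 * pi))" using u1 by simp
    show "AE x in lborel. norm (u x * complex_of_real (B n x)) \<le> norm (u x) * (2 * pi)" for n
      using Bb(1)[of n] by (intro AE_I2) (simp add: norm_mult mult_left_mono)
    show "AE x in lborel. (\<lambda>n. u x * complex_of_real (B n x)) \<longlonglongrightarrow> complex_of_real (2 * pi) * (indicator {a..b} x * u x)"
    proof (rule AE_mp[OF AE_lborel_singleton[of a]], rule AE_mp[OF AE_lborel_singleton[of b]], rule AE_I2, intro impI)
      fix x assume "x \<noteq> b" "x \<noteq> a"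
      then have "(\<lambda>n. u x * complex_of_real (B n x)) \<longlonglongrightarrow> u x * complex_of_real (2 * pi * indicator {a..b} x)"
        by (intro tendsto_intros Bb(2))
      moreover have "u x * complex_of_real (2 * pi * indicator {a..b} x) = complex_of_real (2 * pi) * (indicator {a..b} x * u x)"
        by (simp add: indicator_def)
      ultimately show "(\<lambda>n. u x * complex_of_real (B n x)) \<longlonglongrightarrow> complex_of_real (2 * pi) * (indicator {a..b} x * u x)"
        by (simp only:)
    qed
  qed measurable
  from LIMSEQ_unique[OF L R[folded eq]] show ?thesis unfolding v_def by simp
qed

text \<open>Extends the identity from integrable functions to the pairs related by
  \<open>fourier_L2\<close>: truncation to \<open>{-R..R}\<close> does not change the integral over
  \<open>{a..b}\<close> once \<open>R\<close> is large, and the other side is stable under L2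
  limits.\<close>

lemma fourier_L2_pairing_interval:
  fixes a b :: real
  assumes fg: "fourier_L2 f g"
  shows "integrable lborel (\<lambda>\<xi>. g \<xi> * cnj (fourier_int (indicator {a..b}) \<xi>))"
    and "(LINT \<xi>|lborel. g \<xi> * cnj (fourier_int (indicator {a..b}) \<xi>))
     = complex_of_real (2 * pi) * (LINT x|lborel. indicator {a..b} x * f x)"
proof -
  define c where "c = fourier_int (indicator {a..b} :: real \<Rightarrow> complex)"
  have fm[measurable]: "f \<in> borel_measurable borel" and f2: "integrable lborel (\<lambda>x. (cmod (f x))\<^sup>2)"
    and gm[measurable]: "g \<in> borel_measurable borel" and g2: "integrable lborel (\<lambda>x. (cmod (g x))\<^sup>2)"
    using fg by (auto simp: fourier_L2_def L2_fun_def)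
  have c2: "integrable lborel (\<lambda>x. (cmod (c x))\<^sup>2)"
    unfolding c_def by (rule plancherel_le(1)) (rule interval_indicator_L1_L2)+
  have [measurable]: "c \<in> borel_measurable borel"
    unfolding c_def by measurable
  define u where "u R x = indicator {-R..R} x * f x" for R x
  have u2: "integrable lborel (\<lambda>x. (cmod (u R x))\<^sup>2)" for R
    unfolding u_def by (rule Bochner_Integration.integrable_bound[OF f2]) (auto simp: indicator_def)
  have u1: "integrable lborel (u R)" for R
  proof (rule Bochner_Integration.integrable_bound)
    show "integrable lborel (\<lambda>x. indicator {-R..R} x + (cmod (u R x))\<^sup>2)"
      using u2 by (intro Bochner_Integration.integrable_add integrable_real_indicator) (auto simp: emeasure_lborel_Icc_eq)
    show "u R \<in> borel_measurable lborel" unfolding u_def[abs_def] by measurable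
    have "cmod z \<le> 1 + (cmod z)\<^sup>2" for z by (rule le_one_plus_square)
    then show "AE x in lborel. norm (u R x) \<le> norm (indicator {-R..R} x + (cmod (u R x))\<^sup>2)"
      by (auto simp: u_def indicator_def)
  qed
  have uh2: "integrable lborel (\<lambda>\<xi>. (cmod (fourier_int (u R) \<xi>))\<^sup>2)" for R by (rule plancherel_le(1)[OF u1 u2])
  have [measurable]: "u R \<in> borel_measurable borel" for R using u1 by auto
  have prod_bd: "cmod (z * cnj w) \<le> m / 2 * (cmod z)\<^sup>2 + (cmod w)\<^sup>2 / (2 * m)" if "m > 0" for z w :: complex and m :: real
  proof -
    have "2 * (sqrt m * cmod z) * (cmod w / sqrt m) \<le> (sqrt m * cmod z)\<^sup>2 + (cmod w / sqrt m)\<^sup>2"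
      by (rule sum_squares_bound)
    then show ?thesis using that by (simp add: norm_mult power_divide power_mult_distrib field_simps)
  qed
  have prod_int: "integrable lborel (\<lambda>\<xi>. h \<xi> * cnj (c \<xi>))"
    if [measurable]: "h \<in> borel_measurable borel" and h2: "integrable lborel (\<lambda>\<xi>. (cmod (h \<xi>))\<^sup>2)" for h
  proof (rule Bochner_Integration.integrable_bound)
    show "integrable lborel (\<lambda>\<xi>. 1 / 2 * (cmod (h \<xi>))\<^sup>2 + (cmod (c \<xi>))\<^sup>2 / (2 * 1))" using h2 c2 by auto
    show "AE \<xi> in lborel. norm (h \<xi> * cnj (c \<xi>)) \<le> norm (1 / 2 * (cmod (h \<xi>))\<^sup>2 + (cmod (c \<xi>))\<^sup>2 / (2 * 1))"
      using order_trans[OF prod_bd[of 1] abs_ge_self] by (intro AE_I2) simp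
  qed measurable
  show gi: "integrable lborel (\<lambda>\<xi>. g \<xi> * cnj (fourier_int (indicator {a..b}) \<xi>))"
    using prod_int[OF gm g2] by (simp add: c_def)
  define d where "d R = (LINT \<xi>|lborel. (cmod (g \<xi> - fourier_int (u R) \<xi>))\<^sup>2)" for R
  have d0: "(d \<longlongrightarrow> 0) at_top"
    using fg unfolding fourier_L2_def truncated_fourier d_def[abs_def] u_def[abs_def] by simp
  have di: "integrable lborel (\<lambda>\<xi>. (cmod (g \<xi> - fourier_int (u R) \<xi>))\<^sup>2)" for R
  proof (rule Bochner_Integration.integrable_bound)
    show "integrable lborel (\<lambda>\<xi>. 2 * (cmod (g \<xi>))\<^sup>2 + 2 * (cmod (fourier_int (u R) \<xi>))\<^sup>2)" using g2 uh2 by auto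
    have "(cmod (z - w))\<^sup>2 \<le> 2 * (cmod z)\<^sup>2 + 2 * (cmod w)\<^sup>2" for z w
    proof -
      have "(cmod (z - w))\<^sup>2 \<le> (cmod z + cmod w)\<^sup>2" by (intro power_mono norm_triangle_ineq4) auto
      then show ?thesis using sum_squares_bound[of "cmod z" "cmod w"] by (simp add: power2_sum)
    qed
    then show "AE \<xi> in lborel. norm ((cmod (g \<xi> - fourier_int (u R) \<xi>))\<^sup>2) \<le> norm (2 * (cmod (g \<xi>))\<^sup>2 + 2 * (cmod (fourier_int (u R) \<xi>))\<^sup>2)"
      by (intro AE_I2) simp
  qed measurable
  define X where "X = cmod ((LINT \<xi>|lborel. g \<xi> * cnj (c \<xi>)) - complex_of_real (2 * pi) * (LINT x|lborel. indicator {a..b} x * f x))"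
  define V where "V = (LINT \<xi>|lborel. (cmod (c \<xi>))\<^sup>2)"
  \<comment> \<open>A Cauchy-Schwarz estimate with a free weight \<open>m\<close>: letting
    \<open>R\<close> tend to infinity removes the first term, and a large \<open>m\<close> then
    makes the second small. The value \<open>m = V / X\<close> used below would give
    \<open>X \<le> X / 2\<close>.\<close>
  have bd: "X \<le> m / 2 * d R + V / (2 * m)" if R: "R \<ge> max \<bar>a\<bar> \<bar>b\<bar>" and l: "m > 0" for R m
  proof -
    have "(LINT x|lborel. indicator {a..b} x * u R x) = (LINT x|lborel. indicator {a..b} x * f x)"
      using R by (intro Bochner_Integration.integral_cong) (auto simp: u_def indicator_def)
    then have "(LINT \<xi>|lborel. fourier_int (u R) \<xi> * cnj (c \<xi>)) = complex_of_real (2 * pi) * (LINT x|lborel. indicator {a..b} x * f x)"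
      using fourier_pairing_interval[OF u1 u2, of R a b] by (simp add: c_def)
    then have "X = cmod (LINT \<xi>|lborel. (g \<xi> - fourier_int (u R) \<xi>) * cnj (c \<xi>))"
      using prod_int[OF gm g2] prod_int[OF _ uh2, of R] by (simp add: X_def left_diff_distrib)
    also have "\<dots> \<le> (LINT \<xi>|lborel. m / 2 * (cmod (g \<xi> - fourier_int (u R) \<xi>))\<^sup>2 + (cmod (c \<xi>))\<^sup>2 / (2 * m))"
    proof (rule order_trans[OF integral_norm_bound integral_mono])
      show "integrable lborel (\<lambda>\<xi>. norm ((g \<xi> - fourier_int (u R) \<xi>) * cnj (c \<xi>)))"
        by (intro integrable_norm prod_int di) measurable
      show "integrable lborel (\<lambda>\<xi>. m / 2 * (cmod (g \<xi> - fourier_int (u R) \<xi>))\<^sup>2 + (cmod (c \<xi>))\<^sup>2 / (2 * m))"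
        using di c2 by auto
    qed (rule prod_bd[OF l])
    also have "\<dots> = m / 2 * d R + V / (2 * m)"
      using di c2 by (simp add: d_def V_def)
    finally show ?thesis .
  qed
  have bd2: "X \<le> V / (2 * m)" if "m > 0" for m
  proof -
    have "((\<lambda>R. m / 2 * d R + V / (2 * m)) \<longlongrightarrow> m / 2 * 0 + V / (2 * m)) at_top"
      by (intro tendsto_intros d0)
    then have "((\<lambda>R. m / 2 * d R + V / (2 * m)) \<longlongrightarrow> V / (2 * m)) at_top" by simp
    then show ?thesis
    proof (rule tendsto_lowerbound)
      show "\<forall>\<^sub>F R in at_top. X \<le> m / 2 * d R + V / (2 * m)"
        using eventually_ge_at_top[of "max \<bar>a\<bar> \<bar>b\<bar>"] by eventually_elim (rule bd[OF _ that])
    qed simp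
  qed
  have "X \<le> 0"
  proof (rule ccontr)
    assume "\<not> X \<le> 0"
    then have X: "X > 0" by simp
    with bd2[of 1] have V: "V > 0" by simp
    have "X \<le> V / (2 * (V / X))" using X V by (intro bd2) simp
    then show False using X V by simp
  qed
  then show "(LINT \<xi>|lborel. g \<xi> * cnj (fourier_int (indicator {a..b}) \<xi>))
     = complex_of_real (2 * pi) * (LINT x|lborel. indicator {a..b} x * f x)"
    unfolding X_def c_def by simp
qed

section \<open>Kernel estimates\<close>

text \<open>Trades exponential decay for a power of freely chosen order \<open>q\<close>, so that
  the singularity in the distance can be kept just integrable.\<close>

lemma exp_minus_le_powr:
  fixes X q :: real
  assumes X: "X > 0" and q: "0 \<le> q" "q \<le> 1"
  shows "exp (- X) \<le> X powr (- q)"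
proof -
  have "X powr q \<le> exp X"
  proof (cases "X \<le> 1")
    case True
    then have "X powr q \<le> 1" using X q by (intro powr_le1) auto
    also have "1 \<le> exp X" using X by simp
    finally show ?thesis .
  next
    case False
    then have "X powr q \<le> X powr 1" using q by (intro powr_mono) auto
    also have "X powr 1 = X" using X by simp
    also have "X \<le> exp X" using exp_ge_add_one_self[of X] by linarith
    finally show ?thesis .
  qed
  then have "inverse (exp X) \<le> inverse (X powr q)" using X by (intro le_imp_inverse_le) auto
  then show ?thesis by (simp add: exp_minus powr_minus)
qed

text \<open>Here \<open>q\<close> is the exponent of the distance where the Gaussian decays.
  Converting the Gaussian costs \<open>N powr (2 * (1 - q))\<close> if damping dominates; if
  dispersion dominates, the exponent of \<open>N\<close> is twice
  \<open>q - (2 * q - 1) / \<gamma>\<close>. Both must stay below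
  \<open>N powr (4 * \<sigma>)\<close>. The second claim says that the distance exponent where the
  curve bridges is below 1. For \<gamma> at least 1 the bound \<open>1/2 - \<alpha>\<close> is
  available on every branch, because the branches are ordered on either side of
  \<open>1 / (2 * \<alpha>)\<close>.\<close>

lemma critical_exponent_parameters:
  fixes \<gamma> \<alpha> \<sigma> :: real
  assumes g: "\<gamma> > 0" and a: "1/4 < \<alpha>" "\<alpha> < 1/2" and s: "s_crit \<alpha> \<gamma> < \<sigma>" "\<sigma> < 1/2"
  shows "\<exists>q. 1/2 \<le> q \<and> q < 1 \<and> 1 - q \<le> 2 * \<sigma> \<and> (\<gamma> > 1 \<longrightarrow> q - (2 * q - 1) / \<gamma> \<le> 2 * \<sigma>)"
    and "min 1 \<gamma> * (1 - 2 * \<sigma>) / (2 * \<alpha>) < 1" and "\<sigma> > 0"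
proof -
  have g1: "\<gamma> \<ge> 1 \<Longrightarrow> 1/2 - \<alpha> < \<sigma>"
  proof -
    assume "\<gamma> \<ge> 1"
    moreover have "1/2 - \<alpha> \<le> 1/2 * (1 - 1/\<gamma>)" if "\<gamma> \<ge> 1 / (2 * \<alpha>)"
    proof -
      have "1 / \<gamma> \<le> 1 / (1 / (2 * \<alpha>))" using that a g by (intro divide_left_mono) auto
      then show ?thesis by simp
    qed
    ultimately show ?thesis using s a by (auto simp: s_crit_def split: if_splits)
  qed
  have gd: "1/2 * (1 - 1/\<gamma>) < \<sigma>" if "1 < \<gamma>" "\<gamma> < 2"
  proof -
    have "1/2 * (1 - 1/\<gamma>) \<le> 1/2 - \<alpha>" if l: "\<gamma> < 1 / (2 * \<alpha>)"
    proof -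
      have "2 * \<alpha> * \<gamma> \<le> 1" using l a g by (simp add: field_simps)
      then have "2 * \<alpha> \<le> 1 / \<gamma>" using g by (simp add: field_simps)
      then show ?thesis by simp
    qed
    then show ?thesis using s that a by (auto simp: s_crit_def split: if_splits)
  qed
  show s0: "\<sigma> > 0"
  proof -
    have "s_crit \<alpha> \<gamma> \<ge> 0" if "\<gamma> < 1" using a that g by (auto simp: s_crit_def field_simps)
    then show ?thesis using g1 a s by (cases "\<gamma> \<ge> 1") auto
  qed
  show "min 1 \<gamma> * (1 - 2 * \<sigma>) / (2 * \<alpha>) < 1"
  proof (cases "\<gamma> \<ge> 1")
    case True
    then show ?thesis using g1 a by (simp add: min_def field_simps)
  next
    case False
    have "\<gamma> * (1 - 2 * \<sigma>) < 2 * \<alpha>"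
    proof (cases "\<gamma> < 2 * \<alpha>")
      case True
      have "\<gamma> * (1 - 2 * \<sigma>) \<le> \<gamma> * 1" using s0 g by (intro mult_left_mono) auto
      then show ?thesis using True by simp
    next
      case F: False
      then have "1/2 - \<alpha> / \<gamma> < \<sigma>" using False s by (simp add: s_crit_def)
      then have "1 - 2 * \<sigma> < 2 * \<alpha> / \<gamma>" by simp
      then show ?thesis using g by (simp add: field_simps)
    qed
    then show ?thesis using False a by (simp add: min_def)
  qed
  show "\<exists>q. 1/2 \<le> q \<and> q < 1 \<and> 1 - q \<le> 2 * \<sigma> \<and> (\<gamma> > 1 \<longrightarrow> q - (2 * q - 1) / \<gamma> \<le> 2 * \<sigma>)"
  proof (cases "\<gamma> \<ge> 2")
    case True
    have "1 / (2 * \<alpha>) < 2" using a by (simp add: field_simps)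
    then have "\<sigma> > 1/4" using True s a by (auto simp: s_crit_def split: if_splits)
    \<comment> \<open>At \<open>q = 1/2\<close> both conditions read
      \<open>1/2 \<le> 2 * \<sigma>\<close>, which is the threshold 1/4 of this range.\<close>
    then show ?thesis by (intro exI[of _ "1/2"]) simp
  next
    case False
    \<comment> \<open>With \<open>q = 1 - d\<close> and \<open>d\<close> tending to 0, the
      conditions tend to \<open>0 \<le> 2 * \<sigma>\<close> and
      \<open>1 - 1 / \<gamma> \<le> 2 * \<sigma>\<close>. Both hold strictly, and \<open>d\<close>
      is the smaller of the two margins, capped to keep \<open>q \<ge> 1/2\<close>.\<close>
    define d where "d = min (1/2) (min (2 * \<sigma>) (if \<gamma> > 1 then 2 * \<sigma> - 1 + 1 / \<gamma> else 1))"
    have d: "0 < d" "d \<le> 1/2" "d \<le> 2 * \<sigma>" using s0 gd False by (auto simp: d_def)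
    have "1 - d - (2 * (1 - d) - 1) / \<gamma> \<le> 2 * \<sigma>" if "\<gamma> > 1"
    proof -
      have "1 - d - (2 * (1 - d) - 1) / \<gamma> = 1 - 1 / \<gamma> + d * (2 / \<gamma> - 1)" using g by (simp add: field_simps)
      also have "d * (2 / \<gamma> - 1) \<le> d * 1" using d that by (intro mult_left_mono) (auto simp: field_simps)
      also have "d \<le> 2 * \<sigma> - 1 + 1 / \<gamma>" using that by (simp add: d_def)
      finally show ?thesis by simp
    qed
    then show ?thesis using d by (intro exI[of _ "1 - d"]) auto
  qed
qed

text \<open>The two regimes: either the difference of times is so large that the curve may bridge the
  distance \<open>r\<close>, or the linear phase is at least comparable with \<open>r\<close>.\<close>
lemma kernel_size_bound:
  fixes \<gamma> \<alpha> \<sigma> C1 C3 :: real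
  assumes g: "\<gamma> > 0" and al: "\<alpha> > 0" and s: "0 < \<sigma>" "\<sigma> < 1/2" and C: "C1 > 0" "C3 > 0"
    and q: "1/2 \<le> q" "q < 1" "1 - q \<le> 2 * \<sigma>" "\<gamma> > 1 \<Longrightarrow> q - (2 * q - 1) / \<gamma> \<le> 2 * \<sigma>"
  defines "\<beta>1 \<equiv> min 1 \<gamma> * (1 - 2 * \<sigma>) / (2 * \<alpha>)"
  defines "M \<equiv> (C1 / (2 * C3)) powr (- 2 * \<beta>1) + (C1\<^sup>2 / 16) powr (- q)"
  assumes N: "N \<ge> 1" and r: "0 < r" "r \<le> 1" and b: "\<bar>b\<bar> \<le> 1"
    and cN: "c \<ge> 1 / N\<^sup>2" and cb: "c \<ge> \<bar>b\<bar> powr \<gamma>" and ab: "C1 * r - C3 * \<bar>b\<bar> powr \<alpha> \<le> \<bar>a\<bar>"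
  shows "1 / sqrt (c\<^sup>2 + b\<^sup>2) * exp (- (a\<^sup>2 * c) / (2 * (c\<^sup>2 + b\<^sup>2))) \<le> M * N powr (4 * \<sigma>) * r powr (- 2 * max \<beta>1 q)"
proof -
  define E where "E = sqrt (c\<^sup>2 + b\<^sup>2)"
  have N0: "N > 0" using N by simp
  have sq: "(y\<^sup>2) powr z = y powr (2 * z)" if "y > 0" for y z :: real
    using powr_powr[of y 2 z] that by (simp add: powr_numeral)
  have cpos: "c > 0" using cN N0 by (smt (verit) divide_pos_pos zero_less_power)
  have Ec: "E \<ge> c" "E \<ge> \<bar>b\<bar>" "E > 0"
    using cpos by (auto simp: E_def real_le_rsqrt intro: real_sqrt_gt_zero add_pos_nonneg)
  have E2: "c\<^sup>2 + b\<^sup>2 = E\<^sup>2" by (simp add: E_def)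
  have N2: "1 / N\<^sup>2 = N powr (-2)" using N0 by (simp add: powr_minus powr_numeral divide_inverse)
  have M0: "(C1 / (2 * C3)) powr (- 2 * \<beta>1) \<ge> 0" "(C1\<^sup>2 / 16) powr (- q) \<ge> 0" by auto
  have rmax: "r powr (- 2 * z) \<le> r powr (- 2 * max \<beta>1 q)" if "z \<le> max \<beta>1 q" for z
    using r that by (intro powr_mono') auto
  have cN': "c powr (- z) \<le> N powr (2 * z)" if "z \<ge> 0" for z
  proof -
    have "c powr (- z) \<le> (N powr (-2)) powr (- z)"
      using cN N0 that unfolding N2 by (intro powr_mono2') auto
    then show ?thesis by (simp add: powr_powr)
  qed
  have Nmono: "N powr x \<le> N powr y" if "x \<le> y" for x y using N that by (intro powr_mono) auto
  let ?T = "1 / E * exp (- (a\<^sup>2 * c) / (2 * E\<^sup>2))"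
  have "?T \<le> M * N powr (4 * \<sigma>) * r powr (- 2 * max \<beta>1 q)"
  proof (cases "C3 * \<bar>b\<bar> powr \<alpha> \<ge> C1 * r / 2")
    case True
    \<comment> \<open>The factor \<open>1 / E\<close> is split into
      \<open>E powr (- \<theta>)\<close>, paid for by the distance \<open>r\<close> through the
      lower bound on \<open>\<bar>b\<bar>\<close>, and \<open>E powr (- (2 * \<sigma>))\<close>,
      paid for by \<open>N\<close> through \<open>c \<ge> 1 / N\<^sup>2\<close>.\<close>
    define \<theta> where "\<theta> = 1 - 2 * \<sigma>"
    define m where "m = min 1 \<gamma>"
    have th: "0 < \<theta>" "\<theta> < 1" using s by (auto simp: \<theta>_def)
    have m: "m > 0" using g by (simp add: m_def)
    have kr: "C1 / (2 * C3) * r \<le> \<bar>b\<bar> powr \<alpha>" using True C by (simp add: field_simps)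
    have krp: "C1 / (2 * C3) * r > 0" using C r by simp
    have bne: "\<bar>b\<bar> > 0" using kr krp by (cases "b = 0") auto
    have Em: "E \<ge> \<bar>b\<bar> powr m"
    proof (cases "\<gamma> \<ge> 1")
      case True then show ?thesis using Ec bne by (simp add: m_def)
    next
      case False then show ?thesis using Ec cb by (simp add: m_def)
    qed
    have "(C1 / (2 * C3) * r) powr (m / \<alpha>) \<le> (\<bar>b\<bar> powr \<alpha>) powr (m / \<alpha>)"
      using kr krp m al by (intro powr_mono2) auto
    also have "\<dots> = \<bar>b\<bar> powr m" using al by (simp add: powr_powr)
    finally have Ekr: "(C1 / (2 * C3) * r) powr (m / \<alpha>) \<le> E" using Em by simp
    have b1: "m / \<alpha> * \<theta> = 2 * \<beta>1" using al by (simp add: \<beta>1_def m_def \<theta>_def)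
    have "E powr (- \<theta>) \<le> ((C1 / (2 * C3) * r) powr (m / \<alpha>)) powr (- \<theta>)"
      using Ekr krp th by (intro powr_mono2') auto
    also have "\<dots> = (C1 / (2 * C3) * r) powr (- 2 * \<beta>1)" using b1 by (simp add: powr_powr)
    also have "\<dots> = (C1 / (2 * C3)) powr (- 2 * \<beta>1) * r powr (- 2 * \<beta>1)"
      by (rule powr_mult)
    finally have e1: "E powr (- \<theta>) \<le> (C1 / (2 * C3)) powr (- 2 * \<beta>1) * r powr (- 2 * \<beta>1)" .
    have "E powr (- (2 * \<sigma>)) \<le> c powr (- (2 * \<sigma>))" using Ec cpos s by (intro powr_mono2') auto
    also have "\<dots> \<le> N powr (4 * \<sigma>)" using cN'[of "2 * \<sigma>"] s by simp
    finally have e2: "E powr (- (2 * \<sigma>)) \<le> N powr (4 * \<sigma>)" .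
    have "?T \<le> 1 / E * 1" using Ec cpos by (intro mult_left_mono) auto
    also have "\<dots> = E powr (- \<theta> + - (2 * \<sigma>))"
      using Ec by (simp add: \<theta>_def powr_minus_divide)
    also have "\<dots> = E powr (- \<theta>) * E powr (- (2 * \<sigma>))" by (rule powr_add)
    also have "\<dots> \<le> ((C1 / (2 * C3)) powr (- 2 * \<beta>1) * r powr (- 2 * \<beta>1)) * N powr (4 * \<sigma>)"
      using e1 e2 by (intro mult_mono) auto
    also have "\<dots> = ((C1 / (2 * C3)) powr (- 2 * \<beta>1)) * N powr (4 * \<sigma>) * r powr (- 2 * \<beta>1)" by simp
    also have "\<dots> \<le> M * N powr (4 * \<sigma>) * r powr (- 2 * max \<beta>1 q)"
      using M0 by (intro mult_mono rmax) (auto simp: M_def)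
    finally show ?thesis .
  next
    case False
    then have ar: "\<bar>a\<bar> \<ge> C1 * r / 2" using ab by simp
    have a2: "a\<^sup>2 \<ge> C1\<^sup>2 / 4 * r\<^sup>2"
      using power_mono[OF ar, of 2] C r by (simp add: power_divide power_mult_distrib)
    have fin: "?T \<le> M * N powr (4 * \<sigma>) * r powr (- 2 * max \<beta>1 q)"
      if T: "?T \<le> (C1\<^sup>2 / 16) powr (- q) * N powr (4 * \<sigma>) * r powr (- 2 * q)"
    proof -
      have "(C1\<^sup>2 / 16) powr (- q) * N powr (4 * \<sigma>) * r powr (- 2 * q) \<le> M * N powr (4 * \<sigma>) * r powr (- 2 * max \<beta>1 q)"
        using M0 by (intro mult_mono rmax) (auto simp: M_def)
      then show ?thesis using T by linarith
    qed
    \<comment> \<open>\<open>E\<close> is comparable with the larger of \<open>c\<close> and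
      \<open>\<bar>b\<bar>\<close>; the factor 2 in \<open>E\<^sup>2 \<le> 2 * y\<^sup>2\<close> is
      what turns \<open>C1\<^sup>2 / 4\<close> into \<open>C1\<^sup>2 / 16\<close>.\<close>
    have Tb: "?T \<le> 1 / y * exp (- (C1\<^sup>2 / 16 * r\<^sup>2 * c / y\<^sup>2))" if y: "y > 0" "y \<le> E" "E\<^sup>2 \<le> 2 * y\<^sup>2" for y
    proof (intro mult_mono)
      show "1 / E \<le> 1 / y" using y by (intro divide_left_mono) auto
      have "C1\<^sup>2 / 16 * r\<^sup>2 * c / y\<^sup>2 = (C1\<^sup>2 / 4 * r\<^sup>2 * c) / (2 * (2 * y\<^sup>2))" by simp
      also have "\<dots> \<le> (a\<^sup>2 * c) / (2 * E\<^sup>2)"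
        using a2 y cpos Ec by (intro frac_le mult_right_mono) auto
      finally show "exp (- (a\<^sup>2 * c) / (2 * E\<^sup>2)) \<le> exp (- (C1\<^sup>2 / 16 * r\<^sup>2 * c / y\<^sup>2))" by simp
    qed (use y in auto)
    show ?thesis
    proof (cases "\<bar>b\<bar> \<le> c")
      case True
      have "b\<^sup>2 \<le> c\<^sup>2" using True by (simp add: abs_le_square_iff[symmetric])
      then have "?T \<le> 1 / c * exp (- (C1\<^sup>2 / 16 * r\<^sup>2 * c / c\<^sup>2))"
        using Ec cpos by (intro Tb) (auto simp: E2[symmetric])
      also have "C1\<^sup>2 / 16 * r\<^sup>2 * c / c\<^sup>2 = C1\<^sup>2 / 16 * r\<^sup>2 / c" using cpos by (simp add: power2_eq_square)
      also have "exp (- (C1\<^sup>2 / 16 * r\<^sup>2 / c)) \<le> (C1\<^sup>2 / 16 * r\<^sup>2 / c) powr (- q)"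
        using C r cpos q by (intro exp_minus_le_powr) auto
      also have "(C1\<^sup>2 / 16 * r\<^sup>2 / c) powr (- q) = (C1\<^sup>2 / 16) powr (- q) * r powr (- 2 * q) * c powr q"
      proof -
        have "C1\<^sup>2 / 16 * r\<^sup>2 / c = C1\<^sup>2 / 16 * r\<^sup>2 * c powr (- 1)" using cpos by (simp add: powr_minus_divide)
        then show ?thesis using sq[OF r(1), of "- q"] by (simp only: powr_mult powr_powr) simp
      qed
      finally have "?T \<le> (C1\<^sup>2 / 16) powr (- q) * r powr (- 2 * q) * (c powr q * (1 / c))"
        using cpos by (simp add: divide_right_mono)
      also have "c powr q * (1 / c) = c powr (- (1 - q))"
        using cpos by (simp add: powr_diff powr_minus divide_inverse)
      also have "\<dots> \<le> N powr (2 * (1 - q))" using q by (intro cN') auto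
      also have "\<dots> \<le> N powr (4 * \<sigma>)" using q by (intro Nmono) auto
      finally have "?T \<le> (C1\<^sup>2 / 16) powr (- q) * r powr (- 2 * q) * N powr (4 * \<sigma>)"
        by (simp add: mult_left_mono)
      then show ?thesis by (intro fin) (simp add: mult_ac)
    next
      case bc: False
      then have bp: "\<bar>b\<bar> > 0" using cpos by simp
      \<comment> \<open>Dispersion can dominate only for \<gamma> > 1: otherwise
        \<open>\<bar>b\<bar> \<le> \<bar>b\<bar> powr \<gamma> \<le> c\<close> because
        \<open>\<bar>b\<bar> \<le> 1\<close>.\<close>
      have g1: "\<gamma> > 1"
      proof (rule ccontr)
        assume "\<not> \<gamma> > 1"
        then have "\<bar>b\<bar> powr 1 \<le> \<bar>b\<bar> powr \<gamma>" using b bp by (intro powr_mono') auto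
        then show False using cb bc bp by simp
      qed
      \<comment> \<open>Chosen so that \<open>\<gamma> * q * \<theta> = 2 * q - 1\<close>. The part
        \<open>c powr (- (q * \<theta>))\<close> then cancels
        \<open>\<bar>b\<bar> powr (2 * q - 1)\<close>, while the remaining power of \<open>c\<close>
        has exponent \<open>q * (1 - \<theta>) = q - (2 * q - 1) / \<gamma>\<close> and is paid for
        by \<open>N\<close>.\<close>
      define \<theta> where "\<theta> = (2 - 1 / q) / \<gamma>"
      have "0 \<le> 2 - 1 / q" "2 - 1 / q \<le> 1" using q by (auto simp: field_simps)
      then have th: "0 \<le> \<theta>" "\<theta> \<le> 1" using g1 by (auto simp: \<theta>_def divide_le_eq)
      have c2: "c\<^sup>2 \<le> b\<^sup>2" using bc cpos by (simp add: abs_le_square_iff[symmetric])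
      have "?T \<le> 1 / \<bar>b\<bar> * exp (- (C1\<^sup>2 / 16 * r\<^sup>2 * c / \<bar>b\<bar>\<^sup>2))"
        using Ec bp c2 by (intro Tb) (auto simp: E2[symmetric])
      also have "exp (- (C1\<^sup>2 / 16 * r\<^sup>2 * c / \<bar>b\<bar>\<^sup>2)) \<le> (C1\<^sup>2 / 16 * r\<^sup>2 * c / \<bar>b\<bar>\<^sup>2) powr (- q)"
        using C r cpos q bp by (intro exp_minus_le_powr) auto
      also have "(C1\<^sup>2 / 16 * r\<^sup>2 * c / \<bar>b\<bar>\<^sup>2) powr (- q) = (C1\<^sup>2 / 16) powr (- q) * r powr (- 2 * q) * c powr (- q) * \<bar>b\<bar> powr (2 * q)"
      proof -
        have "(r\<^sup>2) powr (- q) = r powr (- 2 * q)" "(\<bar>b\<bar>\<^sup>2) powr (- q) = 1 / \<bar>b\<bar> powr (2 * q)"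
          using sq[OF r(1), of "- q"] sq[OF bp, of "- q"] by (simp_all add: powr_minus divide_inverse)
        then show ?thesis using C r cpos bp by (simp add: powr_mult powr_divide)
      qed
      finally have T1: "?T \<le> (C1\<^sup>2 / 16) powr (- q) * r powr (- 2 * q) * (c powr (- q) * (\<bar>b\<bar> powr (2 * q) * (1 / \<bar>b\<bar>)))"
        using bp by (simp add: divide_right_mono)
      have bb: "\<bar>b\<bar> powr (2 * q) * (1 / \<bar>b\<bar>) = \<bar>b\<bar> powr (2 * q - 1)"
        using bp by (simp add: powr_diff)
      have q0: "q > 0" using q by simp
      have "c powr (- (q * \<theta>)) \<le> (\<bar>b\<bar> powr \<gamma>) powr (- (q * \<theta>))"
        using cb bp q th by (intro powr_mono2') auto
      also have "\<dots> = \<bar>b\<bar> powr (- (2 * q - 1))"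
      proof -
        have "\<gamma> * (- (q * \<theta>)) = - (2 * q - 1)" using g1 q0 by (simp add: \<theta>_def field_simps)
        then show ?thesis by (simp add: powr_powr)
      qed
      finally have c1: "c powr (- (q * \<theta>)) \<le> \<bar>b\<bar> powr (- (2 * q - 1))" .
      have qt: "2 * (q * (1 - \<theta>)) \<le> 4 * \<sigma>"
      proof -
        have "q * (1 - \<theta>) = q - (2 * q - 1) / \<gamma>" using g1 q0 by (simp add: \<theta>_def field_simps)
        then show ?thesis using q(4)[OF g1] by linarith
      qed
      have c2: "c powr (- (q * (1 - \<theta>))) \<le> N powr (4 * \<sigma>)"
        by (rule order_trans[OF cN' Nmono[OF qt]]) (use q th in simp)
      have "c powr (- q) = c powr (- (q * \<theta>)) * c powr (- (q * (1 - \<theta>)))"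
        by (simp add: powr_add[symmetric] algebra_simps)
      also have "\<dots> \<le> \<bar>b\<bar> powr (- (2 * q - 1)) * N powr (4 * \<sigma>)"
        using c1 c2 by (intro mult_mono) auto
      finally have "c powr (- q) * \<bar>b\<bar> powr (2 * q - 1) \<le> (\<bar>b\<bar> powr (- (2 * q - 1)) * N powr (4 * \<sigma>)) * \<bar>b\<bar> powr (2 * q - 1)"
        by (intro mult_right_mono) auto
      also have "\<dots> = (\<bar>b\<bar> powr (- (2 * q - 1)) * \<bar>b\<bar> powr (2 * q - 1)) * N powr (4 * \<sigma>)" by (simp only: mult_ac)
      also have "\<bar>b\<bar> powr (- (2 * q - 1)) * \<bar>b\<bar> powr (2 * q - 1) = 1"
        using bp by (simp flip: powr_add)
      finally have "c powr (- q) * (\<bar>b\<bar> powr (2 * q) * (1 / \<bar>b\<bar>)) \<le> N powr (4 * \<sigma>)" unfolding bb by simp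
      then have "(C1\<^sup>2 / 16) powr (- q) * r powr (- 2 * q) * (c powr (- q) * (\<bar>b\<bar> powr (2 * q) * (1 / \<bar>b\<bar>)))
          \<le> (C1\<^sup>2 / 16) powr (- q) * r powr (- 2 * q) * N powr (4 * \<sigma>)"
        by (intro mult_left_mono) auto
      then have "?T \<le> (C1\<^sup>2 / 16) powr (- q) * r powr (- 2 * q) * N powr (4 * \<sigma>)" using T1 by linarith
      then show ?thesis by (intro fin) (simp add: mult_ac)
    qed
  qed
  then show ?thesis using Ec(3) unfolding E2 by simp
qed

section \<open>The maximal inequality\<close>

lemma integrable_abs_powr_interval:
  fixes \<beta> :: real
  assumes b: "0 \<le> \<beta>" "\<beta> < 1"
  shows "has_bochner_integral lborel (\<lambda>z. indicator {-1..1} z * \<bar>z\<bar> powr (- \<beta>)) (2 / (1 - \<beta>))"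
proof -
  define p where "p z = indicator {0..1} z * z powr (- \<beta>)" for z :: real
  have [measurable]: "p \<in> borel_measurable borel" unfolding p_def[abs_def] by measurable
  have p0: "p z \<ge> 0" for z by (simp add: p_def)
  have "((\<lambda>x. x powr (-\<beta>)) has_integral (1 powr (-\<beta>+1) / (-\<beta>+1))) {0..1}"
    by (rule has_integral_powr_from_0) (use b in auto)
  then have "((\<lambda>x. if x \<in> {0..1} then x powr (-\<beta>) else 0) has_integral (1 / (1 - \<beta>))) UNIV"
    by (subst has_integral_restrict_UNIV) simp
  moreover have "(\<lambda>x. if x \<in> {0..1} then x powr (-\<beta>) else 0) = p"
    by (auto simp: p_def indicator_def)
  ultimately have "(p has_integral (1 / (1 - \<beta>))) UNIV" by simp
  then have N: "integral\<^sup>N lborel p = ennreal (1 / (1 - \<beta>))"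
    by (intro nn_integral_has_integral_lborel p0) simp
  then have H: "has_bochner_integral lborel p (1 / (1 - \<beta>))"
    using b p0 by (intro has_bochner_integral_nn_integral) auto
  have H': "has_bochner_integral lborel (\<lambda>z. p (- z)) (1 / (1 - \<beta>))"
    using lborel_has_bochner_integral_real_affine_iff[of "-1" p "1 / (1 - \<beta>)" 0] H by simp
  have "indicator {-1..1} z * \<bar>z\<bar> powr (- \<beta>) = p z + p (- z)" for z
    by (auto simp: p_def indicator_def)
  then show ?thesis
    using has_bochner_integral_add[OF H H'] by simp
qed

text \<open>The multiplier of \<open>P_gamma\<close> with an additional Gaussian of strength
  \<open>\<mu>\<close>: \<open>\<mu> = 0\<close> is the evolution itself,
  \<open>\<mu> = 1/N\<^sup>2\<close> the frequency cutoff at \<open>N\<close>.\<close>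

definition wave :: "real \<Rightarrow> real \<Rightarrow> real \<Rightarrow> real \<Rightarrow> real \<Rightarrow> complex" where
  "wave \<gamma> \<mu> y t \<xi> = exp (\<i> * complex_of_real (y * \<xi> + t * \<xi>\<^sup>2)) * complex_of_real (exp (- ((t powr \<gamma> + \<mu>) * \<xi>\<^sup>2)))"

lemma P_gamma_wave: "P_gamma \<gamma> g y t = complex_of_real (1 / (2 * pi)) * (LINT \<xi>|lborel. wave \<gamma> 0 y t \<xi> * g \<xi>)"
  unfolding P_gamma_def wave_def by simp

lemma wave_measurable [measurable (raw)]:
  assumes [measurable]: "a \<in> borel_measurable M" "b \<in> borel_measurable M" "c \<in> borel_measurable M"
  shows "(\<lambda>x. wave \<gamma> \<mu> (a x) (b x) (c x)) \<in> borel_measurable M"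
  unfolding wave_def by measurable

lemma cmod_wave: "cmod (wave \<gamma> \<mu> y t \<xi>) = exp (- ((t powr \<gamma> + \<mu>) * \<xi>\<^sup>2))"
  unfolding wave_def by (simp add: norm_mult)

text \<open>In \<open>TT_star_dual_bound\<close> the role of \<open>\<phi>\<close> falls to the
  conjugate wave, whence the double conjugation. In the product the phases subtract and the dampings
  add, which leaves the chirp of \<open>gaussian_chirp_norm\<close>.\<close>

lemma wave_kernel_norm:
  fixes \<gamma> \<mu> y y' t t' :: real
  assumes "t powr \<gamma> + t' powr \<gamma> + 2 * \<mu> > 0"
  defines "a \<equiv> y' - y" and "b \<equiv> t' - t" and "c \<equiv> t powr \<gamma> + t' powr \<gamma> + 2 * \<mu>"
  shows "(cmod (LINT \<xi>|lborel. cnj (wave \<gamma> \<mu> y t \<xi>) * cnj (cnj (wave \<gamma> \<mu> y' t' \<xi>))))\<^sup>2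
     = pi * (1 / sqrt (c\<^sup>2 + b\<^sup>2) * exp (- (a\<^sup>2 * c) / (2 * (c\<^sup>2 + b\<^sup>2))))"
proof -
  have c: "c > 0" using assms by simp
  have "cnj (wave \<gamma> \<mu> y t \<xi>) * cnj (cnj (wave \<gamma> \<mu> y' t' \<xi>)) =
     exp (\<i> * complex_of_real (a * \<xi> + b * \<xi>\<^sup>2)) * complex_of_real (exp (- (c * \<xi>\<^sup>2)))" for \<xi>
  proof -
    have "cnj (wave \<gamma> \<mu> y t \<xi>) * cnj (cnj (wave \<gamma> \<mu> y' t' \<xi>)) =
      (exp (\<i> * complex_of_real (y' * \<xi> + t' * \<xi>\<^sup>2)) * exp (- (\<i> * complex_of_real (y * \<xi> + t * \<xi>\<^sup>2))))
      * complex_of_real (exp (- ((t powr \<gamma> + \<mu>) * \<xi>\<^sup>2)) * exp (- ((t' powr \<gamma> + \<mu>) * \<xi>\<^sup>2)))"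
      unfolding wave_def by (simp add: exp_cnj)
    also have "exp (- ((t powr \<gamma> + \<mu>) * \<xi>\<^sup>2)) * exp (- ((t' powr \<gamma> + \<mu>) * \<xi>\<^sup>2)) = exp (- (c * \<xi>\<^sup>2))"
      unfolding c_def by (simp add: exp_add[symmetric] algebra_simps)
    also have "exp (\<i> * complex_of_real (y' * \<xi> + t' * \<xi>\<^sup>2)) * exp (- (\<i> * complex_of_real (y * \<xi> + t * \<xi>\<^sup>2)))
        = exp (\<i> * complex_of_real (a * \<xi> + b * \<xi>\<^sup>2))"
      unfolding iexp_diff a_def b_def by (simp add: algebra_simps)
    finally show ?thesis .
  qed
  then show ?thesis using gaussian_chirp_norm[OF c, of a b] by simp
qed

lemma admissible_curveE:
  assumes "admissible_curve \<alpha> \<Gamma>"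
  obtains C1 C3 where "C1 > 0" "C3 > 0"
    "\<And>t x x'. t \<in> {-1..1} \<Longrightarrow> C1 * \<bar>x - x'\<bar> \<le> \<bar>\<Gamma> x t - \<Gamma> x' t\<bar>"
    "\<And>t t' x. t \<in> {-1..1} \<Longrightarrow> t' \<in> {-1..1} \<Longrightarrow> \<bar>\<Gamma> x t - \<Gamma> x t'\<bar> \<le> C3 * \<bar>t - t'\<bar> powr \<alpha>"
  using assms unfolding admissible_curve_def by blast

lemma admissible_curve_continuous:
  assumes "admissible_curve \<alpha> \<Gamma>"
  shows "t \<in> {-1..1} \<Longrightarrow> continuous_on UNIV (\<lambda>x. \<Gamma> x t)" and "continuous_on {-1..1} (\<Gamma> x)"
proof -
  have c: "continuous_on (UNIV \<times> {-1..1}) (\<lambda>(x, t). \<Gamma> x t)" using assms by (simp add: admissible_curve_def)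
  show "t \<in> {-1..1} \<Longrightarrow> continuous_on UNIV (\<lambda>x. \<Gamma> x t)"
    using continuous_on_compose2[OF c, of UNIV "\<lambda>x. (x, t)"] by (fastforce intro: continuous_intros)
  show "continuous_on {-1..1} (\<Gamma> x)"
    using continuous_on_compose2[OF c, of "{-1..1}" "\<lambda>t. (x, t)"] by (fastforce intro: continuous_intros)
qed

text \<open>The triangle inequality through \<open>\<Gamma> y t\<close> combines the bilipschitz and
  the Hoelder bound into the lower bound on the linear phase. The larger of two positive times
  exceeds their difference, so \<open>c\<close> dominates
  \<open>\<bar>t' - t\<bar> powr \<gamma>\<close>. The root of \<open>pi * M\<close> and the halved
  exponents arise because \<open>kernel_size_bound\<close> concerns the squared norm.\<close>

lemma kernel_estimate:
  assumes g: "\<gamma> > 0" and a: "1/4 < \<alpha>" "\<alpha> < 1/2" and s: "s_crit \<alpha> \<gamma> < \<sigma>" "\<sigma> < 1/2"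
    and \<Gamma>: "admissible_curve \<alpha> \<Gamma>"
  obtains \<beta> K where "0 \<le> \<beta>" "\<beta> < 1" "K > 0"
    "\<And>N x y t t'. \<lbrakk>N \<ge> 1; x \<noteq> y; \<bar>x - y\<bar> \<le> 1; t \<in> {0<..<1}; t' \<in> {0<..<1}\<rbrakk> \<Longrightarrow>
       cmod (LINT \<xi>|lborel. cnj (wave \<gamma> (1/N\<^sup>2) (\<Gamma> x t) t \<xi>) * cnj (cnj (wave \<gamma> (1/N\<^sup>2) (\<Gamma> y t') t' \<xi>)))
         \<le> K * N powr (2 * \<sigma>) * \<bar>x - y\<bar> powr (- \<beta>)"
proof -
  from critical_exponent_parameters[OF g a s] obtain q where
    q: "1/2 \<le> q" "q < 1" "1 - q \<le> 2 * \<sigma>" "\<gamma> > 1 \<Longrightarrow> q - (2 * q - 1) / \<gamma> \<le> 2 * \<sigma>"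
    and b1: "min 1 \<gamma> * (1 - 2 * \<sigma>) / (2 * \<alpha>) < 1" and s0: "\<sigma> > 0" by blast
  from admissible_curveE[OF \<Gamma>] obtain C1 C3 where C: "C1 > 0" "C3 > 0"
    and lip: "\<And>t x x'. t \<in> {-1..1} \<Longrightarrow> C1 * \<bar>x - x'\<bar> \<le> \<bar>\<Gamma> x t - \<Gamma> x' t\<bar>"
    and hol: "\<And>t t' x. t \<in> {-1..1} \<Longrightarrow> t' \<in> {-1..1} \<Longrightarrow> \<bar>\<Gamma> x t - \<Gamma> x t'\<bar> \<le> C3 * \<bar>t - t'\<bar> powr \<alpha>" by blast
  define \<beta>1 where "\<beta>1 = min 1 \<gamma> * (1 - 2 * \<sigma>) / (2 * \<alpha>)"
  define M where "M = (C1 / (2 * C3)) powr (- 2 * \<beta>1) + (C1\<^sup>2 / 16) powr (- q)"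
  define \<beta> where "\<beta> = max \<beta>1 q"
  have M: "M > 0" using C by (auto simp: M_def intro!: add_pos_pos)
  show ?thesis
  proof (rule that[of \<beta> "sqrt (pi * M)"])
    show "0 \<le> \<beta>" "\<beta> < 1" using q b1 by (auto simp: \<beta>_def \<beta>1_def)
    show "sqrt (pi * M) > 0" using M by simp
  next
    fix N x y t t' :: real
    assume N: "N \<ge> 1" and xy: "x \<noteq> y" "\<bar>x - y\<bar> \<le> 1" and t: "t \<in> {0<..<1}" and t': "t' \<in> {0<..<1}"
    define c where "c = t powr \<gamma> + t' powr \<gamma> + 2 * (1/N\<^sup>2)"
    define r where "r = \<bar>x - y\<bar>"
    have c: "c > 0" using N t by (auto simp: c_def intro!: add_pos_nonneg)
    have cN: "c \<ge> 1 / N\<^sup>2"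
    proof -
      have "0 \<le> 1 / N\<^sup>2" "0 \<le> t powr \<gamma>" "0 \<le> t' powr \<gamma>" by auto
      then show ?thesis unfolding c_def by linarith
    qed
    have cb: "c \<ge> \<bar>t' - t\<bar> powr \<gamma>"
    proof (cases "t \<le> t'")
      case True
      then have "\<bar>t' - t\<bar> powr \<gamma> \<le> t' powr \<gamma>" using t t' g by (intro powr_mono2) auto
      then show ?thesis by (simp add: c_def add_increasing add_increasing2)
    next
      case False
      then have "\<bar>t' - t\<bar> powr \<gamma> \<le> t powr \<gamma>" using t t' g by (intro powr_mono2) auto
      then show ?thesis by (simp add: c_def add_increasing add_increasing2)
    qed
    have ab: "C1 * r - C3 * \<bar>t' - t\<bar> powr \<alpha> \<le> \<bar>\<Gamma> y t' - \<Gamma> x t\<bar>"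
    proof -
      have "C1 * r \<le> \<bar>\<Gamma> x t - \<Gamma> y t\<bar>" unfolding r_def using t by (intro lip) auto
      moreover have "\<bar>\<Gamma> y t' - \<Gamma> y t\<bar> \<le> C3 * \<bar>t' - t\<bar> powr \<alpha>" using t t' by (intro hol) auto
      ultimately show ?thesis by linarith
    qed
    have "(cmod (LINT \<xi>|lborel. cnj (wave \<gamma> (1/N\<^sup>2) (\<Gamma> x t) t \<xi>) * cnj (cnj (wave \<gamma> (1/N\<^sup>2) (\<Gamma> y t') t' \<xi>))))\<^sup>2
       = pi * (1 / sqrt (c\<^sup>2 + (t' - t)\<^sup>2) * exp (- ((\<Gamma> y t' - \<Gamma> x t)\<^sup>2 * c) / (2 * (c\<^sup>2 + (t' - t)\<^sup>2))))"
      unfolding c_def by (rule wave_kernel_norm) (use c in \<open>simp add: c_def\<close>)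
    also have "\<dots> \<le> pi * (M * N powr (4 * \<sigma>) * r powr (- 2 * \<beta>))"
      unfolding M_def \<beta>_def \<beta>1_def
      by (intro mult_left_mono kernel_size_bound[OF g _ s0 s(2) C q N _ _ _ cN cb ab])
         (use a t t' xy in \<open>auto simp: r_def\<close>)
    also have "\<dots> = (sqrt (pi * M) * N powr (2 * \<sigma>) * r powr (- \<beta>))\<^sup>2"
    proof -
      have "(N powr (2 * \<sigma>))\<^sup>2 = N powr (4 * \<sigma>)" "(r powr (- \<beta>))\<^sup>2 = r powr (- 2 * \<beta>)"
        by (simp_all add: power2_eq_square flip: powr_add)
      then show ?thesis using M by (simp add: power_mult_distrib)
    qed
    finally show "cmod (LINT \<xi>|lborel. cnj (wave \<gamma> (1/N\<^sup>2) (\<Gamma> x t) t \<xi>) * cnj (cnj (wave \<gamma> (1/N\<^sup>2) (\<Gamma> y t') t' \<xi>)))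
         \<le> sqrt (pi * M) * N powr (2 * \<sigma>) * \<bar>x - y\<bar> powr (- \<beta>)"
      unfolding r_def by (rule power2_le_imp_le) (use M in simp)
  qed
qed

text \<open>The supremum over finitely many times is attained at a measurable index, which turns the
  maximal operator into a linear one.\<close>
lemma maximal_estimate:
  assumes g: "\<gamma> > 0" and a: "1/4 < \<alpha>" "\<alpha> < 1/2" and s: "s_crit \<alpha> \<gamma> < \<sigma>" "\<sigma> < 1/2"
    and \<Gamma>: "admissible_curve \<alpha> \<Gamma>"
  obtains A where "A > 0"
    "\<And>N h \<tau> u. \<lbrakk>N \<ge> 1; h \<in> borel_measurable borel; integrable lborel (\<lambda>\<xi>. (cmod (h \<xi>))\<^sup>2); \<And>i::nat. \<tau> i \<in> {0<..<1}\<rbrakk> \<Longrightarrow>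
      (\<integral>\<^sup>+x. indicator {u..u+1} x * (SUP i. ennreal ((cmod (LINT \<xi>|lborel. wave \<gamma> (1/N\<^sup>2) (\<Gamma> x (\<tau> i)) (\<tau> i) \<xi> * h \<xi>))\<^sup>2)) \<partial>lborel)
       \<le> ennreal (A * N powr (2 * \<sigma>) * (LINT \<xi>|lborel. (cmod (h \<xi>))\<^sup>2))"
proof -
  from kernel_estimate[OF g a s \<Gamma>] obtain \<beta> K where b: "0 \<le> \<beta>" "\<beta> < 1" and K: "K > 0"
    and ker: "\<And>N x y t t'. \<lbrakk>N \<ge> 1; x \<noteq> y; \<bar>x - y\<bar> \<le> 1; t \<in> {0<..<1}; t' \<in> {0<..<1}\<rbrakk> \<Longrightarrow>
       cmod (LINT \<xi>|lborel. cnj (wave \<gamma> (1/N\<^sup>2) (\<Gamma> x t) t \<xi>) * cnj (cnj (wave \<gamma> (1/N\<^sup>2) (\<Gamma> y t') t' \<xi>)))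
         \<le> K * N powr (2 * \<sigma>) * \<bar>x - y\<bar> powr (- \<beta>)" by blast
  show ?thesis
  proof (rule that[of "K * (2 / (1 - \<beta>))"])
    show "K * (2 / (1 - \<beta>)) > 0" using K b by simp
  next
    fix N u :: real and h :: "real \<Rightarrow> complex" and \<tau> :: "nat \<Rightarrow> real"
    assume N: "N \<ge> 1" and h[measurable]: "h \<in> borel_measurable borel" and h2: "integrable lborel (\<lambda>\<xi>. (cmod (h \<xi>))\<^sup>2)"
      and tau: "\<And>i. \<tau> i \<in> {0<..<1}"
    define \<mu> where "\<mu> = 1 / N\<^sup>2"
    have mu: "\<mu> > 0" using N by (simp add: \<mu>_def)
    define v where "v i x = (cmod (LINT \<xi>|lborel. wave \<gamma> \<mu> (\<Gamma> x (\<tau> i)) (\<tau> i) \<xi> * h \<xi>))\<^sup>2" for i x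
    have Gm[measurable]: "(\<lambda>x. \<Gamma> x (\<tau> i)) \<in> borel_measurable borel" for i
    proof (rule borel_measurable_continuous_onI)
      show "continuous_on UNIV (\<lambda>x. \<Gamma> x (\<tau> i))"
        using tau[of i] by (intro admissible_curve_continuous(1)[OF \<Gamma>]) auto
    qed
    have vm[measurable]: "v i \<in> borel_measurable borel" for i
    proof -
      have "(\<lambda>x. LINT \<xi>|lborel. wave \<gamma> \<mu> (\<Gamma> x (\<tau> i)) (\<tau> i) \<xi> * h \<xi>) \<in> borel_measurable borel"
        by (rule lborel.borel_measurable_lebesgue_integral) measurable
      then show ?thesis unfolding v_def[abs_def] by measurable
    qed
    define k where "k z = K * N powr (2 * \<sigma>) * (indicator {-1..1} z * \<bar>z\<bar> powr (- \<beta>))" for z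
    have kb: "has_bochner_integral lborel k (K * N powr (2 * \<sigma>) * (2 / (1 - \<beta>)))"
      unfolding k_def by (intro has_bochner_integral_mult_right integrable_abs_powr_interval b)
    define \<kappa> where "\<kappa> = K * N powr (2 * \<sigma>) * (2 / (1 - \<beta>))"
    have kap: "\<kappa> > 0" using K b N by (simp add: \<kappa>_def)
    have r2: "integrable lborel (\<lambda>\<xi>. (exp (- (\<mu> * \<xi>\<^sup>2)))\<^sup>2)"
    proof -
      have "(exp (- (\<mu> * \<xi>\<^sup>2)))\<^sup>2 = exp (- ((2 * \<mu>) * \<xi>\<^sup>2))" for \<xi>
        by (simp add: power2_eq_square exp_add[symmetric])
      then show ?thesis using integrable_gaussian(2)[of "2 * \<mu>"] mu by simp
    qed
    have fin: "(\<integral>\<^sup>+x. indicator {u..u+1} x * (SUP j\<in>{..n}. ennreal (v j x)) \<partial>lborel) \<le> ennreal (\<kappa> * (LINT \<xi>|lborel. (cmod (h \<xi>))\<^sup>2))" for n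
    proof -
      define P where "P x i \<longleftrightarrow> i \<le> n \<and> (\<forall>j\<le>n. v j x \<le> v i x)" for x i
      \<comment> \<open>Taking the least maximising index resolves ties in a measurable way.\<close>
      define ix where "ix x = (LEAST i. P x i)" for x
      have exP: "\<exists>i. P x i" for x
      proof -
        have "Max ((\<lambda>j. v j x) ` {..n}) \<in> (\<lambda>j. v j x) ` {..n}" by (rule Max_in) auto
        then obtain i where "i \<le> n" "v i x = Max ((\<lambda>j. v j x) ` {..n})"
          unfolding image_iff by (metis atMost_iff)
        then show ?thesis unfolding P_def by (intro exI[of _ i]) auto
      qed
      have Pix: "P x (ix x)" for x unfolding ix_def using exP by (rule LeastI_ex)
      have ixm[measurable]: "ix \<in> borel \<rightarrow>\<^sub>M count_space UNIV"
        unfolding ix_def[abs_def] P_def by measurable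
      have taum[measurable]: "(\<lambda>x. \<tau> (ix x)) \<in> borel_measurable borel"
        by (rule measurable_compose[OF ixm]) simp
      have Gix[measurable]: "(\<lambda>x. \<Gamma> x (\<tau> (ix x))) \<in> borel_measurable borel"
        by (rule measurable_compose_countable[OF Gm ixm])
      define \<phi> where "\<phi> x \<xi> = cnj (wave \<gamma> \<mu> (\<Gamma> x (\<tau> (ix x))) (\<tau> (ix x)) \<xi>)" for x \<xi>
      have phim: "(\<lambda>(x, \<xi>). \<phi> x \<xi>) \<in> borel_measurable (borel \<Otimes>\<^sub>M borel)"
        unfolding \<phi>_def case_prod_beta by measurable
      have phib: "cmod (\<phi> x \<xi>) \<le> exp (- (\<mu> * \<xi>\<^sup>2))" for x \<xi>
        unfolding \<phi>_def complex_mod_cnj cmod_wave by (simp add: distrib_right)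
      have Kb: "cmod (LINT \<xi>|lborel. \<phi> x \<xi> * cnj (\<phi> y \<xi>)) \<le> k (x - y)"
        if "x \<in> {u..u+1}" "y \<in> {u..u+1}" "x \<noteq> y" for x y
        using ker[OF N that(3) _ tau tau, of "ix x" "ix y"] that(1,2) by (auto simp: k_def \<phi>_def \<mu>_def indicator_def)
      have em: "emeasure lborel {u..u+1} < \<infinity>" by (simp add: emeasure_lborel_Icc_eq)
      have k0: "k z \<ge> 0" for z using K N by (simp add: k_def)
      have ki: "integrable lborel k" "(LINT z|lborel. k z) \<le> \<kappa>" using kb by (auto simp: has_bochner_integral_iff \<kappa>_def)
      note D = TT_star_dual_bound[OF phim phib r2 h h2 _ em Kb k0 ki kap]
      have vix: "(cmod (LINT \<xi>|lborel. cnj (\<phi> x \<xi>) * h \<xi>))\<^sup>2 = v (ix x) x" for x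
        by (simp add: \<phi>_def v_def)
      have "(\<integral>\<^sup>+x. indicator {u..u+1} x * (SUP j\<in>{..n}. ennreal (v j x)) \<partial>lborel) \<le> (\<integral>\<^sup>+x. ennreal (indicator {u..u+1} x * v (ix x) x) \<partial>lborel)"
      proof (rule nn_integral_mono)
        fix x
        have "(SUP j\<in>{..n}. ennreal (v j x)) \<le> ennreal (v (ix x) x)"
          using Pix[of x] by (intro SUP_least ennreal_leI) (auto simp: P_def)
        then show "indicator {u..u+1} x * (SUP j\<in>{..n}. ennreal (v j x)) \<le> ennreal (indicator {u..u+1} x * v (ix x) x)"
          by (auto simp: indicator_def)
      qed
      also have "\<dots> = ennreal (LINT x|lborel. indicator {u..u+1} x * v (ix x) x)"
        using D(1) unfolding vix by (intro nn_integral_eq_integral) (auto simp: v_def)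
      also have "\<dots> \<le> ennreal (\<kappa> * (LINT \<xi>|lborel. (cmod (h \<xi>))\<^sup>2))"
        using D(2) unfolding vix by (intro ennreal_leI) auto
      finally show ?thesis .
    qed
    have "(\<integral>\<^sup>+x. indicator {u..u+1} x * (SUP i. ennreal (v i x)) \<partial>lborel) = (\<integral>\<^sup>+x. (SUP n. indicator {u..u+1} x * (SUP j\<in>{..n}. ennreal (v j x))) \<partial>lborel)"
    proof (rule nn_integral_cong)
      fix x
      have "(SUP i. ennreal (v i x)) = (SUP n. SUP j\<in>{..n}. ennreal (v j x))"
      proof (rule antisym)
        show "(SUP i. ennreal (v i x)) \<le> (SUP n. SUP j\<in>{..n}. ennreal (v j x))"
          by (rule SUP_least) (auto intro!: SUP_upper2[OF UNIV_I] SUP_upper)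
        show "(SUP n. SUP j\<in>{..n}. ennreal (v j x)) \<le> (SUP i. ennreal (v i x))"
          by (intro SUP_least SUP_upper) auto
      qed
      then show "indicator {u..u+1} x * (SUP i. ennreal (v i x)) = (SUP n. indicator {u..u+1} x * (SUP j\<in>{..n}. ennreal (v j x)))"
        by (simp add: SUP_mult_left_ennreal)
    qed
    also have "\<dots> = (SUP n. \<integral>\<^sup>+x. indicator {u..u+1} x * (SUP j\<in>{..n}. ennreal (v j x)) \<partial>lborel)"
    proof (rule nn_integral_monotone_convergence_SUP)
      show "incseq (\<lambda>n x. indicator {u..u+1} x * (SUP j\<in>{..n}. ennreal (v j x)))"
        by (intro incseq_SucI le_funI mult_left_mono SUP_subset_mono) auto
    qed measurable
    also have "\<dots> \<le> ennreal (\<kappa> * (LINT \<xi>|lborel. (cmod (h \<xi>))\<^sup>2))"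
      by (rule SUP_least) (rule fin)
    also have "\<kappa> = K * (2 / (1 - \<beta>)) * N powr (2 * \<sigma>)" by (simp add: \<kappa>_def)
    finally show "(\<integral>\<^sup>+x. indicator {u..u+1} x * (SUP i. ennreal ((cmod (LINT \<xi>|lborel. wave \<gamma> (1/N\<^sup>2) (\<Gamma> x (\<tau> i)) (\<tau> i) \<xi> * h \<xi>))\<^sup>2)) \<partial>lborel)
       \<le> ennreal (K * (2 / (1 - \<beta>)) * N powr (2 * \<sigma>) * (LINT \<xi>|lborel. (cmod (h \<xi>))\<^sup>2))"
      unfolding v_def \<mu>_def by simp
  qed
qed

section \<open>Convergence above the critical exponent\<close>

text \<open>Multiplying \<open>h\<close> by \<open>exp (1/N\<^sup>2 * \<xi>\<^sup>2)\<close> cancels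
  the cutoff exactly. On the support of \<open>h\<close> this factor is at most
  \<open>exp 1\<close>, so it costs only a constant.\<close>

lemma band_limited_maximal_estimate:
  assumes g: "\<gamma> > 0" and a: "1/4 < \<alpha>" "\<alpha> < 1/2" and s: "s_crit \<alpha> \<gamma> < \<sigma>" "\<sigma> < 1/2"
    and \<Gamma>: "admissible_curve \<alpha> \<Gamma>"
  obtains A where "A > 0"
    "\<And>N h \<tau> u. \<lbrakk>N \<ge> 1; h \<in> borel_measurable borel; integrable lborel (\<lambda>\<xi>. (cmod (h \<xi>))\<^sup>2);
        \<And>\<xi>. \<bar>\<xi>\<bar> > N \<Longrightarrow> h \<xi> = 0; \<And>i::nat. \<tau> i \<in> {0<..<1}\<rbrakk> \<Longrightarrow>
      (\<integral>\<^sup>+x. indicator {u..u+1} x * (SUP i. ennreal ((cmod (P_gamma \<gamma> h (\<Gamma> x (\<tau> i)) (\<tau> i)))\<^sup>2)) \<partial>lborel)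
       \<le> ennreal (A * N powr (2 * \<sigma>) * (LINT \<xi>|lborel. (cmod (h \<xi>))\<^sup>2))"
proof -
  from maximal_estimate[OF g a s \<Gamma>] obtain A where A: "A > 0" and
    est: "\<And>N h \<tau> u. \<lbrakk>N \<ge> 1; h \<in> borel_measurable borel; integrable lborel (\<lambda>\<xi>. (cmod (h \<xi>))\<^sup>2); \<And>i::nat. \<tau> i \<in> {0<..<1}\<rbrakk> \<Longrightarrow>
      (\<integral>\<^sup>+x. indicator {u..u+1} x * (SUP i. ennreal ((cmod (LINT \<xi>|lborel. wave \<gamma> (1/N\<^sup>2) (\<Gamma> x (\<tau> i)) (\<tau> i) \<xi> * h \<xi>))\<^sup>2)) \<partial>lborel)
       \<le> ennreal (A * N powr (2 * \<sigma>) * (LINT \<xi>|lborel. (cmod (h \<xi>))\<^sup>2))" by blast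
  show ?thesis
  proof (rule that[of "A * (exp 1)\<^sup>2"])
    show "A * (exp 1)\<^sup>2 > 0" using A by simp
  next
    fix N u :: real and h :: "real \<Rightarrow> complex" and \<tau> :: "nat \<Rightarrow> real"
    assume N: "N \<ge> 1" and h[measurable]: "h \<in> borel_measurable borel" and h2: "integrable lborel (\<lambda>\<xi>. (cmod (h \<xi>))\<^sup>2)"
      and supp: "\<And>\<xi>. \<bar>\<xi>\<bar> > N \<Longrightarrow> h \<xi> = 0" and tau: "\<And>i. \<tau> i \<in> {0<..<1}"
    define H where "H \<xi> = complex_of_real (exp (1/N\<^sup>2 * \<xi>\<^sup>2)) * h \<xi>" for \<xi>
    have [measurable]: "H \<in> borel_measurable borel" unfolding H_def[abs_def] by measurable
    have Hb: "(cmod (H \<xi>))\<^sup>2 \<le> (exp 1)\<^sup>2 * (cmod (h \<xi>))\<^sup>2" for \<xi>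
    proof (cases "\<bar>\<xi>\<bar> > N")
      case False
      then have "\<xi>\<^sup>2 \<le> N\<^sup>2" using N by (simp add: abs_le_square_iff[symmetric])
      then have "exp (1/N\<^sup>2 * \<xi>\<^sup>2) \<le> exp 1" using N by (simp add: divide_le_eq)
      then have "cmod (H \<xi>) \<le> exp 1 * cmod (h \<xi>)" by (simp add: H_def norm_mult mult_right_mono)
      from power_mono[OF this, of 2] show ?thesis by (simp add: power_mult_distrib)
    qed (simp add: H_def supp)
    have H2: "integrable lborel (\<lambda>\<xi>. (cmod (H \<xi>))\<^sup>2)"
      using h2 Hb by (intro Bochner_Integration.integrable_bound[OF integrable_mult_right[OF h2, of "(exp 1)\<^sup>2"]]) auto
    have P: "ennreal ((cmod (P_gamma \<gamma> h y t))\<^sup>2) \<le> ennreal ((cmod (LINT \<xi>|lborel. wave \<gamma> (1/N\<^sup>2) y t \<xi> * H \<xi>))\<^sup>2)" for y t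
    proof -
      have "wave \<gamma> (1/N\<^sup>2) y t \<xi> * H \<xi> = wave \<gamma> 0 y t \<xi> * h \<xi>" for \<xi>
      proof -
        have "exp (- ((t powr \<gamma> + 1/N\<^sup>2) * \<xi>\<^sup>2)) * exp (1/N\<^sup>2 * \<xi>\<^sup>2) = exp (- (t powr \<gamma> * \<xi>\<^sup>2))"
          by (simp add: exp_add[symmetric] algebra_simps)
        then have "complex_of_real (exp (- ((t powr \<gamma> + 1/N\<^sup>2) * \<xi>\<^sup>2))) * complex_of_real (exp (1/N\<^sup>2 * \<xi>\<^sup>2)) = complex_of_real (exp (- (t powr \<gamma> * \<xi>\<^sup>2)))"
          by (simp only: flip: of_real_mult)
        then show ?thesis unfolding wave_def H_def by (simp add: mult.assoc)
      qed
      then have "cmod (P_gamma \<gamma> h y t) = 1 / (2 * pi) * cmod (LINT \<xi>|lborel. wave \<gamma> (1/N\<^sup>2) y t \<xi> * H \<xi>)"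
        by (simp add: P_gamma_wave norm_mult norm_divide)
      also have "\<dots> \<le> 1 * cmod (LINT \<xi>|lborel. wave \<gamma> (1/N\<^sup>2) y t \<xi> * H \<xi>)"
        using pi_ge_two by (intro mult_right_mono) (auto simp: field_simps)
      finally show ?thesis by (intro ennreal_leI power_mono) auto
    qed
    have "(\<integral>\<^sup>+x. indicator {u..u+1} x * (SUP i. ennreal ((cmod (P_gamma \<gamma> h (\<Gamma> x (\<tau> i)) (\<tau> i)))\<^sup>2)) \<partial>lborel)
      \<le> (\<integral>\<^sup>+x. indicator {u..u+1} x * (SUP i. ennreal ((cmod (LINT \<xi>|lborel. wave \<gamma> (1/N\<^sup>2) (\<Gamma> x (\<tau> i)) (\<tau> i) \<xi> * H \<xi>))\<^sup>2)) \<partial>lborel)"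
      by (intro nn_integral_mono mult_left_mono SUP_mono) (use P in auto)
    also have "\<dots> \<le> ennreal (A * N powr (2 * \<sigma>) * (LINT \<xi>|lborel. (cmod (H \<xi>))\<^sup>2))"
      by (rule est[OF N _ H2 tau]) measurable
    also have "\<dots> \<le> ennreal (A * (exp 1)\<^sup>2 * N powr (2 * \<sigma>) * (LINT \<xi>|lborel. (cmod (h \<xi>))\<^sup>2))"
    proof (rule ennreal_leI)
      have "(LINT \<xi>|lborel. (cmod (H \<xi>))\<^sup>2) \<le> (LINT \<xi>|lborel. (exp 1)\<^sup>2 * (cmod (h \<xi>))\<^sup>2)"
        using H2 h2 Hb by (intro integral_mono) auto
      then have "A * N powr (2 * \<sigma>) * (LINT \<xi>|lborel. (cmod (H \<xi>))\<^sup>2) \<le> A * N powr (2 * \<sigma>) * ((exp 1)\<^sup>2 * (LINT \<xi>|lborel. (cmod (h \<xi>))\<^sup>2))"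
        using A by (intro mult_left_mono) auto
      then show "A * N powr (2 * \<sigma>) * (LINT \<xi>|lborel. (cmod (H \<xi>))\<^sup>2) \<le> A * (exp 1)\<^sup>2 * N powr (2 * \<sigma>) * (LINT \<xi>|lborel. (cmod (h \<xi>))\<^sup>2)"
        by (simp add: mult_ac)
    qed
    finally show "(\<integral>\<^sup>+x. indicator {u..u+1} x * (SUP i. ennreal ((cmod (P_gamma \<gamma> h (\<Gamma> x (\<tau> i)) (\<tau> i)))\<^sup>2)) \<partial>lborel)
       \<le> ennreal (A * (exp 1)\<^sup>2 * N powr (2 * \<sigma>) * (LINT \<xi>|lborel. (cmod (h \<xi>))\<^sup>2))" .
  qed
qed

lemma P_gamma_tendsto:
  assumes g: "\<gamma> > 0" and h: "integrable lborel h" and y: "y \<longlonglongrightarrow> y0" and t: "t \<longlonglongrightarrow> t0" and t0: "\<And>n. t n \<ge> 0"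
  shows "(\<lambda>n. P_gamma \<gamma> h (y n) (t n)) \<longlonglongrightarrow> P_gamma \<gamma> h y0 t0"
proof -
  have [measurable]: "h \<in> borel_measurable borel" using h by auto
  have tg: "(\<lambda>n. t n powr \<gamma>) \<longlonglongrightarrow> t0 powr \<gamma>"
    by (rule tendsto_powr'[OF t tendsto_const]) (use g t0 in auto)
  have "(\<lambda>n. LINT \<xi>|lborel. wave \<gamma> 0 (y n) (t n) \<xi> * h \<xi>) \<longlonglongrightarrow> (LINT \<xi>|lborel. wave \<gamma> 0 y0 t0 \<xi> * h \<xi>)"
  proof (rule integral_dominated_convergence[where w = "\<lambda>\<xi>. norm (h \<xi>)"])
    show "AE \<xi> in lborel. (\<lambda>n. wave \<gamma> 0 (y n) (t n) \<xi> * h \<xi>) \<longlonglongrightarrow> wave \<gamma> 0 y0 t0 \<xi> * h \<xi>"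
      unfolding wave_def by (intro AE_I2 tendsto_intros y t tg)
    show "AE \<xi> in lborel. norm (wave \<gamma> 0 (y n) (t n) \<xi> * h \<xi>) \<le> norm (h \<xi>)" for n
      by (intro AE_I2) (simp add: norm_mult cmod_wave mult_left_le_one_le)
    show "integrable lborel (\<lambda>\<xi>. norm (h \<xi>))" using h by simp
  qed measurable
  then show ?thesis unfolding P_gamma_wave by (rule tendsto_mult_left)
qed

lemma P_gamma_curve_continuous:
  assumes g: "\<gamma> > 0" and h: "integrable lborel h" and \<Gamma>: "admissible_curve \<alpha> \<Gamma>"
  shows "continuous_on {0..1} (\<lambda>t. P_gamma \<gamma> h (\<Gamma> x t) t)"
  unfolding continuous_on_sequentially
proof (intro allI ballI impI)
  fix X :: "nat \<Rightarrow> real" and t assume t: "t \<in> {0..1}" and X: "(\<forall>n. X n \<in> {0..1}) \<and> X \<longlonglongrightarrow> t"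
  have "continuous_on {0..1} (\<Gamma> x)"
    by (rule continuous_on_subset[OF admissible_curve_continuous(2)[OF \<Gamma>]]) auto
  then have "(\<lambda>n. \<Gamma> x (X n)) \<longlonglongrightarrow> \<Gamma> x t"
    using t X unfolding continuous_on_sequentially comp_def by blast
  then show "((\<lambda>t. P_gamma \<gamma> h (\<Gamma> x t) t) \<circ> X) \<longlonglongrightarrow> P_gamma \<gamma> h (\<Gamma> x t) t"
    unfolding comp_def using X by (intro P_gamma_tendsto[OF g h]) auto
qed

text \<open>The maximal estimate handles a sequence of times; since band-limited evolutions are
  continuous in time along the curve, a dense sequence controls the whole interval, including time
  zero.\<close>

lemma rational_times:
  obtains \<tau> :: "nat \<Rightarrow> real" where "\<And>i. \<tau> i \<in> {0<..<1}" "closure (range \<tau>) = {0..1}"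
proof -
  let ?S = "{0<..<1::real} \<inter> \<rat>"
  have c: "countable ?S" using countable_rat by (rule countable_subset[rotated]) auto
  have "1/2 \<in> ?S" by simp
  then have ne: "?S \<noteq> {}" by blast
  have "closure ?S = closure {0<..<1::real}"
    by (rule closure_open_Int_superset) (auto simp: Rats_closure_real)
  then have "closure ?S = {0..1}" by simp
  then show ?thesis
    using that[of "from_nat_into ?S"] from_nat_into[OF ne] range_from_nat_into[OF ne c] by auto
qed

text \<open>The compact intervals form a generator stable under intersection. Closure under
  complements needs the integral over the whole line, which is not a compact interval and is
  therefore a separate assumption.\<close>

lemma AE_zero_of_interval_integrals:
  fixes h :: "real \<Rightarrow> complex"
  assumes h: "integrable lborel h" and I: "\<And>a b. (LINT x|lborel. indicator {a..b} x *\<^sub>R h x) = 0"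
    and tot: "(LINT x|lborel. h x) = 0"
  shows "AE x in lborel. h x = 0"
proof (rule sigma_finite_measure.density_zero[OF sigma_finite_lborel h])
  fix A :: "real set" assume "A \<in> sets lborel"
  then have A: "A \<in> sigma_sets UNIV (range (\<lambda>(a, b). {a..b}))"
    by (simp add: borel_eq_atLeastAtMost)
  have sb: "B \<in> sets borel" if "B \<in> sigma_sets UNIV (range (\<lambda>(a, b). {a..b::real}))" for B
    using that by (simp add: borel_eq_atLeastAtMost)
  have si: "set_integrable lborel B h" if "B \<in> sets borel" for B
    unfolding set_integrable_def using that h by (intro integrable_mult_indicator) auto
  have "{a..b} \<inter> {c..d} \<in> range (\<lambda>(a, b). {a..b::real})" for a b c d
    by (rule range_eqI[where x = "(max a c, min b d)"]) simp
  then have gen: "Int_stable (range (\<lambda>(a, b). {a..b::real}))" "range (\<lambda>(a, b). {a..b::real}) \<subseteq> Pow UNIV"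
    unfolding Int_stable_def by auto
  from gen A show "set_lebesgue_integral lborel A h = 0"
  proof (induction rule: sigma_sets_induct_disjoint)
    case (basic A)
    then show ?case using I by (auto simp: set_lebesgue_integral_def)
  next
    case empty
    then show ?case by (simp add: set_lebesgue_integral_def)
  next
    case (compl A)
    have "set_lebesgue_integral lborel (A \<union> (UNIV - A)) h = set_lebesgue_integral lborel A h + set_lebesgue_integral lborel (UNIV - A) h"
      using sb[OF compl(1)] by (intro set_integral_Un si) auto
    moreover have "set_lebesgue_integral lborel (A \<union> (UNIV - A)) h = 0"
      using tot by (simp add: set_lebesgue_integral_def)
    ultimately show ?case using compl by simp
  next
    case (union A)
    have m: "A i \<in> sets borel" for i using union(2) by (intro sb) auto
    have "set_lebesgue_integral lborel (\<Union>i. A i) h = (\<Sum>i. set_lebesgue_integral lborel (A i) h)"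
      using m union(1) by (intro lebesgue_integral_countable_add si) (auto simp: disjoint_family_on_def)
    then show ?case using union by simp
  qed
qed

section \<open>Decomposition into dyadic frequency bands\<close>

definition band :: "(real \<Rightarrow> complex) \<Rightarrow> nat \<Rightarrow> real \<Rightarrow> complex" where
  "band g k \<xi> = (if \<bar>\<xi>\<bar> < 2 ^ k \<and> (k = 0 \<or> 2 ^ (k - 1) \<le> \<bar>\<xi>\<bar>) then g \<xi> else 0)"

lemma sum_band: "(\<Sum>k\<le>n. band g k \<xi>) = (if \<bar>\<xi>\<bar> < 2 ^ n then g \<xi> else 0)"
proof (induction n)
  case (Suc n)
  have "(2::real) ^ n \<le> 2 ^ Suc n" by simp
  then show ?case using Suc by (auto simp: band_def)
qed (simp add: band_def)

lemma sum_band_tendsto: "(\<lambda>n. \<Sum>k\<le>n. band g k \<xi>) \<longlonglongrightarrow> g \<xi>"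
proof -
  obtain n0 where n0: "\<bar>\<xi>\<bar> < 2 ^ n0" using real_arch_pow[of 2 "\<bar>\<xi>\<bar>"] by auto
  have "\<forall>\<^sub>F n in sequentially. (\<Sum>k\<le>n. band g k \<xi>) = g \<xi>"
    using eventually_ge_at_top[of n0]
  proof eventually_elim
    case (elim n)
    then have "(2::real) ^ n0 \<le> 2 ^ n" by (intro power_increasing) auto
    with n0 have "\<bar>\<xi>\<bar> < 2 ^ n" by (rule order.strict_trans2)
    then show ?case by (simp add: sum_band)
  qed
  then show ?thesis by (rule tendsto_eventually)
qed

lemma norm_sum_band_le: "norm (\<Sum>k\<le>n. band g k \<xi>) \<le> norm (g \<xi>)"
  by (simp add: sum_band)

lemma band_measurable [measurable]: "g \<in> borel_measurable borel \<Longrightarrow> band g k \<in> borel_measurable borel"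
proof -
  assume [measurable]: "g \<in> borel_measurable borel"
  show ?thesis unfolding band_def[abs_def] by measurable
qed

lemma band_L2:
  assumes [measurable]: "g \<in> borel_measurable borel" and g2: "integrable lborel (\<lambda>\<xi>. (cmod (g \<xi>))\<^sup>2)"
  shows "integrable lborel (\<lambda>\<xi>. (cmod (band g k \<xi>))\<^sup>2)" "integrable lborel (band g k)"
proof -
  show b2: "integrable lborel (\<lambda>\<xi>. (cmod (band g k \<xi>))\<^sup>2)"
    by (rule Bochner_Integration.integrable_bound[OF g2]) (auto simp: band_def)
  show "integrable lborel (band g k)"
  proof (rule Bochner_Integration.integrable_bound)
    show "integrable lborel (\<lambda>x. indicator {- (2 ^ k) .. 2 ^ k} x + (cmod (g x))\<^sup>2)"
      using g2 by (intro Bochner_Integration.integrable_add integrable_real_indicator) (auto simp: emeasure_lborel_Icc_eq)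
    have "cmod z \<le> 1 + (cmod z)\<^sup>2" for z by (rule le_one_plus_square)
    then show "AE x in lborel. norm (band g k x) \<le> norm (indicator {- (2 ^ k) .. 2 ^ k} x + (cmod (g x))\<^sup>2)"
      by (auto simp: band_def indicator_def)
  qed measurable
qed

lemma band_sobolev:
  assumes [measurable]: "g \<in> borel_measurable borel" and g2: "integrable lborel (\<lambda>\<xi>. (cmod (g \<xi>))\<^sup>2)"
    and gs: "integrable lborel (\<lambda>\<xi>. (1 + \<xi>\<^sup>2) powr s * (cmod (g \<xi>))\<^sup>2)" and s: "s \<ge> 0"
  shows "(LINT \<xi>|lborel. (cmod (band g k \<xi>))\<^sup>2) \<le> 2 powr (2 * s) * (2 ^ k) powr (- 2 * s) * (LINT \<xi>|lborel. (1 + \<xi>\<^sup>2) powr s * (cmod (g \<xi>))\<^sup>2)"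
proof -
  have pt: "(cmod (band g k \<xi>))\<^sup>2 \<le> 2 powr (2 * s) * (2 ^ k) powr (- 2 * s) * ((1 + \<xi>\<^sup>2) powr s * (cmod (g \<xi>))\<^sup>2)" for \<xi>
  proof (cases "\<bar>\<xi>\<bar> < 2 ^ k \<and> (k = 0 \<or> 2 ^ (k - 1) \<le> \<bar>\<xi>\<bar>)")
    case True
    \<comment> \<open>Half of the outer radius bounds \<open>\<xi>\<close> from below on every band
      with \<open>k > 0\<close>; for \<open>k = 0\<close> the left side is only 1/4. The halving is
      the origin of the factor \<open>2 powr (2 * s)\<close>.\<close>
    have "(2 ^ k / 2)\<^sup>2 \<le> 1 + \<xi>\<^sup>2"
    proof (cases k)
      case 0
      have "(1/2)\<^sup>2 \<le> (1::real)" by (simp add: power2_eq_square)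
      then show ?thesis using 0 by (simp add: add_increasing2)
    next
      case (Suc j)
      then have "2 ^ k / 2 \<le> \<bar>\<xi>\<bar>" using True by simp
      from power_mono[OF this, of 2] show ?thesis by simp
    qed
    then have "((2 ^ k / 2)\<^sup>2) powr s \<le> (1 + \<xi>\<^sup>2) powr s" using s by (intro powr_mono2) auto
    moreover have "((2 ^ k / 2)\<^sup>2) powr s = (2 ^ k / 2) powr (2 * s)" for k :: nat
      using powr_powr[of "2 ^ k / 2" 2 s] by (simp add: powr_numeral)
    moreover have "2 powr (2 * s) * (2 ^ k) powr (- 2 * s) * (2 ^ k / 2) powr (2 * s) = 1"
    proof -
      have "2 powr (2 * s) * (2 ^ k / 2) powr (2 * s) = (2 ^ k) powr (2 * s)"
        by (simp flip: powr_mult)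
      then have "2 powr (2 * s) * (2 ^ k) powr (- 2 * s) * (2 ^ k / 2) powr (2 * s) = (2 ^ k) powr (- 2 * s) * (2 ^ k) powr (2 * s)"
        by (metis mult.assoc mult.commute)
      then show ?thesis by (simp flip: powr_add)
    qed
    ultimately have "1 \<le> 2 powr (2 * s) * (2 ^ k) powr (- 2 * s) * (1 + \<xi>\<^sup>2) powr s"
      by (metis mult_left_mono powr_ge_zero mult_nonneg_nonneg)
    from mult_right_mono[OF this, of "(cmod (g \<xi>))\<^sup>2"] show ?thesis
      using True by (simp add: band_def mult.assoc)
  qed (auto simp: band_def)
  have "(LINT \<xi>|lborel. (cmod (band g k \<xi>))\<^sup>2) \<le> (LINT \<xi>|lborel. 2 powr (2 * s) * (2 ^ k) powr (- 2 * s) * ((1 + \<xi>\<^sup>2) powr s * (cmod (g \<xi>))\<^sup>2))"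
    using gs band_L2[OF _ g2] pt by (intro integral_mono) auto
  then show ?thesis by simp
qed


text \<open>At a positive time the damping is square integrable, so its product with the merely
  square integrable \<open>g\<close> is integrable and dominates all partial sums of bands.\<close>

lemma P_gamma_sum_bands:
  assumes g[measurable]: "g \<in> borel_measurable borel" and g2: "integrable lborel (\<lambda>\<xi>. (cmod (g \<xi>))\<^sup>2)" and t: "t > 0"
  shows "(\<lambda>k. P_gamma \<gamma> (band g k) y t) sums P_gamma \<gamma> g y t"
proof -
  define c where "c = t powr \<gamma>"
  have c: "c > 0" using t by (simp add: c_def)
  have wi: "integrable lborel (\<lambda>\<xi>. exp (- (c * \<xi>\<^sup>2)) * cmod (g \<xi>))"
  proof (rule Bochner_Integration.integrable_bound)
    show "integrable lborel (\<lambda>\<xi>. exp (- ((2 * c) * \<xi>\<^sup>2)) + (cmod (g \<xi>))\<^sup>2)"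
      using g2 integrable_gaussian(2)[of "2 * c"] c by (intro Bochner_Integration.integrable_add) auto
    show "AE \<xi> in lborel. norm (exp (- (c * \<xi>\<^sup>2)) * cmod (g \<xi>)) \<le> norm (exp (- ((2 * c) * \<xi>\<^sup>2)) + (cmod (g \<xi>))\<^sup>2)"
    proof (rule AE_I2)
      fix \<xi>
      have "2 * exp (- (c * \<xi>\<^sup>2)) * cmod (g \<xi>) \<le> (exp (- (c * \<xi>\<^sup>2)))\<^sup>2 + (cmod (g \<xi>))\<^sup>2"
        by (rule sum_squares_bound)
      moreover have "(exp (- (c * \<xi>\<^sup>2)))\<^sup>2 = exp (- ((2 * c) * \<xi>\<^sup>2))"
        by (simp add: power2_eq_square exp_add[symmetric])
      moreover have "0 \<le> exp (- (c * \<xi>\<^sup>2)) * cmod (g \<xi>)" by simp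
      ultimately have "exp (- (c * \<xi>\<^sup>2)) * cmod (g \<xi>) \<le> exp (- ((2 * c) * \<xi>\<^sup>2)) + (cmod (g \<xi>))\<^sup>2"
        by linarith
      then show "norm (exp (- (c * \<xi>\<^sup>2)) * cmod (g \<xi>)) \<le> norm (exp (- ((2 * c) * \<xi>\<^sup>2)) + (cmod (g \<xi>))\<^sup>2)"
        by simp
    qed
  qed measurable
  have bi: "integrable lborel (\<lambda>\<xi>. wave \<gamma> 0 y t \<xi> * band g k \<xi>)" for k
    by (rule Bochner_Integration.integrable_bound[OF band_L2(2)[OF g g2, of k]])
       (auto simp: norm_mult cmod_wave intro!: AE_I2 mult_left_le_one_le)
  have "(\<lambda>n. LINT \<xi>|lborel. wave \<gamma> 0 y t \<xi> * (\<Sum>k\<le>n. band g k \<xi>)) \<longlonglongrightarrow> (LINT \<xi>|lborel. wave \<gamma> 0 y t \<xi> * g \<xi>)"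
  proof (rule integral_dominated_convergence[OF _ _ wi])
    show "AE \<xi> in lborel. (\<lambda>n. wave \<gamma> 0 y t \<xi> * (\<Sum>k\<le>n. band g k \<xi>)) \<longlonglongrightarrow> wave \<gamma> 0 y t \<xi> * g \<xi>"
      by (intro AE_I2 tendsto_mult_left sum_band_tendsto)
    show "AE \<xi> in lborel. norm (wave \<gamma> 0 y t \<xi> * (\<Sum>k\<le>n. band g k \<xi>)) \<le> exp (- (c * \<xi>\<^sup>2)) * cmod (g \<xi>)" for n
      using norm_sum_band_le[of g _ n] by (intro AE_I2) (simp add: norm_mult cmod_wave c_def mult_left_mono)
  qed measurable
  moreover have "(LINT \<xi>|lborel. wave \<gamma> 0 y t \<xi> * (\<Sum>k\<le>n. band g k \<xi>)) = (\<Sum>k\<le>n. LINT \<xi>|lborel. wave \<gamma> 0 y t \<xi> * band g k \<xi>)" for n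
    unfolding sum_distrib_left by (rule Bochner_Integration.integral_sum) (rule bi)
  ultimately have "(\<lambda>k. LINT \<xi>|lborel. wave \<gamma> 0 y t \<xi> * band g k \<xi>) sums (LINT \<xi>|lborel. wave \<gamma> 0 y t \<xi> * g \<xi>)"
    unfolding sums_def_le by simp
  then show ?thesis unfolding P_gamma_wave by (rule sums_mult)
qed

text \<open>Writes the inverse transform through \<open>fourier_int\<close>, which makes its
  measurability and \<open>fourier_multiplication_formula\<close> available at time zero.\<close>

lemma P_gamma_zero_time:
  assumes g: "\<gamma> > 0"
  shows "P_gamma \<gamma> h x 0 = complex_of_real (1 / (2 * pi)) * cnj (fourier_int (\<lambda>\<xi>. cnj (h \<xi>)) x)"
proof -
  have "cnj (fourier_int (\<lambda>\<xi>. cnj (h \<xi>)) x) = (LINT \<xi>|lborel. cnj (exp (- (\<i> * complex_of_real (\<xi> * x))) * cnj (h \<xi>)))"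
    unfolding fourier_int_def by (rule Bochner_Integration.integral_cnj[symmetric])
  also have "\<dots> = (LINT \<xi>|lborel. wave \<gamma> 0 x 0 \<xi> * h \<xi>)"
    using g by (simp add: wave_def exp_cnj mult.commute)
  finally show ?thesis unfolding P_gamma_wave by simp
qed

text \<open>The maximal estimate loses \<open>(2 ^ k) powr (2 * \<sigma>)\<close> on the band
  \<open>k\<close>, and the Sobolev weight gains \<open>(2 ^ k) powr (- 2 * s)\<close>. As
  \<open>\<sigma> < s\<close>, the net factor is \<open>\<rho> ^ k\<close>. The constant
  \<open>C\<close> serves all unit intervals at once.\<close>

lemma band_maximal_decay:
  assumes g: "\<gamma> > 0" and a: "1/4 < \<alpha>" "\<alpha> < 1/2" and s: "s_crit \<alpha> \<gamma> < s"
    and \<Gamma>: "admissible_curve \<alpha> \<Gamma>"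
    and hm[measurable]: "h \<in> borel_measurable borel" and h2: "integrable lborel (\<lambda>\<xi>. (cmod (h \<xi>))\<^sup>2)"
    and hs: "integrable lborel (\<lambda>\<xi>. (1 + \<xi>\<^sup>2) powr s * (cmod (h \<xi>))\<^sup>2)"
  obtains C \<rho> Mx where "0 \<le> C" "0 < \<rho>" "\<rho> < 1"
    "\<And>k. Mx k \<in> borel_measurable borel"
    "\<And>k u. (\<integral>\<^sup>+x. indicator {u..u+1} x * Mx k x \<partial>lborel) \<le> ennreal (C * \<rho> ^ k)"
    "\<And>k x t. t \<in> {0..1} \<Longrightarrow> ennreal ((cmod (P_gamma \<gamma> (band h k) (\<Gamma> x t) t))\<^sup>2) \<le> Mx k x"
proof -
  have sc: "s_crit \<alpha> \<gamma> < 1/2"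
  proof -
    have "\<gamma> < 2 \<Longrightarrow> 1 / \<gamma> > 0" using g by simp
    then show ?thesis using a g by (auto simp: s_crit_def)
  qed
  \<comment> \<open>Strictly between the critical exponent and \<open>s\<close>, with
    \<open>s\<close> capped at 1/2 because the kernel estimates require
    \<open>\<sigma> < 1/2\<close>.\<close>
  define \<sigma> where "\<sigma> = (s_crit \<alpha> \<gamma> + min s (1/2)) / 2"
  have sg: "s_crit \<alpha> \<gamma> < \<sigma>" "\<sigma> < 1/2" "\<sigma> < s" using s sc by (auto simp: \<sigma>_def min_def)
  have sg0: "\<sigma> > 0" by (rule critical_exponent_parameters(3)[OF g a sg(1,2)])
  from band_limited_maximal_estimate[OF g a sg(1,2) \<Gamma>] obtain A where A: "A > 0" and est:
    "\<And>N h \<tau> u. \<lbrakk>N \<ge> 1; h \<in> borel_measurable borel; integrable lborel (\<lambda>\<xi>. (cmod (h \<xi>))\<^sup>2);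
        \<And>\<xi>. \<bar>\<xi>\<bar> > N \<Longrightarrow> h \<xi> = 0; \<And>i::nat. \<tau> i \<in> {0<..<1}\<rbrakk> \<Longrightarrow>
      (\<integral>\<^sup>+x. indicator {u..u+1} x * (SUP i. ennreal ((cmod (P_gamma \<gamma> h (\<Gamma> x (\<tau> i)) (\<tau> i)))\<^sup>2)) \<partial>lborel)
       \<le> ennreal (A * N powr (2 * \<sigma>) * (LINT \<xi>|lborel. (cmod (h \<xi>))\<^sup>2))" by blast
  obtain \<tau> :: "nat \<Rightarrow> real" where tau: "\<And>i. \<tau> i \<in> {0<..<1}" and tcl: "closure (range \<tau>) = {0..1}"
    using rational_times by blast
  define S where "S = (LINT \<xi>|lborel. (1 + \<xi>\<^sup>2) powr s * (cmod (h \<xi>))\<^sup>2)"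
  have S0: "S \<ge> 0" unfolding S_def by (intro Bochner_Integration.integral_nonneg) auto
  define \<rho> where "\<rho> = 2 powr (- 2 * (s - \<sigma>))"
  have r: "0 < \<rho>" "\<rho> < 1" using sg powr_less_one[of 2 "- 2 * (s - \<sigma>)"] by (auto simp: \<rho>_def)
  define Mx where "Mx k x = (SUP i. ennreal ((cmod (P_gamma \<gamma> (band h k) (\<Gamma> x (\<tau> i)) (\<tau> i)))\<^sup>2))" for k x
  show ?thesis
  proof (rule that[of "A * 2 powr (2 * s) * S" \<rho> Mx])
    show "0 \<le> A * 2 powr (2 * s) * S" using A S0 by simp
    show "0 < \<rho>" "\<rho> < 1" by fact+
  next
    fix k
    have Gm[measurable]: "(\<lambda>x. \<Gamma> x (\<tau> i)) \<in> borel_measurable borel" for i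
    proof (rule borel_measurable_continuous_onI)
      show "continuous_on UNIV (\<lambda>x. \<Gamma> x (\<tau> i))"
        using tau[of i] by (intro admissible_curve_continuous(1)[OF \<Gamma>]) auto
    qed
    have "(\<lambda>x. P_gamma \<gamma> (band h k) (\<Gamma> x (\<tau> i)) (\<tau> i)) \<in> borel_measurable borel" for i
    proof -
      have "(\<lambda>x. LINT \<xi>|lborel. wave \<gamma> 0 (\<Gamma> x (\<tau> i)) (\<tau> i) \<xi> * band h k \<xi>) \<in> borel_measurable borel"
        by (rule lborel.borel_measurable_lebesgue_integral) measurable
      then show ?thesis unfolding P_gamma_wave by measurable
    qed
    note [measurable] = this
    show "Mx k \<in> borel_measurable borel" unfolding Mx_def[abs_def] by measurable
  next
    fix k and u :: real
    have "(\<integral>\<^sup>+x. indicator {u..u+1} x * Mx k x \<partial>lborel) \<le> ennreal (A * (2 ^ k) powr (2 * \<sigma>) * (LINT \<xi>|lborel. (cmod (band h k \<xi>))\<^sup>2))"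
      unfolding Mx_def by (rule est[OF _ _ band_L2(1)[OF hm h2] _ tau]) (auto simp: band_def)
    also have "\<dots> \<le> ennreal (A * 2 powr (2 * s) * S * \<rho> ^ k)"
    proof (rule ennreal_leI)
      have "A * (2 ^ k) powr (2 * \<sigma>) * (LINT \<xi>|lborel. (cmod (band h k \<xi>))\<^sup>2)
         \<le> A * (2 ^ k) powr (2 * \<sigma>) * (2 powr (2 * s) * (2 ^ k) powr (- 2 * s) * S)"
        unfolding S_def using A sg sg0 by (intro mult_left_mono band_sobolev[OF hm h2 hs]) auto
      also have "\<dots> = A * 2 powr (2 * s) * S * ((2 ^ k) powr (2 * \<sigma>) * (2 ^ k) powr (- 2 * s))"
        by (simp only: mult_ac)
      also have "(2 ^ k) powr (2 * \<sigma>) * (2 ^ k) powr (- 2 * s) = \<rho> ^ k"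
      proof -
        have "(2 ^ k) powr (2 * \<sigma>) * (2 ^ k) powr (- 2 * s) = (2 powr real k) powr (- 2 * (s - \<sigma>))"
          by (simp add: powr_realpow powr_add[symmetric] algebra_simps)
        also have "\<dots> = \<rho> powr real k" unfolding \<rho>_def by (simp add: powr_powr mult.commute)
        also have "\<dots> = \<rho> ^ k" using r by (simp add: powr_realpow)
        finally show ?thesis .
      qed
      finally show "A * (2 ^ k) powr (2 * \<sigma>) * (LINT \<xi>|lborel. (cmod (band h k \<xi>))\<^sup>2) \<le> A * 2 powr (2 * s) * S * \<rho> ^ k" .
    qed
    finally show "(\<integral>\<^sup>+x. indicator {u..u+1} x * Mx k x \<partial>lborel) \<le> ennreal (A * 2 powr (2 * s) * S * \<rho> ^ k)" .
  next
    fix k and x t :: real assume t: "t \<in> {0..1}"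
    let ?p = "\<lambda>t. P_gamma \<gamma> (band h k) (\<Gamma> x t) t"
    show "ennreal ((cmod (?p t))\<^sup>2) \<le> Mx k x"
    proof (cases "Mx k x = \<top>")
      case False
      then obtain m where m: "Mx k x = ennreal m" "m \<ge> 0" by (cases "Mx k x") auto
      have "cmod (?p s) \<le> sqrt m" if sr: "s \<in> range \<tau>" for s
      proof -
        have "ennreal ((cmod (?p s))\<^sup>2) \<le> Mx k x" unfolding Mx_def using sr by (auto intro: SUP_upper)
        then have "(cmod (?p s))\<^sup>2 \<le> m" using m by simp
        then show ?thesis by (simp add: real_le_rsqrt)
      qed
      \<comment> \<open>The bound on the dense set of times passes to its closure by continuity, so
        \<open>Mx\<close> also controls \<open>t = 0\<close>.\<close>
      moreover have "continuous_on (closure (range \<tau>)) ?p"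
        unfolding tcl by (rule P_gamma_curve_continuous[OF g band_L2(2)[OF hm h2] \<Gamma>])
      ultimately have "cmod (?p t) \<le> sqrt m"
        using t tcl by (intro continuous_on_closure_norm_le[of "range \<tau>" ?p]) auto
      then have "(cmod (?p t))\<^sup>2 \<le> m" using m(2) by (metis power_mono norm_ge_zero real_sqrt_pow2)
      then show ?thesis using m by (simp add: ennreal_leI)
    qed simp
  qed
qed


text \<open>The time-zero values of the bands converge absolutely almost everywhere by the maximal
  bound. Their sum is recognised as \<open>f\<close> by integrating over subintervals of
  \<open>{u..u+1}\<close>: each band is paired with the transform of the indicator, the pairings add
  up to that of \<open>g\<close>, and \<open>fourier_L2_pairing_interval\<close> evaluates the
  latter.\<close>

lemma bands_zero_time_sum:
  assumes gam: "\<gamma> > 0" and fg: "fourier_L2 f g"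
    and C: "0 \<le> C" "0 < \<rho>" "\<rho> < 1"
    and Mx[measurable]: "\<And>k. Mx k \<in> borel_measurable borel"
    and Mi: "\<And>k. (\<integral>\<^sup>+x. indicator {u..u+1} x * Mx k x \<partial>lborel) \<le> ennreal (C * \<rho> ^ k)"
    and Mb: "\<And>k x. ennreal ((cmod (P_gamma \<gamma> (band g k) x 0))\<^sup>2) \<le> Mx k x"
  shows "AE x in lborel. x \<in> {u..u+1} \<longrightarrow> (\<Sum>k. P_gamma \<gamma> (band g k) x 0) = f x"
proof -
  have fm[measurable]: "f \<in> borel_measurable borel" and f2: "integrable lborel (\<lambda>x. (cmod (f x))\<^sup>2)"
    and gm[measurable]: "g \<in> borel_measurable borel" and g2: "integrable lborel (\<lambda>x. (cmod (g x))\<^sup>2)"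
    using fg by (auto simp: fourier_L2_def L2_fun_def)
  let ?I = "{u..u+1}"
  define F where "F k x = indicator ?I x * P_gamma \<gamma> (band g k) x 0" for k x
  have ci: "integrable lborel (\<lambda>\<xi>. cnj (band g k \<xi>))" for k using band_L2(2)[OF gm g2] by simp
  have [measurable]: "F k \<in> borel_measurable borel" for k
  proof -
    have "fourier_int (\<lambda>\<xi>. cnj (band g k \<xi>)) \<in> borel_measurable borel" by measurable
    then show ?thesis unfolding F_def[abs_def] P_gamma_zero_time[OF gam] by measurable
  qed
  have Ie: "integrable lborel (indicator ?I :: real \<Rightarrow> real)"
    by (rule integrable_real_indicator) (auto simp: emeasure_lborel_Icc_eq)
  have F2: "integrable lborel (\<lambda>x. (cmod (F k x))\<^sup>2)" "(LINT x|lborel. (cmod (F k x))\<^sup>2) \<le> C * \<rho> ^ k" for k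
  proof -
    have "(\<integral>\<^sup>+x. ennreal ((cmod (F k x))\<^sup>2) \<partial>lborel) \<le> (\<integral>\<^sup>+x. indicator ?I x * Mx k x \<partial>lborel)"
      using Mb by (intro nn_integral_mono) (auto simp: F_def indicator_def)
    also note Mi
    finally have le: "(\<integral>\<^sup>+x. ennreal ((cmod (F k x))\<^sup>2) \<partial>lborel) \<le> ennreal (C * \<rho> ^ k)" .
    show i: "integrable lborel (\<lambda>x. (cmod (F k x))\<^sup>2)"
      using le by (intro integrableI_nonneg) (auto simp: top_unique less_top[symmetric])
    show "(LINT x|lborel. (cmod (F k x))\<^sup>2) \<le> C * \<rho> ^ k"
      using le C by (simp add: nn_integral_eq_integral[OF i])
  qed
  \<comment> \<open>Since \<open>\<theta> ^ 2 = \<rho>\<close>, the split of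
    \<open>norm (F k x)\<close> into \<open>\<theta> ^ k\<close> and
    \<open>(cmod (F k x))\<^sup>2 / \<theta> ^ k\<close> turns the bound
    \<open>C * \<rho> ^ k\<close> on squares into the summable bound
    \<open>(1 + C) * \<theta> ^ k\<close> on integrals.\<close>
  define \<theta> where "\<theta> = sqrt \<rho>"
  have th: "0 < \<theta>" "\<theta> < 1" "\<theta> ^ 2 = \<rho>" using C by (auto simp: \<theta>_def)
  have Fb: "norm (F k x) \<le> \<theta> ^ k * indicator ?I x + (1 / \<theta> ^ k) * (cmod (F k x))\<^sup>2" for k x
  proof (cases "x \<in> ?I")
    case True
    have "2 * (sqrt (\<theta> ^ k)) * (cmod (F k x) / sqrt (\<theta> ^ k)) \<le> (sqrt (\<theta> ^ k))\<^sup>2 + (cmod (F k x) / sqrt (\<theta> ^ k))\<^sup>2"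
      by (rule sum_squares_bound)
    then have "2 * cmod (F k x) \<le> \<theta> ^ k + (cmod (F k x))\<^sup>2 / \<theta> ^ k"
      using th by (simp add: power_divide)
    then have "cmod (F k x) \<le> \<theta> ^ k + (cmod (F k x))\<^sup>2 / \<theta> ^ k"
      using norm_ge_zero[of "F k x"] by linarith
    then show ?thesis using True by simp
  qed (simp add: F_def)
  have bi: "integrable lborel (\<lambda>x. \<theta> ^ k * indicator ?I x + (1 / \<theta> ^ k) * (cmod (F k x))\<^sup>2)" for k
    using Ie F2 by (intro Bochner_Integration.integrable_add integrable_mult_right)
  have Fi: "integrable lborel (F k)" for k
    using order_trans[OF Fb abs_ge_self] by (intro Bochner_Integration.integrable_bound[OF bi[of k]] AE_I2) auto
  have Fn: "(LINT x|lborel. norm (F k x)) \<le> (1 + C) * \<theta> ^ k" for k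
  proof -
    have "(LINT x|lborel. norm (F k x)) \<le> (LINT x|lborel. \<theta> ^ k * indicator ?I x + (1 / \<theta> ^ k) * (cmod (F k x))\<^sup>2)"
      by (rule integral_mono[OF integrable_norm[OF Fi] bi Fb])
    also have "\<dots> = \<theta> ^ k * (LINT x|lborel. indicator ?I x) + (1 / \<theta> ^ k) * (LINT x|lborel. (cmod (F k x))\<^sup>2)"
      using Ie F2 by simp
    also have "(LINT x|lborel. indicator ?I x) = (1::real)" by simp
    also have "(1 / \<theta> ^ k) * (LINT x|lborel. (cmod (F k x))\<^sup>2) \<le> (1 / \<theta> ^ k) * (C * \<rho> ^ k)"
      using F2 th by (intro mult_left_mono) auto
    also have "(1 / \<theta> ^ k) * (C * \<rho> ^ k) = C * \<theta> ^ k"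
      using th(1) unfolding th(3)[symmetric] by (simp add: power2_eq_square power_mult_distrib)
    finally show ?thesis by (simp add: algebra_simps)
  qed
  have sumth: "summable (\<lambda>k. (1 + C) * \<theta> ^ k)" using th by (intro summable_mult summable_geometric) auto
  have sumF: "summable (\<lambda>k. LINT x|lborel. norm (F k x))"
    by (rule summable_comparison_test_ev[OF _ sumth]) (use Fn in \<open>auto intro!: always_eventually\<close>)
  have aesum: "AE x in lborel. summable (\<lambda>k. norm (F k x))"
    by (rule AE_summable_norm[OF Fi sumF])
  define \<Phi> where "\<Phi> x = (\<Sum>k. F k x)" for x
  have Phi_i: "integrable lborel \<Phi>"
    unfolding \<Phi>_def[abs_def] by (rule integrable_suminf[OF Fi aesum sumF])
  have fI: "integrable lborel (\<lambda>x. indicator ?I x * f x)"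
  proof (rule Bochner_Integration.integrable_bound)
    show "integrable lborel (\<lambda>x. indicator ?I x + (cmod (f x))\<^sup>2)" using Ie f2 by auto
    have "cmod z \<le> 1 + (cmod z)\<^sup>2" for z by (rule le_one_plus_square)
    then show "AE x in lborel. norm (indicator ?I x * f x) \<le> norm (indicator ?I x + (cmod (f x))\<^sup>2)"
      by (auto simp: indicator_def)
  qed measurable
  have pair: "(LINT x|lborel. indicator {a..b} x *\<^sub>R \<Phi> x) = (LINT x|lborel. indicator {a..b} x *\<^sub>R f x)"
    if ab: "{a..b} \<subseteq> ?I" for a b
  proof -
    define c where "c = fourier_int (indicator {a..b} :: real \<Rightarrow> complex)"
    have iF: "integrable lborel (\<lambda>x. indicator {a..b} x *\<^sub>R F k x)" for k
      by (rule integrable_mult_indicator[OF _ Fi]) simp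
    have FkI: "(LINT x|lborel. indicator {a..b} x *\<^sub>R F k x) = complex_of_real (1 / (2 * pi)) * (LINT \<xi>|lborel. band g k \<xi> * cnj (c \<xi>))" for k
    proof -
      have "(LINT x|lborel. indicator {a..b} x *\<^sub>R F k x)
         = (LINT x|lborel. complex_of_real (1 / (2 * pi)) * cnj (indicator {a..b} x * fourier_int (\<lambda>\<xi>. cnj (band g k \<xi>)) x))"
        using ab by (intro Bochner_Integration.integral_cong) (auto simp: F_def P_gamma_zero_time[OF gam] indicator_def)
      also have "\<dots> = complex_of_real (1 / (2 * pi)) * cnj (LINT x|lborel. indicator {a..b} x * fourier_int (\<lambda>\<xi>. cnj (band g k \<xi>)) x)"
        by (subst integral_mult_right_zero, subst Bochner_Integration.integral_cnj) (rule refl)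
      also have "(LINT x|lborel. indicator {a..b} x * fourier_int (\<lambda>\<xi>. cnj (band g k \<xi>)) x) = (LINT \<xi>|lborel. c \<xi> * cnj (band g k \<xi>))"
        unfolding c_def by (rule fourier_multiplication_formula[OF interval_indicator_L1_L2(1) ci, symmetric])
      also have "cnj (LINT \<xi>|lborel. c \<xi> * cnj (band g k \<xi>)) = (LINT \<xi>|lborel. band g k \<xi> * cnj (c \<xi>))"
        by (subst Bochner_Integration.integral_cnj[symmetric]) (simp add: mult.commute del: Bochner_Integration.integral_cnj)
      finally show ?thesis .
    qed
    have gi: "integrable lborel (\<lambda>\<xi>. g \<xi> * cnj (c \<xi>))"
      and gI: "(LINT \<xi>|lborel. g \<xi> * cnj (c \<xi>)) = complex_of_real (2 * pi) * (LINT x|lborel. indicator {a..b} x * f x)"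
      unfolding c_def by (rule fourier_L2_pairing_interval[OF fg])+
    have [measurable]: "c \<in> borel_measurable borel" unfolding c_def by measurable
    have bci: "integrable lborel (\<lambda>\<xi>. band g k \<xi> * cnj (c \<xi>))" for k
      by (rule Bochner_Integration.integrable_bound[OF gi]) (auto simp: band_def norm_mult)
    have "(\<lambda>n. LINT \<xi>|lborel. (\<Sum>k\<le>n. band g k \<xi>) * cnj (c \<xi>)) \<longlonglongrightarrow> (LINT \<xi>|lborel. g \<xi> * cnj (c \<xi>))"
    proof (rule integral_dominated_convergence[OF _ _ integrable_norm[OF gi]])
      show "AE \<xi> in lborel. (\<lambda>n. (\<Sum>k\<le>n. band g k \<xi>) * cnj (c \<xi>)) \<longlonglongrightarrow> g \<xi> * cnj (c \<xi>)"
        by (intro AE_I2 tendsto_mult_right sum_band_tendsto)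
      show "AE \<xi> in lborel. norm ((\<Sum>k\<le>n. band g k \<xi>) * cnj (c \<xi>)) \<le> norm (g \<xi> * cnj (c \<xi>))" for n
        using norm_sum_band_le[of g _ n] by (intro AE_I2) (simp add: norm_mult mult_right_mono)
    qed measurable
    moreover have "(LINT \<xi>|lborel. (\<Sum>k\<le>n. band g k \<xi>) * cnj (c \<xi>)) = (\<Sum>k\<le>n. LINT \<xi>|lborel. band g k \<xi> * cnj (c \<xi>))" for n
      unfolding sum_distrib_right by (rule Bochner_Integration.integral_sum) (rule bci)
    ultimately have "(\<lambda>k. LINT \<xi>|lborel. band g k \<xi> * cnj (c \<xi>)) sums (LINT \<xi>|lborel. g \<xi> * cnj (c \<xi>))"
      unfolding sums_def_le by simp
    then have s1: "(\<lambda>k. LINT x|lborel. indicator {a..b} x *\<^sub>R F k x) sums (complex_of_real (1 / (2 * pi)) * (LINT \<xi>|lborel. g \<xi> * cnj (c \<xi>)))"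
      unfolding FkI by (rule sums_mult)
    have ae2: "AE x in lborel. summable (\<lambda>k. norm (indicator {a..b} x *\<^sub>R F k x))"
      using aesum by eventually_elim (rule summable_comparison_test_ev[rotated], auto simp: indicator_def)
    have sum2: "summable (\<lambda>k. LINT x|lborel. norm (indicator {a..b} x *\<^sub>R F k x))"
    proof (rule summable_comparison_test_ev[OF _ sumF], intro always_eventually allI)
      fix k
      have "(LINT x|lborel. norm (indicator {a..b} x *\<^sub>R F k x)) \<le> (LINT x|lborel. norm (F k x))"
        by (intro integral_mono integrable_norm iF Fi) (auto simp: indicator_def)
      moreover have "0 \<le> (LINT x|lborel. norm (indicator {a..b} x *\<^sub>R F k x))"
        by (intro Bochner_Integration.integral_nonneg) auto
      ultimately show "norm (LINT x|lborel. norm (indicator {a..b} x *\<^sub>R F k x)) \<le> (LINT x|lborel. norm (F k x))"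
        by simp
    qed
    have "(LINT x|lborel. indicator {a..b} x *\<^sub>R \<Phi> x) = (LINT x|lborel. (\<Sum>k. indicator {a..b} x *\<^sub>R F k x))"
      unfolding \<Phi>_def by (intro Bochner_Integration.integral_cong) (auto simp: indicator_def)
    also have "\<dots> = (\<Sum>k. LINT x|lborel. indicator {a..b} x *\<^sub>R F k x)"
      by (rule integral_suminf[OF iF ae2 sum2])
    also have "\<dots> = complex_of_real (1 / (2 * pi)) * (LINT \<xi>|lborel. g \<xi> * cnj (c \<xi>))"
      using s1 by (rule sums_unique[symmetric])
    also have "\<dots> = (LINT x|lborel. indicator {a..b} x * f x)" unfolding gI by simp
    also have "\<dots> = (LINT x|lborel. indicator {a..b} x *\<^sub>R f x)"
      by (intro Bochner_Integration.integral_cong) (auto simp: indicator_def)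
    finally show ?thesis .
  qed
  \<comment> \<open>The difference vanishes outside \<open>{u..u+1}\<close>. Hence any interval may
    be cut down to this one, and the integral over the line is itself an integral over an
    interval.\<close>
  define h where "h x = \<Phi> x - indicator ?I x * f x" for x
  have hi: "integrable lborel h" unfolding h_def[abs_def] using Phi_i fI by (rule Bochner_Integration.integrable_diff)
  have h0: "h x = 0" if "x \<notin> ?I" for x using that by (simp add: h_def \<Phi>_def F_def)
  have hI: "(LINT x|lborel. indicator {a..b} x *\<^sub>R h x) = 0" for a b
  proof -
    let ?a = "max a u" and ?b = "min b (u+1)"
    have i1: "integrable lborel (\<lambda>x. indicator {?a..?b} x *\<^sub>R \<Phi> x)"
      by (rule integrable_mult_indicator[OF _ Phi_i]) simp
    have i2: "integrable lborel (\<lambda>x. indicator {?a..?b} x *\<^sub>R f x)"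
      by (rule Bochner_Integration.integrable_bound[OF fI]) (auto simp: indicator_def)
    have "(LINT x|lborel. indicator {a..b} x *\<^sub>R h x) = (LINT x|lborel. indicator {?a..?b} x *\<^sub>R \<Phi> x - indicator {?a..?b} x *\<^sub>R f x)"
      using h0 by (intro Bochner_Integration.integral_cong) (auto simp: indicator_def h_def)
    also have "\<dots> = 0"
      using i1 i2 pair[of ?a ?b] by simp
    finally show ?thesis .
  qed
  have "(LINT x|lborel. h x) = (LINT x|lborel. indicator ?I x *\<^sub>R h x)"
    using h0 by (intro Bochner_Integration.integral_cong) (auto simp: indicator_def)
  then have "(LINT x|lborel. h x) = 0" using hI by simp
  then have "AE x in lborel. h x = 0" by (rule AE_zero_of_interval_integrals[OF hi hI])
  then show ?thesis
    by eventually_elim (auto simp: h_def \<Phi>_def F_def)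
qed


lemma convergence_above_critical:
  assumes g: "\<gamma> > 0" and a: "1/4 < \<alpha>" "\<alpha> < 1/2" and s: "s_crit \<alpha> \<gamma> < s"
    and \<Gamma>: "admissible_curve \<alpha> \<Gamma>" and fg: "sobolev_with_fourier s f h"
  shows "conv_ae \<gamma> \<Gamma> f h"
proof -
  have f4: "fourier_L2 f h" and hs: "integrable lborel (\<lambda>\<xi>. (1 + \<xi>\<^sup>2) powr s * (cmod (h \<xi>))\<^sup>2)"
    using fg by (auto simp: sobolev_with_fourier_def)
  have hm[measurable]: "h \<in> borel_measurable borel" and h2: "integrable lborel (\<lambda>x. (cmod (h x))\<^sup>2)"
    using f4 by (auto simp: fourier_L2_def L2_fun_def)
  have G0: "\<Gamma> x 0 = x" for x using \<Gamma> by (simp add: admissible_curve_def)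
  obtain C \<rho> Mx where C: "0 \<le> C" "0 < \<rho>" "\<rho> < 1"
    and Mx[measurable]: "\<And>k. Mx k \<in> borel_measurable borel"
    and Mi: "\<And>k u. (\<integral>\<^sup>+x. indicator {u..u+1} x * Mx k x \<partial>lborel) \<le> ennreal (C * \<rho> ^ k)"
    and Mb: "\<And>k x t. t \<in> {0..1} \<Longrightarrow> ennreal ((cmod (P_gamma \<gamma> (band h k) (\<Gamma> x t) t))\<^sup>2) \<le> Mx k x"
    using band_maximal_decay[OF g a s \<Gamma> hm h2 hs] by blast
  \<comment> \<open>\<open>Mx\<close> bounds squares, so its summability alone would not sum the
    bands. Weighting with \<open>1 / \<theta> ^ k\<close> still leaves a convergent series and
    forces \<open>Mx k x \<le> B * \<theta> ^ k\<close> at almost every point, hence geometric decay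
    of the bands, uniformly in time.\<close>
  define \<theta> where "\<theta> = sqrt \<rho>"
  have th: "0 < \<theta>" "\<theta> < 1" "\<theta> ^ 2 = \<rho>" using C by (auto simp: \<theta>_def)
  have loc: "AE x in lborel. x \<in> {u..u+1} \<longrightarrow> ((\<lambda>t. P_gamma \<gamma> h (\<Gamma> x t) t) \<longlongrightarrow> f x) (at_right 0)" for u
  proof -
    have sum0: "AE x in lborel. x \<in> {u..u+1} \<longrightarrow> (\<Sum>k. P_gamma \<gamma> (band h k) x 0) = f x"
      by (rule bands_zero_time_sum[OF g f4 C Mx Mi]) (use Mb[of 0] G0 in simp)
    have "(\<integral>\<^sup>+x. (\<Sum>k. ennreal (1 / \<theta> ^ k) * (indicator {u..u+1} x * Mx k x)) \<partial>lborel)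
       = (\<Sum>k. \<integral>\<^sup>+x. ennreal (1 / \<theta> ^ k) * (indicator {u..u+1} x * Mx k x) \<partial>lborel)"
      by (rule nn_integral_suminf) measurable
    also have "\<dots> = (\<Sum>k. ennreal (1 / \<theta> ^ k) * (\<integral>\<^sup>+x. indicator {u..u+1} x * Mx k x \<partial>lborel))"
      by (intro suminf_cong nn_integral_cmult) measurable
    also have "\<dots> \<le> (\<Sum>k. ennreal (C * \<theta> ^ k))"
    proof (intro suminf_le allI summableI)
      fix k
      have "ennreal (1 / \<theta> ^ k) * (\<integral>\<^sup>+x. indicator {u..u+1} x * Mx k x \<partial>lborel) \<le> ennreal (1 / \<theta> ^ k) * ennreal (C * \<rho> ^ k)"
        by (intro mult_left_mono Mi) auto
      also have "\<dots> = ennreal (1 / \<theta> ^ k * (C * \<rho> ^ k))" using th C by (intro ennreal_mult[symmetric]) auto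
      also have "1 / \<theta> ^ k * (C * \<rho> ^ k) = C * \<theta> ^ k"
        using th(1) unfolding th(3)[symmetric] by (simp add: power2_eq_square power_mult_distrib)
      finally show "ennreal (1 / \<theta> ^ k) * (\<integral>\<^sup>+x. indicator {u..u+1} x * Mx k x \<partial>lborel) \<le> ennreal (C * \<theta> ^ k)" .
    qed
    also have "\<dots> = ennreal (\<Sum>k. C * \<theta> ^ k)"
      using th C by (intro suminf_ennreal2 summable_mult summable_geometric) auto
    also have "\<dots> < \<infinity>" by simp
    finally have "AE x in lborel. (\<Sum>k. ennreal (1 / \<theta> ^ k) * (indicator {u..u+1} x * Mx k x)) \<noteq> \<infinity>"
      by (intro nn_integral_PInf_AE) auto
    with sum0 show ?thesis
    proof eventually_elim
      case (elim x)
      show ?case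
      proof
        assume x: "x \<in> {u..u+1}"
        let ?S = "\<Sum>k. ennreal (1 / \<theta> ^ k) * (indicator {u..u+1} x * Mx k x)"
        from elim(2) obtain B where B: "?S = ennreal B" "B \<ge> 0" by (cases ?S) auto
        have Mk: "Mx k x \<le> ennreal (B * \<theta> ^ k)" for k
        proof -
          have "ennreal (1 / \<theta> ^ k) * (indicator {u..u+1} x * Mx k x) \<le> ?S"
            using sum_le_suminf[of "\<lambda>k. ennreal (1 / \<theta> ^ k) * (indicator {u..u+1} x * Mx k x)" "{k}"] by (simp add: summableI)
          then have "ennreal (1 / \<theta> ^ k) * Mx k x \<le> ennreal B" using x B by simp
          then have "ennreal (\<theta> ^ k) * (ennreal (1 / \<theta> ^ k) * Mx k x) \<le> ennreal (\<theta> ^ k) * ennreal B"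
            by (intro mult_left_mono) auto
          moreover have "ennreal (\<theta> ^ k) * ennreal (1 / \<theta> ^ k) = 1"
            using th by (simp flip: ennreal_mult)
          ultimately have "Mx k x \<le> ennreal (\<theta> ^ k) * ennreal B"
            by (simp flip: mult.assoc)
          then show ?thesis using th B by (simp add: ennreal_mult mult.commute)
        qed
        have pb: "norm (P_gamma \<gamma> (band h k) (\<Gamma> x t) t) \<le> sqrt B * sqrt \<theta> ^ k" if "t \<in> {0..1}" for k t
        proof -
          have "ennreal ((cmod (P_gamma \<gamma> (band h k) (\<Gamma> x t) t))\<^sup>2) \<le> ennreal (B * \<theta> ^ k)"
            by (rule order_trans[OF Mb[OF that] Mk])
          then have "(cmod (P_gamma \<gamma> (band h k) (\<Gamma> x t) t))\<^sup>2 \<le> B * \<theta> ^ k"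
            using B th by simp
          then have "cmod (P_gamma \<gamma> (band h k) (\<Gamma> x t) t) \<le> sqrt (B * \<theta> ^ k)" by (rule real_le_rsqrt)
          then show ?thesis by (simp add: real_sqrt_mult real_sqrt_power)
        qed
        have T: "((\<lambda>t. \<Sum>k. P_gamma \<gamma> (band h k) (\<Gamma> x t) t) \<longlongrightarrow> (\<Sum>k. P_gamma \<gamma> (band h k) x 0)) (at_right 0)"
        proof (rule tannerys_theorem[THEN conjunct2, THEN conjunct2])
          show "((\<lambda>t. P_gamma \<gamma> (band h k) (\<Gamma> x t) t) \<longlongrightarrow> P_gamma \<gamma> (band h k) x 0) (at_right 0)" for k
            using continuous_on_Icc_at_rightD[OF P_gamma_curve_continuous[OF g band_L2(2)[OF hm h2, of k] \<Gamma>, of x]] by (simp add: G0)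
          have "\<forall>\<^sub>F t in at_right (0::real). t \<in> {0..1}"
            unfolding eventually_at_right_field by (intro exI[of _ 1]) auto
          then have "\<forall>\<^sub>F p in sequentially \<times>\<^sub>F at_right (0::real). True \<and> snd p \<in> {0..1}"
            by (intro eventually_prodI) auto
          then show "\<forall>\<^sub>F (k, t) in sequentially \<times>\<^sub>F at_right 0. norm (P_gamma \<gamma> (band h k) (\<Gamma> x t) t) \<le> sqrt B * sqrt \<theta> ^ k"
            by eventually_elim (use pb in auto)
          show "summable (\<lambda>k. sqrt B * sqrt \<theta> ^ k)"
            using th by (intro summable_mult summable_geometric) auto
        qed simp
        have "\<forall>\<^sub>F t in at_right (0::real). (\<Sum>k. P_gamma \<gamma> (band h k) (\<Gamma> x t) t) = P_gamma \<gamma> h (\<Gamma> x t) t"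
          using eventually_at_right_less[of "0::real"]
          by eventually_elim (rule sums_unique[symmetric, OF P_gamma_sum_bands[OF hm h2]])
        from Lim_transform_eventually[OF T this]
        show "((\<lambda>t. P_gamma \<gamma> h (\<Gamma> x t) t) \<longlongrightarrow> f x) (at_right 0)"
          using elim(1) x by simp
      qed
    qed
  qed
  have "AE x in lborel. \<forall>n::int. x \<in> {real_of_int n..real_of_int n+1} \<longrightarrow> ((\<lambda>t. P_gamma \<gamma> h (\<Gamma> x t) t) \<longlongrightarrow> f x) (at_right 0)"
    unfolding AE_all_countable by (intro allI loc)
  then show ?thesis unfolding conv_ae_def
  proof eventually_elim
    case (elim x)
    have "x \<in> {real_of_int \<lfloor>x\<rfloor>..real_of_int \<lfloor>x\<rfloor>+1}"
      using of_int_floor_le[of x] real_of_int_floor_add_one_ge[of x] by simp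
    then show ?case using elim by blast
  qed
qed

section \<open>Packets of separated frequencies\<close>

text \<open>A frequency profile: the average of \<open>M\<close> unit Gaussian bumps centred at
  \<open>X m\<close>. Its mass is \<open>sqrt (2 * pi)\<close> for every positive \<open>M\<close>,
  so the evolution can reach size one where the bumps agree in phase.\<close>

definition packet :: "(nat \<Rightarrow> real) \<Rightarrow> nat \<Rightarrow> real \<Rightarrow> real" where
  "packet X M \<xi> = (\<Sum>m<M. exp (- (1/2 * (\<xi> - X m)\<^sup>2))) / real M"

text \<open>The inverse Fourier transform of \<open>packet X M\<close>: one Gaussian envelope times
  an average of exponentials.\<close>

definition packet_fun :: "(nat \<Rightarrow> real) \<Rightarrow> nat \<Rightarrow> real \<Rightarrow> complex" where
  "packet_fun X M x = complex_of_real (exp (- (1/2 * x\<^sup>2)) / (sqrt (2 * pi) * real M)) * (\<Sum>m<M. exp (\<i> * complex_of_real (X m * x)))"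

text \<open>The squared L2 norm of \<open>packet X M\<close> divided by \<open>sqrt pi\<close>: two
  bumps at distance \<open>D\<close> have the inner product
  \<open>sqrt pi * exp (- D\<^sup>2 / 4)\<close>.\<close>

definition energy :: "(nat \<Rightarrow> real) \<Rightarrow> nat \<Rightarrow> real" where
  "energy X M = (\<Sum>m<M. \<Sum>n<M. exp (- (1/4 * (X m - X n)\<^sup>2))) / (real M)\<^sup>2"

lemma packet_nonneg: "packet X M \<xi> \<ge> 0"
  by (simp add: packet_def sum_nonneg)

lemma packet_measurable [measurable]: "packet X M \<in> borel_measurable borel"
  unfolding packet_def[abs_def] by measurable

lemma packet_fun_measurable [measurable]: "packet_fun X M \<in> borel_measurable borel"
  unfolding packet_fun_def[abs_def] by measurable

lemma has_bochner_integral_iexp_gaussian: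
  "has_bochner_integral lborel (\<lambda>x. exp (\<i> * complex_of_real (a * x)) * complex_of_real (exp (- (1/2 * x\<^sup>2))))
     (complex_of_real (sqrt (2 * pi) * exp (- (1/2 * a\<^sup>2))))"
  using gaussian_fourier[of "1/2" a] by (simp add: mult.commute)

lemma packet_fun_fourier:
  shows "integrable lborel (packet_fun X M)" and "fourier_int (packet_fun X M) \<xi> = complex_of_real (packet X M \<xi>)"
proof -
  have "has_bochner_integral lborel (\<lambda>x. complex_of_real (1 / (sqrt (2 * pi) * real M)) *
      (\<Sum>m<M. exp (\<i> * complex_of_real ((X m - \<xi>) * x)) * complex_of_real (exp (- (1/2 * x\<^sup>2)))))
     (complex_of_real (1 / (sqrt (2 * pi) * real M)) * (\<Sum>m<M. complex_of_real (sqrt (2 * pi) * exp (- (1/2 * (X m - \<xi>)\<^sup>2)))))" for \<xi>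
    by (intro has_bochner_integral_mult_right has_bochner_integral_sum has_bochner_integral_iexp_gaussian)
  moreover have "complex_of_real (1 / (sqrt (2 * pi) * real M)) *
      (\<Sum>m<M. exp (\<i> * complex_of_real ((X m - \<xi>) * x)) * complex_of_real (exp (- (1/2 * x\<^sup>2))))
      = exp (- (\<i> * complex_of_real (x * \<xi>))) * packet_fun X M x" for \<xi> x
  proof -
    have "exp (\<i> * complex_of_real ((X m - \<xi>) * x)) = exp (\<i> * complex_of_real (X m * x)) * exp (- (\<i> * complex_of_real (x * \<xi>)))" for m
      unfolding iexp_diff by (simp add: algebra_simps)
    then show ?thesis by (simp add: packet_fun_def sum_distrib_left sum_distrib_right sum_divide_distrib mult_ac)
  qed
  moreover have "complex_of_real (1 / (sqrt (2 * pi) * real M)) * (\<Sum>m<M. complex_of_real (sqrt (2 * pi) * exp (- (1/2 * (X m - \<xi>)\<^sup>2))))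
     = complex_of_real (packet X M \<xi>)" for \<xi>
    by (simp add: packet_def sum_distrib_left[symmetric] power2_commute[of "X _" \<xi>])
  ultimately have H: "has_bochner_integral lborel (\<lambda>x. exp (- (\<i> * complex_of_real (x * \<xi>))) * packet_fun X M x) (complex_of_real (packet X M \<xi>))" for \<xi>
    by simp
  show "fourier_int (packet_fun X M) \<xi> = complex_of_real (packet X M \<xi>)"
    unfolding fourier_int_def by (rule has_bochner_integral_integral_eq[OF H])
  show "integrable lborel (packet_fun X M)" using H[of 0] by (simp add: has_bochner_integral_iff)
qed

text \<open>On the space side the inner products are
  \<open>exp (- (1/2 * (X m - X n)\<^sup>2))\<close>, below those in \<open>energy\<close>. The L1
  bound is Cauchy-Schwarz against the Gaussian envelope, in the form
  \<open>z \<le> (l + z\<^sup>2 / l) / 2\<close>; it will allow the series of packets to be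
  transformed term by term.\<close>

lemma packet_fun_norms:
  assumes M: "M > 0" and l: "l > 0" and E: "energy X M \<le> l\<^sup>2"
  shows "integrable lborel (\<lambda>x. (cmod (packet_fun X M x))\<^sup>2)" "(LINT x|lborel. (cmod (packet_fun X M x))\<^sup>2) \<le> l\<^sup>2"
    and "(LINT x|lborel. cmod (packet_fun X M x)) \<le> l"
proof -
  define S where "S x = (\<Sum>m<M. exp (\<i> * complex_of_real (X m * x)))" for x
  define Q where "Q x = exp (- (1/2 * x\<^sup>2)) * (cmod (S x))\<^sup>2" for x
  define r where "r = sqrt (2 * pi)"
  have r: "r > 0" "r \<ge> 1" "r\<^sup>2 = 2 * pi" using pi_ge_two by (auto simp: r_def)
  have SS: "complex_of_real (Q x) = (\<Sum>m<M. \<Sum>n<M. exp (\<i> * complex_of_real ((X m - X n) * x)) * complex_of_real (exp (- (1/2 * x\<^sup>2))))" for x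
  proof -
    have "complex_of_real ((cmod (S x))\<^sup>2) = S x * cnj (S x)" by (simp add: complex_mult_cnj cmod_power2)
    also have "\<dots> = (\<Sum>m<M. \<Sum>n<M. exp (\<i> * complex_of_real (X m * x)) * exp (- (\<i> * complex_of_real (X n * x))))"
      unfolding S_def by (simp add: sum_product exp_cnj)
    also have "\<dots> = (\<Sum>m<M. \<Sum>n<M. exp (\<i> * complex_of_real ((X m - X n) * x)))"
      unfolding iexp_diff by (simp add: left_diff_distrib)
    finally show ?thesis by (simp add: Q_def sum_distrib_left mult.commute)
  qed
  have "has_bochner_integral lborel (\<lambda>x. complex_of_real (Q x)) (\<Sum>m<M. \<Sum>n<M. complex_of_real (sqrt (2 * pi) * exp (- (1/2 * (X m - X n)\<^sup>2))))"
    unfolding SS by (intro has_bochner_integral_sum has_bochner_integral_iexp_gaussian)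
  then have "has_bochner_integral lborel (\<lambda>x. Re (complex_of_real (Q x))) (Re (\<Sum>m<M. \<Sum>n<M. complex_of_real (sqrt (2 * pi) * exp (- (1/2 * (X m - X n)\<^sup>2)))))"
    by (rule has_bochner_integral_bounded_linear[OF bounded_linear_Re])
  then have Qh: "has_bochner_integral lborel Q (r * (\<Sum>m<M. \<Sum>n<M. exp (- (1/2 * (X m - X n)\<^sup>2))))"
    by (simp add: r_def sum_distrib_left)
  then have Qi: "integrable lborel Q" by (simp add: has_bochner_integral_iff)
  have QI: "(LINT x|lborel. Q x) \<le> r * ((real M)\<^sup>2 * l\<^sup>2)"
  proof -
    have "(\<Sum>m<M. \<Sum>n<M. exp (- (1/2 * (X m - X n)\<^sup>2))) \<le> (\<Sum>m<M. \<Sum>n<M. exp (- (1/4 * (X m - X n)\<^sup>2)))"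
      by (intro sum_mono) simp
    also have "\<dots> = (real M)\<^sup>2 * energy X M" using M by (simp add: energy_def)
    also have "\<dots> \<le> (real M)\<^sup>2 * l\<^sup>2" using E by (intro mult_left_mono) auto
    finally show ?thesis using Qh r by (simp add: has_bochner_integral_iff)
  qed
  have pf: "cmod (packet_fun X M x) = exp (- (1/2 * x\<^sup>2)) * cmod (S x) / (r * real M)" for x
    by (simp add: packet_fun_def S_def r_def norm_mult norm_divide)
  have b2: "(cmod (packet_fun X M x))\<^sup>2 \<le> (1 / (r * (real M)\<^sup>2)) * Q x" for x
  proof -
    have "(exp (- (1/2 * x\<^sup>2)) * cmod (S x))\<^sup>2 = exp (- (1/2 * x\<^sup>2)) * Q x"
      by (simp add: Q_def power2_eq_square)
    also have "\<dots> \<le> 1 * Q x" by (intro mult_right_mono) (auto simp: Q_def)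
    finally have "(cmod (packet_fun X M x))\<^sup>2 \<le> Q x / (r * real M)\<^sup>2"
      unfolding pf power_divide by (intro divide_right_mono) auto
    also have "\<dots> \<le> Q x / (r * (real M)\<^sup>2)"
    proof (intro divide_left_mono)
      have "r * (real M)\<^sup>2 \<le> (r * r) * (real M)\<^sup>2" using r by (intro mult_right_mono) auto
      then show "r * (real M)\<^sup>2 \<le> (r * real M)\<^sup>2" by (simp add: power2_eq_square mult_ac)
    qed (use r M in \<open>auto simp: Q_def\<close>)
    finally show ?thesis by simp
  qed
  show i2: "integrable lborel (\<lambda>x. (cmod (packet_fun X M x))\<^sup>2)"
    using order_trans[OF b2 abs_ge_self] by (intro Bochner_Integration.integrable_bound[OF integrable_mult_right[OF Qi, of "1 / (r * (real M)\<^sup>2)"]] AE_I2) auto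
  have "(LINT x|lborel. (cmod (packet_fun X M x))\<^sup>2) \<le> (LINT x|lborel. (1 / (r * (real M)\<^sup>2)) * Q x)"
    by (intro integral_mono i2 integrable_mult_right Qi b2)
  also have "\<dots> = (1 / (r * (real M)\<^sup>2)) * (LINT x|lborel. Q x)" by simp
  also have "\<dots> \<le> (1 / (r * (real M)\<^sup>2)) * (r * ((real M)\<^sup>2 * l\<^sup>2))" using QI r by (intro mult_left_mono) auto
  also have "\<dots> = l\<^sup>2" using r M by simp
  finally show "(LINT x|lborel. (cmod (packet_fun X M x))\<^sup>2) \<le> l\<^sup>2" .
  have gb: "has_bochner_integral lborel (\<lambda>x. exp (- (1/2 * x\<^sup>2))) r"
    using gaussian_has_integral[of "1/2" 0] by (simp add: r_def mult.commute)
  then have gi: "integrable lborel (\<lambda>x::real. exp (- (1/2 * x\<^sup>2)))" "(LINT x::real|lborel. exp (- (1/2 * x\<^sup>2))) = r"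
    by (simp_all only: has_bochner_integral_iff)
  have b1: "cmod (packet_fun X M x) \<le> (l / (2 * r)) * exp (- (1/2 * x\<^sup>2)) + (1 / (2 * r * l * (real M)\<^sup>2)) * Q x" for x
  proof -
    let ?z = "cmod (S x) / real M"
    have "z \<le> (l + z\<^sup>2 / l) / 2" for z
    proof -
      have "2 * (sqrt l) * (z / sqrt l) \<le> (sqrt l)\<^sup>2 + (z / sqrt l)\<^sup>2" by (rule sum_squares_bound)
      then show ?thesis using l by (simp add: power_divide)
    qed
    then have "?z \<le> (l + ?z\<^sup>2 / l) / 2" .
    then have "exp (- (1/2 * x\<^sup>2)) / r * ?z \<le> exp (- (1/2 * x\<^sup>2)) / r * ((l + ?z\<^sup>2 / l) / 2)"
      using r by (intro mult_left_mono) auto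
    also have "\<dots> = (l / (2 * r)) * exp (- (1/2 * x\<^sup>2)) + (1 / (2 * r * l * (real M)\<^sup>2)) * Q x"
      using r l M by (simp add: Q_def power_divide field_simps)
    finally show ?thesis by (simp add: pf)
  qed
  have "(LINT x|lborel. cmod (packet_fun X M x)) \<le> (LINT x|lborel. (l / (2 * r)) * exp (- (1/2 * x\<^sup>2)) + (1 / (2 * r * l * (real M)\<^sup>2)) * Q x)"
    by (intro integral_mono integrable_norm packet_fun_fourier(1) Bochner_Integration.integrable_add integrable_mult_right gi Qi b1)
  also have "\<dots> = (l / (2 * r)) * r + (1 / (2 * r * l * (real M)\<^sup>2)) * (LINT x|lborel. Q x)"
    using gi Qi by simp
  also have "\<dots> \<le> (l / (2 * r)) * r + (1 / (2 * r * l * (real M)\<^sup>2)) * (r * ((real M)\<^sup>2 * l\<^sup>2))"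
    using QI r l by (intro add_left_mono mult_left_mono) auto
  also have "\<dots> = l" using r l M by (simp add: power2_eq_square)
  finally show "(LINT x|lborel. cmod (packet_fun X M x)) \<le> l" .
qed

text \<open>The product of two bumps is their energy term times a Gaussian centred at the midpoint
  \<open>c m n\<close>, whose modulus is at most \<open>N\<close>. There
  \<open>1 + \<xi>\<^sup>2\<close> is at most \<open>3 * N\<^sup>2\<close> times a quadratic in the
  distance to the centre; half of the Gaussian absorbs the quadratic at the cost of a factor 2,
  whence the constant 6.\<close>

lemma packet_sobolev:
  assumes s: "0 \<le> s" "s \<le> 1" and N: "N \<ge> 1" and X: "\<And>m. m < M \<Longrightarrow> \<bar>X m\<bar> \<le> N"
  shows "integrable lborel (\<lambda>\<xi>. (1 + \<xi>\<^sup>2) powr s * (packet X M \<xi>)\<^sup>2)"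
    and "(LINT \<xi>|lborel. (1 + \<xi>\<^sup>2) powr s * (packet X M \<xi>)\<^sup>2) \<le> 6 * sqrt (2 * pi) * (N powr (2 * s) * energy X M)"
proof -
  define c where "c m n = (X m + X n) / 2" for m n
  define B where "B \<xi> = (\<Sum>m<M. \<Sum>n<M. (6 * N powr (2 * s) * exp (- (1/4 * (X m - X n)\<^sup>2)) / (real M)\<^sup>2) * exp (- (1/2 * (\<xi> - c m n)\<^sup>2)))" for \<xi>
  have g: "has_bochner_integral lborel (\<lambda>x. exp (- (1/2 * (x - a)\<^sup>2))) (sqrt (2 * pi))" for a
    using gaussian_has_integral[of "1/2" a] by (simp add: mult.commute)
  have "has_bochner_integral lborel B (\<Sum>m<M. \<Sum>n<M. (6 * N powr (2 * s) * exp (- (1/4 * (X m - X n)\<^sup>2)) / (real M)\<^sup>2) * sqrt (2 * pi))"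
    unfolding B_def by (intro has_bochner_integral_sum has_bochner_integral_mult_right g)
  also have "(\<Sum>m<M. \<Sum>n<M. (6 * N powr (2 * s) * exp (- (1/4 * (X m - X n)\<^sup>2)) / (real M)\<^sup>2) * sqrt (2 * pi)) = 6 * sqrt (2 * pi) * (N powr (2 * s) * energy X M)"
    by (simp add: energy_def sum_distrib_left sum_divide_distrib sum_distrib_right mult_ac)
  finally have Bi: "integrable lborel B" and BI: "(LINT \<xi>|lborel. B \<xi>) = 6 * sqrt (2 * pi) * (N powr (2 * s) * energy X M)"
    by (auto simp: has_bochner_integral_iff)
  have w: "(1 + \<xi>\<^sup>2) powr s * exp (- (\<xi> - a)\<^sup>2) \<le> 6 * N powr (2 * s) * exp (- (1/2 * (\<xi> - a)\<^sup>2))" if a: "\<bar>a\<bar> \<le> N" for \<xi> a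
  proof -
    have "\<xi>\<^sup>2 \<le> 2 * a\<^sup>2 + 2 * (\<xi> - a)\<^sup>2"
    proof -
      have "0 \<le> (2 * a - \<xi>)\<^sup>2" by simp
      then show ?thesis by (simp add: power2_eq_square algebra_simps)
    qed
    moreover have a2: "a\<^sup>2 \<le> N\<^sup>2" using a N by (simp add: abs_le_square_iff[symmetric])
    moreover have N2: "1 \<le> N\<^sup>2" using N by (rule one_le_power)
    moreover have "1 * (\<xi> - a)\<^sup>2 \<le> N\<^sup>2 * (\<xi> - a)\<^sup>2" using N2 by (intro mult_right_mono) auto
    moreover have "3 * N\<^sup>2 * (1 + (\<xi> - a)\<^sup>2) = 3 * N\<^sup>2 + 3 * (N\<^sup>2 * (\<xi> - a)\<^sup>2)" by (simp add: algebra_simps)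
    moreover have "0 \<le> (\<xi> - a)\<^sup>2" by simp
    ultimately have "1 + \<xi>\<^sup>2 \<le> 3 * N\<^sup>2 * (1 + (\<xi> - a)\<^sup>2)" by linarith
    then have "(1 + \<xi>\<^sup>2) powr s \<le> (3 * N\<^sup>2 * (1 + (\<xi> - a)\<^sup>2)) powr s"
      using s by (intro powr_mono2) auto
    also have "\<dots> = 3 powr s * (N\<^sup>2) powr s * (1 + (\<xi> - a)\<^sup>2) powr s" by (simp add: powr_mult)
    also have "\<dots> \<le> 3 powr 1 * (N\<^sup>2) powr s * (1 + (\<xi> - a)\<^sup>2) powr 1"
      using s N2 by (intro mult_mono powr_mono) auto
    also have "(N\<^sup>2) powr s = N powr (2 * s)" using powr_powr[of N 2 s] N by (simp add: powr_numeral)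
    also have "(1 + (\<xi> - a)\<^sup>2) powr 1 \<le> 2 * exp (1/2 * (\<xi> - a)\<^sup>2)"
    proof -
      have "1 + 1/2 * (\<xi> - a)\<^sup>2 \<le> exp (1/2 * (\<xi> - a)\<^sup>2)" by (rule exp_ge_add_one_self)
      moreover have "(1 + (\<xi> - a)\<^sup>2) powr 1 = 1 + (\<xi> - a)\<^sup>2" by (simp add: add_nonneg_nonneg)
      moreover have "0 \<le> (\<xi> - a)\<^sup>2" by simp
      ultimately show ?thesis by linarith
    qed
    finally have "(1 + \<xi>\<^sup>2) powr s \<le> 6 * N powr (2 * s) * exp (1/2 * (\<xi> - a)\<^sup>2)"
      by (simp add: mult_left_mono)
    then have "(1 + \<xi>\<^sup>2) powr s * exp (- (\<xi> - a)\<^sup>2) \<le> 6 * N powr (2 * s) * exp (1/2 * (\<xi> - a)\<^sup>2) * exp (- (\<xi> - a)\<^sup>2)"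
      by (intro mult_right_mono) auto
    also have "6 * N powr (2 * s) * exp (1/2 * (\<xi> - a)\<^sup>2) * exp (- (\<xi> - a)\<^sup>2) = 6 * N powr (2 * s) * exp (- (1/2 * (\<xi> - a)\<^sup>2))"
      by (simp only: mult.assoc exp_add[symmetric]) simp
    finally show ?thesis .
  qed
  have pt: "(1 + \<xi>\<^sup>2) powr s * (packet X M \<xi>)\<^sup>2 \<le> B \<xi>" for \<xi>
  proof -
    have "(\<Sum>m<M. exp (- (1/2 * (\<xi> - X m)\<^sup>2)))\<^sup>2 = (\<Sum>m<M. \<Sum>n<M. exp (- (1/4 * (X m - X n)\<^sup>2)) * exp (- (\<xi> - c m n)\<^sup>2))"
    proof -
      have "exp (- (1/2 * (\<xi> - X m)\<^sup>2)) * exp (- (1/2 * (\<xi> - X n)\<^sup>2)) = exp (- (1/4 * (X m - X n)\<^sup>2)) * exp (- (\<xi> - c m n)\<^sup>2)" for m n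
      proof -
        have "- (1/2 * (\<xi> - X m)\<^sup>2) + - (1/2 * (\<xi> - X n)\<^sup>2) = - (1/4 * (X m - X n)\<^sup>2) + - (\<xi> - c m n)\<^sup>2"
          by (simp add: c_def power2_eq_square field_simps)
        then show ?thesis by (metis exp_add)
      qed
      then show ?thesis by (simp only: power2_eq_square sum_product)
    qed
    moreover have "(packet X M \<xi>)\<^sup>2 = (\<Sum>m<M. exp (- (1/2 * (\<xi> - X m)\<^sup>2)))\<^sup>2 / (real M)\<^sup>2"
      by (simp only: packet_def power_divide)
    ultimately have "(1 + \<xi>\<^sup>2) powr s * (packet X M \<xi>)\<^sup>2 = (\<Sum>m<M. \<Sum>n<M. (exp (- (1/4 * (X m - X n)\<^sup>2)) / (real M)\<^sup>2) * ((1 + \<xi>\<^sup>2) powr s * exp (- (\<xi> - c m n)\<^sup>2)))"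
      by (simp only:) (simp add: sum_distrib_left sum_divide_distrib mult_ac)
    also have "\<dots> \<le> (\<Sum>m<M. \<Sum>n<M. (exp (- (1/4 * (X m - X n)\<^sup>2)) / (real M)\<^sup>2) * (6 * N powr (2 * s) * exp (- (1/2 * (\<xi> - c m n)\<^sup>2))))"
    proof (intro sum_mono mult_left_mono w)
      fix m n assume "m \<in> {..<M}" "n \<in> {..<M}"
      then show "\<bar>c m n\<bar> \<le> N" using X[of m] X[of n] by (auto simp: c_def)
    qed auto
    also have "\<dots> = B \<xi>" unfolding B_def by (simp add: mult_ac)
    finally show ?thesis .
  qed
  show i: "integrable lborel (\<lambda>\<xi>. (1 + \<xi>\<^sup>2) powr s * (packet X M \<xi>)\<^sup>2)"
    using order_trans[OF pt abs_ge_self] by (intro Bochner_Integration.integrable_bound[OF Bi] AE_I2) auto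
  show "(LINT \<xi>|lborel. (1 + \<xi>\<^sup>2) powr s * (packet X M \<xi>)\<^sup>2) \<le> 6 * sqrt (2 * pi) * (N powr (2 * s) * energy X M)"
    unfolding BI[symmetric] by (rule integral_mono[OF i Bi pt])
qed

text \<open>Off the diagonal the terms decay at least like \<open>(1/2) ^ k\<close> with
  \<open>k\<close> the distance of the indices: the square of \<open>2 * k\<close>, divided by 4, is
  at least \<open>k\<close>, and \<open>exp (-1) \<le> 1/2\<close>. Each row of the double sum is
  therefore at most 4.\<close>

lemma energy_separated:
  assumes M: "M > 0" and sep: "\<And>m n. m < M \<Longrightarrow> n < M \<Longrightarrow> \<bar>X m - X n\<bar> \<ge> 2 * \<bar>real m - real n\<bar>"
  shows "energy X M \<le> 4 / real M"
proof -
  have ex: "exp (- (1/4 * (X m - X n)\<^sup>2)) \<le> (1/2) ^ k" if "m < M" "n < M" and k: "real k = \<bar>real m - real n\<bar>" for m n k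
  proof -
    have "(2 * real k)\<^sup>2 \<le> (X m - X n)\<^sup>2"
      using power_mono[OF sep[OF that(1,2), folded k], of 2] by simp
    then have "(real k)\<^sup>2 \<le> 1/4 * (X m - X n)\<^sup>2" by (simp add: power_mult_distrib)
    moreover have "real k \<le> (real k)\<^sup>2" by (cases k) (auto simp: power2_eq_square)
    ultimately have "- (1/4 * (X m - X n)\<^sup>2) \<le> - real k" by linarith
    then have "exp (- (1/4 * (X m - X n)\<^sup>2)) \<le> exp (- real k)" by (simp only: exp_le_cancel_iff)
    also have "\<dots> = (exp (-1)) ^ k" by (simp add: exp_of_nat_mult[symmetric])
    also have "\<dots> \<le> (1/2) ^ k"
    proof (rule power_mono)
      have "2 \<le> exp (1::real)" using exp_ge_add_one_self[of 1] by simp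
      then show "exp (-1) \<le> (1/2::real)" by (simp add: exp_minus inverse_eq_divide divide_le_eq)
    qed simp
    finally show ?thesis .
  qed
  have lower: "(\<Sum>n\<le>m. (1/2::real) ^ (m - n)) \<le> 2" for m
  proof (induction m)
    case (Suc m)
    have "(\<Sum>n\<le>Suc m. (1/2::real) ^ (Suc m - n)) = (\<Sum>n\<le>m. (1/2) * (1/2) ^ (m - n)) + 1"
      by (simp add: Suc_diff_le)
    also have "(\<Sum>n\<le>m. (1/2) * (1/2::real) ^ (m - n)) = (1/2) * (\<Sum>n\<le>m. (1/2) ^ (m - n))"
      by (rule sum_distrib_left[symmetric])
    finally show ?case using Suc by linarith
  qed simp
  have upper: "(\<Sum>n\<in>{m..<M}. (1/2::real) ^ (n - m)) \<le> 2" for m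
  proof -
    have "(\<Sum>n\<in>{m..<M}. (1/2::real) ^ (n - m)) = (\<Sum>n<M - m. (1/2::real) ^ n)"
      by (rule sum.reindex_bij_witness[where i = "\<lambda>n. n + m" and j = "\<lambda>n. n - m"]) auto
    also have "(\<Sum>n<k. (1/2::real) ^ n) = 2 - 2 * (1/2) ^ k" for k by (induction k) auto
    then have "(\<Sum>n<M - m. (1/2::real) ^ n) \<le> 2" by simp
    finally show ?thesis .
  qed
  have row: "(\<Sum>n<M. exp (- (1/4 * (X m - X n)\<^sup>2))) \<le> 4" if m: "m < M" for m
  proof -
    have "(\<Sum>n<M. exp (- (1/4 * (X m - X n)\<^sup>2))) \<le> (\<Sum>n\<in>{..m} \<union> {m..<M}. exp (- (1/4 * (X m - X n)\<^sup>2)))"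
      using m by (intro sum_mono2) auto
    also have "\<dots> \<le> (\<Sum>n\<le>m. exp (- (1/4 * (X m - X n)\<^sup>2))) + (\<Sum>n\<in>{m..<M}. exp (- (1/4 * (X m - X n)\<^sup>2)))"
      by (simp add: sum_Un sum_nonneg)
    also have "\<dots> \<le> (\<Sum>n\<le>m. (1/2) ^ (m - n)) + (\<Sum>n\<in>{m..<M}. (1/2) ^ (n - m))"
      using m by (intro add_mono sum_mono ex) (auto simp: of_nat_diff)
    also have "\<dots> \<le> 4" using lower[of m] upper[of m] by linarith
    finally show ?thesis .
  qed
  have "energy X M \<le> (\<Sum>m<M. 4) / (real M)\<^sup>2"
    unfolding energy_def using row by (intro divide_right_mono sum_mono) auto
  also have "\<dots> = 4 / real M" using M by (simp add: power2_eq_square)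
  finally show ?thesis .
qed

text \<open>Peeling off the first term with
  \<open>(a + b)\<^sup>2 \<le> 2 * a\<^sup>2 + 2 * b\<^sup>2\<close> doubles the later weights at
  each step. It replaces the triangle inequality in L2 by a pointwise bound that is compatible with
  any weight.\<close>

lemma norm_sum_squared_weighted:
  fixes a :: "nat \<Rightarrow> complex"
  shows "(cmod (\<Sum>k<n. a k))\<^sup>2 \<le> (\<Sum>k<n. 2 ^ (k + 1) * (cmod (a k))\<^sup>2)"
proof (induction n arbitrary: a)
  case (Suc n)
  let ?R = "\<Sum>k<n. a (Suc k)"
  have "(cmod (a 0 + ?R))\<^sup>2 \<le> (cmod (a 0) + cmod ?R)\<^sup>2" by (intro power_mono norm_triangle_ineq) auto
  also have "\<dots> \<le> 2 * (cmod (a 0))\<^sup>2 + 2 * (cmod ?R)\<^sup>2"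
    using sum_squares_bound[of "cmod (a 0)" "cmod ?R"] by (simp add: power2_sum)
  also have "\<dots> \<le> 2 * (cmod (a 0))\<^sup>2 + 2 * (\<Sum>k<n. 2 ^ (k + 1) * (cmod (a (Suc k)))\<^sup>2)"
    using Suc[of "\<lambda>k. a (Suc k)"] by simp
  also have "\<dots> = (\<Sum>k<Suc n. 2 ^ (k + 1) * (cmod (a k))\<^sup>2)"
    by (simp add: sum.lessThan_Suc_shift sum_distrib_left mult.assoc del: sum.lessThan_Suc)
  finally show ?case by (simp add: sum.lessThan_Suc_shift del: sum.lessThan_Suc)
qed simp

text \<open>The decay \<open>(1/16) ^ k\<close> beats the weights \<open>2 ^ (k + 1)\<close>, with a
  bound independent of \<open>n\<close>. The weight \<open>w\<close> lets one statement cover both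
  the L2 norm and the Sobolev norm.\<close>

lemma weighted_partial_sums:
  fixes F :: "nat \<Rightarrow> real \<Rightarrow> complex" and w :: "real \<Rightarrow> real"
  assumes [measurable]: "\<And>k. F k \<in> borel_measurable borel" "w \<in> borel_measurable borel" and w0: "\<And>x. w x \<ge> 0"
    and i: "\<And>k. integrable lborel (\<lambda>x. w x * (cmod (F k x))\<^sup>2)"
    and b: "\<And>k. (LINT x|lborel. w x * (cmod (F k x))\<^sup>2) \<le> (1/16) ^ k"
  shows "integrable lborel (\<lambda>x. w x * (cmod (\<Sum>k<n. F k x))\<^sup>2)"
    and "(LINT x|lborel. w x * (cmod (\<Sum>k<n. F k x))\<^sup>2) \<le> 4"
proof -
  define B where "B x = (\<Sum>k<n. 2 ^ (k + 1) * (w x * (cmod (F k x))\<^sup>2))" for x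
  have Bi: "integrable lborel B" unfolding B_def by (intro Bochner_Integration.integrable_sum integrable_mult_right i)
  have pt: "w x * (cmod (\<Sum>k<n. F k x))\<^sup>2 \<le> B x" for x
  proof -
    have "w x * (cmod (\<Sum>k<n. F k x))\<^sup>2 \<le> w x * (\<Sum>k<n. 2 ^ (k + 1) * (cmod (F k x))\<^sup>2)"
      by (intro mult_left_mono norm_sum_squared_weighted w0)
    then show ?thesis by (simp add: B_def sum_distrib_left mult_ac)
  qed
  show ii: "integrable lborel (\<lambda>x. w x * (cmod (\<Sum>k<n. F k x))\<^sup>2)"
    using order_trans[OF pt abs_ge_self] w0 by (intro Bochner_Integration.integrable_bound[OF Bi] AE_I2) (auto simp: abs_mult)
  have "(LINT x|lborel. w x * (cmod (\<Sum>k<n. F k x))\<^sup>2) \<le> (LINT x|lborel. B x)"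
    by (rule integral_mono[OF ii Bi pt])
  also have "\<dots> = (\<Sum>k<n. 2 ^ (k + 1) * (LINT x|lborel. w x * (cmod (F k x))\<^sup>2))"
    unfolding B_def using i by (simp add: Bochner_Integration.integral_sum)
  also have "\<dots> \<le> (\<Sum>k<n. 2 ^ (k + 1) * (1/16) ^ k)" by (intro sum_mono mult_left_mono b) auto
  also have "\<dots> \<le> (\<Sum>k<n. 2 * (1/2) ^ k)"
  proof (intro sum_mono)
    fix k
    have "(2::real) ^ (k + 1) * (1/16) ^ k = 2 * (1/8) ^ k" by (simp add: power_mult_distrib[symmetric])
    also have "\<dots> \<le> 2 * (1/2) ^ k" by (intro mult_left_mono power_mono) auto
    finally show "(2::real) ^ (k + 1) * (1/16) ^ k \<le> 2 * (1/2) ^ k" .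
  qed
  also have "\<dots> = 4 - 4 * (1/2) ^ n" by (induction n) auto
  also have "\<dots> \<le> 4" by simp
  finally show "(LINT x|lborel. w x * (cmod (\<Sum>k<n. F k x))\<^sup>2) \<le> 4" .
qed

section \<open>Evolution near time zero and damping of high frequencies\<close>

lemma cmod_iexp_diff_le: "cmod (exp (\<i> * complex_of_real p) - exp (\<i> * complex_of_real q)) \<le> \<bar>p - q\<bar>"
proof -
  have "exp (\<i> * complex_of_real p) - exp (\<i> * complex_of_real q) = exp (\<i> * complex_of_real q) * (exp (\<i> * complex_of_real (p - q)) - 1)"
    by (simp add: right_diff_distrib exp_add[symmetric])
  then have "cmod (exp (\<i> * complex_of_real p) - exp (\<i> * complex_of_real q)) = cmod (exp (\<i> * complex_of_real (p - q)) - 1)"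
    by (simp add: norm_mult)
  then show ?thesis using iexp_approx1[of "p - q" 0] by simp
qed

lemma one_minus_exp_le: "0 \<le> a \<Longrightarrow> \<bar>exp (- a) - 1\<bar> \<le> (a::real)"
  using exp_ge_add_one_self[of "- a"] by simp

lemma wave_diff_le:
  assumes t: "t \<ge> 0"
  shows "cmod (wave \<gamma> 0 y t \<xi> - exp (\<i> * complex_of_real q)) \<le> \<bar>y * \<xi> + t * \<xi>\<^sup>2 - q\<bar> + t powr \<gamma> * \<xi>\<^sup>2"
proof -
  let ?p = "y * \<xi> + t * \<xi>\<^sup>2" and ?a = "t powr \<gamma> * \<xi>\<^sup>2"
  have eq: "wave \<gamma> 0 y t \<xi> - exp (\<i> * complex_of_real q) = exp (\<i> * complex_of_real ?p) * complex_of_real (exp (- ?a) - 1) + (exp (\<i> * complex_of_real ?p) - exp (\<i> * complex_of_real q))"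
    by (simp add: wave_def right_diff_distrib)
  have "cmod (wave \<gamma> 0 y t \<xi> - exp (\<i> * complex_of_real q)) \<le> cmod (exp (\<i> * complex_of_real ?p) * complex_of_real (exp (- ?a) - 1)) + \<bar>?p - q\<bar>"
    unfolding eq by (rule order_trans[OF norm_triangle_ineq add_left_mono[OF cmod_iexp_diff_le]])
  also have "cmod (exp (\<i> * complex_of_real ?p) * complex_of_real (exp (- ?a) - 1)) = \<bar>exp (- ?a) - 1\<bar>"
    by (simp only: norm_mult norm_exp_i_times norm_of_real mult_1)
  also have "\<dots> \<le> ?a" by (rule one_minus_exp_le) simp
  finally show ?thesis by simp
qed

text \<open>Continuity at time zero with a rate that does not depend on the point, at the price of a
  second moment. It makes the already chosen packets stationary on short time windows.\<close>

lemma P_gamma_close: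
  fixes h :: "real \<Rightarrow> real"
  assumes g: "\<gamma> > 0" and hm[measurable]: "h \<in> borel_measurable borel" and h0: "\<And>\<xi>. h \<xi> \<ge> 0"
    and h2: "integrable lborel (\<lambda>\<xi>. (1 + \<xi>\<^sup>2) * h \<xi>)" and t: "t \<ge> 0"
  shows "cmod (P_gamma \<gamma> (\<lambda>\<xi>. complex_of_real (h \<xi>)) y t - P_gamma \<gamma> (\<lambda>\<xi>. complex_of_real (h \<xi>)) x 0)
     \<le> (\<bar>y - x\<bar> + t + t powr \<gamma>) * (LINT \<xi>|lborel. (1 + \<xi>\<^sup>2) * h \<xi>)"
proof -
  have hi: "integrable lborel h"
    by (rule Bochner_Integration.integrable_bound[OF h2]) (use h0 in \<open>auto simp: algebra_simps abs_mult intro!: AE_I2 mult_right_mono\<close>)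
  have wi: "integrable lborel (\<lambda>\<xi>. wave \<gamma> 0 y t \<xi> * complex_of_real (h \<xi>))" for y t
    by (rule Bochner_Integration.integrable_bound[OF hi]) (auto simp: norm_mult cmod_wave intro!: AE_I2 mult_left_le_one_le)
  have pt: "cmod (wave \<gamma> 0 y t \<xi> * complex_of_real (h \<xi>) - wave \<gamma> 0 x 0 \<xi> * complex_of_real (h \<xi>)) \<le> (\<bar>y - x\<bar> + t + t powr \<gamma>) * ((1 + \<xi>\<^sup>2) * h \<xi>)" for \<xi>
  proof -
    have w0: "wave \<gamma> 0 x 0 \<xi> = exp (\<i> * complex_of_real (x * \<xi>))" using g by (simp add: wave_def)
    have "cmod (wave \<gamma> 0 y t \<xi> - wave \<gamma> 0 x 0 \<xi>) \<le> \<bar>y * \<xi> + t * \<xi>\<^sup>2 - x * \<xi>\<bar> + t powr \<gamma> * \<xi>\<^sup>2"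
      unfolding w0 by (rule wave_diff_le[OF t])
    also have "\<bar>y * \<xi> + t * \<xi>\<^sup>2 - x * \<xi>\<bar> \<le> \<bar>y - x\<bar> * \<bar>\<xi>\<bar> + t * \<xi>\<^sup>2"
    proof -
      have "y * \<xi> + t * \<xi>\<^sup>2 - x * \<xi> = (y - x) * \<xi> + t * \<xi>\<^sup>2" by (simp add: algebra_simps)
      also have "\<bar>\<dots>\<bar> \<le> \<bar>(y - x) * \<xi>\<bar> + \<bar>t * \<xi>\<^sup>2\<bar>" by (rule abs_triangle_ineq)
      finally show ?thesis using t by (simp add: abs_mult)
    qed
    also have "\<bar>y - x\<bar> * \<bar>\<xi>\<bar> + t * \<xi>\<^sup>2 + t powr \<gamma> * \<xi>\<^sup>2 \<le> \<bar>y - x\<bar> * (1 + \<xi>\<^sup>2) + t * (1 + \<xi>\<^sup>2) + t powr \<gamma> * (1 + \<xi>\<^sup>2)"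
    proof (intro add_mono mult_left_mono)
      have "2 * \<bar>\<xi>\<bar> \<le> 1 + \<xi>\<^sup>2" using sum_squares_bound[of 1 "\<bar>\<xi>\<bar>"] by simp
      then show "\<bar>\<xi>\<bar> \<le> 1 + \<xi>\<^sup>2" using abs_ge_zero[of \<xi>] by linarith
    qed (use t in auto)
    finally have "cmod (wave \<gamma> 0 y t \<xi> - wave \<gamma> 0 x 0 \<xi>) \<le> (\<bar>y - x\<bar> + t + t powr \<gamma>) * (1 + \<xi>\<^sup>2)" by (simp only: distrib_right)
    from mult_right_mono[OF this h0[of \<xi>]] show ?thesis
      by (simp add: left_diff_distrib[symmetric] norm_mult h0 mult.assoc)
  qed
  have "P_gamma \<gamma> (\<lambda>\<xi>. complex_of_real (h \<xi>)) y t - P_gamma \<gamma> (\<lambda>\<xi>. complex_of_real (h \<xi>)) x 0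
     = complex_of_real (1 / (2 * pi)) * (LINT \<xi>|lborel. wave \<gamma> 0 y t \<xi> * complex_of_real (h \<xi>) - wave \<gamma> 0 x 0 \<xi> * complex_of_real (h \<xi>))"
    unfolding P_gamma_wave using wi by (simp add: right_diff_distrib)
  then have "cmod (P_gamma \<gamma> (\<lambda>\<xi>. complex_of_real (h \<xi>)) y t - P_gamma \<gamma> (\<lambda>\<xi>. complex_of_real (h \<xi>)) x 0)
     = 1 / (2 * pi) * cmod (LINT \<xi>|lborel. wave \<gamma> 0 y t \<xi> * complex_of_real (h \<xi>) - wave \<gamma> 0 x 0 \<xi> * complex_of_real (h \<xi>))"
    by (simp add: norm_mult norm_divide)
  also have "\<dots> \<le> 1 * cmod (LINT \<xi>|lborel. wave \<gamma> 0 y t \<xi> * complex_of_real (h \<xi>) - wave \<gamma> 0 x 0 \<xi> * complex_of_real (h \<xi>))"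
    using pi_ge_two by (intro mult_right_mono) (auto simp: field_simps)
  also have "\<dots> \<le> (LINT \<xi>|lborel. (\<bar>y - x\<bar> + t + t powr \<gamma>) * ((1 + \<xi>\<^sup>2) * h \<xi>))"
    unfolding mult_1
    by (rule order_trans[OF integral_norm_bound integral_mono[OF integrable_norm[OF Bochner_Integration.integrable_diff[OF wi wi]] integrable_mult_right[OF h2] pt]])
  finally show ?thesis by simp
qed

lemma P_gamma_norm_le:
  fixes h :: "real \<Rightarrow> real"
  assumes hm[measurable]: "h \<in> borel_measurable borel" and h0: "\<And>\<xi>. h \<xi> \<ge> 0" and h1: "integrable lborel h"
    and t: "0 < r" "r \<le> t" and g: "\<gamma> > 0"
  shows "cmod (P_gamma \<gamma> (\<lambda>\<xi>. complex_of_real (h \<xi>)) y t) \<le> (LINT \<xi>|lborel. exp (- (r powr \<gamma> * \<xi>\<^sup>2)) * h \<xi>)"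
proof -
  have ei: "integrable lborel (\<lambda>\<xi>. exp (- (r powr \<gamma> * \<xi>\<^sup>2)) * h \<xi>)"
    by (rule Bochner_Integration.integrable_bound[OF h1]) (use h0 in \<open>auto intro!: AE_I2 mult_left_le_one_le\<close>)
  have wi: "integrable lborel (\<lambda>\<xi>. wave \<gamma> 0 y t \<xi> * complex_of_real (h \<xi>))"
    by (rule Bochner_Integration.integrable_bound[OF h1]) (auto simp: norm_mult cmod_wave intro!: AE_I2 mult_left_le_one_le)
  have "cmod (P_gamma \<gamma> (\<lambda>\<xi>. complex_of_real (h \<xi>)) y t) = 1 / (2 * pi) * cmod (LINT \<xi>|lborel. wave \<gamma> 0 y t \<xi> * complex_of_real (h \<xi>))"
    by (simp add: P_gamma_wave norm_mult norm_divide)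
  also have "\<dots> \<le> 1 * cmod (LINT \<xi>|lborel. wave \<gamma> 0 y t \<xi> * complex_of_real (h \<xi>))"
    using pi_ge_two by (intro mult_right_mono) (auto simp: field_simps)
  also have "\<dots> \<le> (LINT \<xi>|lborel. exp (- (r powr \<gamma> * \<xi>\<^sup>2)) * h \<xi>)"
    unfolding mult_1
  proof (rule order_trans[OF integral_norm_bound integral_mono[OF integrable_norm[OF wi] ei]])
    fix \<xi>
    have "r powr \<gamma> * \<xi>\<^sup>2 \<le> t powr \<gamma> * \<xi>\<^sup>2" using t g by (intro mult_right_mono powr_mono2) auto
    then show "norm (wave \<gamma> 0 y t \<xi> * complex_of_real (h \<xi>)) \<le> exp (- (r powr \<gamma> * \<xi>\<^sup>2)) * h \<xi>"
      using h0 by (auto simp: norm_mult cmod_wave intro!: mult_right_mono)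
  qed
  finally show ?thesis .
qed

lemma packet_moments:
  shows "integrable lborel (packet X M)" and "integrable lborel (\<lambda>\<xi>. (1 + \<xi>\<^sup>2) * packet X M \<xi>)"
proof -
  define B where "B \<xi> = (\<Sum>m<M. (4 + 4 * (X m)\<^sup>2) * 2 * exp (- (1/4 * (\<xi> - X m)\<^sup>2))) / real M" for \<xi>
  have Bi: "integrable lborel B"
    unfolding B_def by (intro integrable_divide Bochner_Integration.integrable_sum integrable_mult_right integrable_gaussian) auto
  have e: "(1 + \<xi>\<^sup>2) * exp (- (1/2 * (\<xi> - a)\<^sup>2)) \<le> (4 + 4 * a\<^sup>2) * 2 * exp (- (1/4 * (\<xi> - a)\<^sup>2))" for \<xi> a :: real
  proof -
    let ?u = "(\<xi> - a)\<^sup>2"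
    have "0 \<le> (2 * a - \<xi>)\<^sup>2" by simp
    then have sq: "\<xi>\<^sup>2 \<le> 2 * a\<^sup>2 + 2 * ?u" by (simp add: power2_eq_square algebra_simps)
    have ex: "(4 + 4 * p) * (1 + 1/4 * u) * 2 = 8 + 8 * p + 2 * u + 2 * (p * u)" for p u :: real
      by (simp add: algebra_simps)
    have "0 \<le> a\<^sup>2 * ?u" "0 \<le> a\<^sup>2" "0 \<le> ?u" by auto
    then have "1 + \<xi>\<^sup>2 \<le> (4 + 4 * a\<^sup>2) * (1 + 1/4 * ?u) * 2" using sq ex[of "a\<^sup>2" ?u] by linarith
    also have "1 + 1/4 * ?u \<le> exp (1/4 * ?u)" by (rule exp_ge_add_one_self)
    finally have "1 + \<xi>\<^sup>2 \<le> (4 + 4 * a\<^sup>2) * exp (1/4 * ?u) * 2" by (simp add: mult_left_mono)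
    then have "(1 + \<xi>\<^sup>2) * exp (- (1/2 * ?u)) \<le> (4 + 4 * a\<^sup>2) * exp (1/4 * ?u) * 2 * exp (- (1/2 * ?u))"
      by (intro mult_right_mono) auto
    also have "\<dots> = (4 + 4 * a\<^sup>2) * 2 * (exp (1/4 * ?u) * exp (- (1/2 * ?u)))" by (simp only: mult_ac)
    also have "exp (1/4 * ?u) * exp (- (1/2 * ?u)) = exp (- (1/4 * ?u))" by (simp add: exp_add[symmetric])
    finally show ?thesis .
  qed
  have pt: "(1 + \<xi>\<^sup>2) * packet X M \<xi> \<le> B \<xi>" for \<xi>
    unfolding packet_def B_def times_divide_eq_right sum_distrib_left by (intro divide_right_mono sum_mono e) auto
  have p0: "0 \<le> (1 + \<xi>\<^sup>2) * packet X M \<xi>" for \<xi> by (intro mult_nonneg_nonneg packet_nonneg) auto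
  show i2: "integrable lborel (\<lambda>\<xi>. (1 + \<xi>\<^sup>2) * packet X M \<xi>)"
    using order_trans[OF pt abs_ge_self] p0 by (intro Bochner_Integration.integrable_bound[OF Bi] AE_I2) auto
  show "integrable lborel (packet X M)"
  proof (rule Bochner_Integration.integrable_bound[OF i2], measurable, rule AE_I2)
    fix \<xi>
    have "1 * packet X M \<xi> \<le> (1 + \<xi>\<^sup>2) * packet X M \<xi>" by (intro mult_right_mono packet_nonneg) auto
    then show "norm (packet X M \<xi>) \<le> norm ((1 + \<xi>\<^sup>2) * packet X M \<xi>)"
      using p0 packet_nonneg by simp
  qed
qed

text \<open>For a bump centred at \<open>a \<ge> A\<close>, either \<open>\<xi> \<ge> a / 2\<close>
  and the damping is small, or \<open>\<xi>\<close> is at distance at least \<open>a / 2\<close>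
  from the centre and half of the bump is small. The threshold \<open>A\<close> depends on
  \<open>r\<close> and \<open>d\<close> alone.\<close>

lemma packet_damping:
  fixes r d :: real
  assumes r: "r > 0" and d: "d > 0"
  obtains A where "A > 0" "\<And>X M. M > 0 \<Longrightarrow> (\<And>m. m < M \<Longrightarrow> A \<le> X m) \<Longrightarrow> (LINT \<xi>|lborel. exp (- (r * \<xi>\<^sup>2)) * packet X M \<xi>) \<le> d"
proof -
  \<comment> \<open>The two alternatives below yield the rates \<open>r / 4\<close> and
    \<open>1 / 16\<close>, both from squaring \<open>a / 2\<close>.\<close>
  define k where "k = min (r / 4) (1 / 16)"
  have k: "k > 0" "k \<le> r / 4" "k \<le> 1 / 16" using r by (auto simp: k_def)
  have pt: "exp (- (r * \<xi>\<^sup>2)) * exp (- (1/2 * (\<xi> - a)\<^sup>2)) \<le> exp (- (k * A\<^sup>2)) * exp (- (1/4 * (\<xi> - a)\<^sup>2))" if A: "0 < A" "A \<le> a" for \<xi> a A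
  proof -
    have "k * A\<^sup>2 \<le> r * \<xi>\<^sup>2 + 1/4 * (\<xi> - a)\<^sup>2"
    proof -
      have kA: "k * A\<^sup>2 \<le> k * a\<^sup>2" using A k by (intro mult_left_mono power_mono) auto
      show ?thesis
      proof (cases "a / 2 \<le> \<xi>")
        case True
        have "(a / 2)\<^sup>2 \<le> \<xi>\<^sup>2" using True A by (intro power_mono) auto
        then have "r * (a / 2)\<^sup>2 \<le> r * \<xi>\<^sup>2" using r by (intro mult_left_mono) auto
        moreover have "k * a\<^sup>2 \<le> r / 4 * a\<^sup>2" using k by (intro mult_right_mono) auto
        moreover have "r * (a / 2)\<^sup>2 = r / 4 * a\<^sup>2" by (simp add: power_divide)
        moreover have "0 \<le> 1/4 * (\<xi> - a)\<^sup>2" by simp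
        ultimately show ?thesis using kA by linarith
      next
        case False
        have "(a / 2)\<^sup>2 \<le> (a - \<xi>)\<^sup>2" using False A by (intro power_mono) auto
        then have "1/16 * a\<^sup>2 \<le> 1/4 * (\<xi> - a)\<^sup>2" by (simp add: power_divide power2_commute)
        moreover have "k * a\<^sup>2 \<le> 1/16 * a\<^sup>2" using k by (intro mult_right_mono) auto
        moreover have "0 \<le> r * \<xi>\<^sup>2" using r by simp
        ultimately show ?thesis using kA by linarith
      qed
    qed
    then have "- (r * \<xi>\<^sup>2) + - (1/2 * (\<xi> - a)\<^sup>2) \<le> - (k * A\<^sup>2) + - (1/4 * (\<xi> - a)\<^sup>2)" by linarith
    then show ?thesis unfolding exp_add[symmetric] by simp
  qed
  define K where "K = sqrt (pi / (1/4))"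
  have "((\<lambda>A. exp (- (k * A\<^sup>2)) * K) \<longlongrightarrow> 0) at_top"
    using k by real_asymp
  then have "\<forall>\<^sub>F A in at_top. exp (- (k * A\<^sup>2)) * K < d \<and> A > 0"
    by (intro eventually_conj order_tendstoD(2)[OF _ d] eventually_gt_at_top)
  then obtain A where A: "exp (- (k * A\<^sup>2)) * K < d" "A > 0"
    using eventually_happens by fastforce
  show ?thesis
  proof (rule that[OF A(2)])
    fix X :: "nat \<Rightarrow> real" and M :: nat assume M: "M > 0" and X: "\<And>m. m < M \<Longrightarrow> A \<le> X m"
    have gb: "has_bochner_integral lborel (\<lambda>\<xi>. (\<Sum>m<M. exp (- (k * A\<^sup>2)) * exp (- (1/4 * (\<xi> - X m)\<^sup>2))) / real M) ((\<Sum>m<M. exp (- (k * A\<^sup>2)) * K) / real M)"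
      unfolding K_def by (intro has_bochner_integral_divide has_bochner_integral_sum has_bochner_integral_mult_right gaussian_has_integral) auto
    have i: "integrable lborel (\<lambda>\<xi>. exp (- (r * \<xi>\<^sup>2)) * packet X M \<xi>)"
      by (rule Bochner_Integration.integrable_bound[OF packet_moments(1)[of X M]])
         (use r in \<open>auto simp: packet_nonneg intro!: AE_I2 mult_left_le_one_le\<close>)
    have "(LINT \<xi>|lborel. exp (- (r * \<xi>\<^sup>2)) * packet X M \<xi>) \<le> (LINT \<xi>|lborel. (\<Sum>m<M. exp (- (k * A\<^sup>2)) * exp (- (1/4 * (\<xi> - X m)\<^sup>2))) / real M)"
    proof (rule integral_mono[OF i])
      show "integrable lborel (\<lambda>\<xi>. (\<Sum>m<M. exp (- (k * A\<^sup>2)) * exp (- (1/4 * (\<xi> - X m)\<^sup>2))) / real M)"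
        using gb by (simp only: has_bochner_integral_iff)
      show "exp (- (r * \<xi>\<^sup>2)) * packet X M \<xi> \<le> (\<Sum>m<M. exp (- (k * A\<^sup>2)) * exp (- (1/4 * (\<xi> - X m)\<^sup>2))) / real M" for \<xi>
        unfolding packet_def times_divide_eq_right sum_distrib_left
        using X A(2) by (intro divide_right_mono sum_mono pt) auto
    qed
    also have "\<dots> = (\<Sum>m<M. exp (- (k * A\<^sup>2)) * K) / real M"
      using gb by (simp only: has_bochner_integral_iff)
    also have "\<dots> = exp (- (k * A\<^sup>2)) * K" using M by simp
    finally show "(LINT \<xi>|lborel. exp (- (r * \<xi>\<^sup>2)) * packet X M \<xi>) \<le> d" using A by simp
  qed
qed

section \<open>Lacunary sums of packets\<close>

text \<open>The building blocks of a counterexample: frequencies above any \<open>A\<close>, norms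
  below any \<open>\<epsilon>\<close>, times below any \<open>r\<close>, and yet size
  \<open>c\<close> somewhere along the curve from every point of \<open>{0..\<kappa>}\<close>. The
  lower time \<open>T\<close> is common to all these points, so that the next packet can be confined
  to earlier times.\<close>

definition packet_supply :: "real \<Rightarrow> (real \<Rightarrow> real \<Rightarrow> real) \<Rightarrow> real \<Rightarrow> real \<Rightarrow> real \<Rightarrow> bool" where
  "packet_supply \<gamma> \<Gamma> s \<kappa> c \<longleftrightarrow> (\<forall>A>0. \<forall>\<epsilon>>0. \<forall>r>0. \<exists>X M N T. 0 < M \<and> 1 \<le> N \<and> (\<forall>m<M. A \<le> X m \<and> X m \<le> N)
     \<and> energy X M \<le> \<epsilon> \<and> N powr (2 * s) * energy X M \<le> \<epsilon> \<and> 0 < T \<and> T \<le> r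
     \<and> (\<forall>x\<in>{0..\<kappa>}. \<exists>t\<in>{T..r}. c \<le> cmod (P_gamma \<gamma> (\<lambda>\<xi>. complex_of_real (packet X M \<xi>)) (\<Gamma> x t) t)))"

lemma energy_nonneg: "energy X M \<ge> 0"
  by (simp add: energy_def sum_nonneg)

text \<open>At stage \<open>n\<close> the sum of the packets before \<open>n\<close> is almost
  stationary up to time \<open>r n\<close>, while the packet \<open>n\<close> is damped at
  \<open>r n\<close> but large at some time in \<open>{T n..r n}\<close>. These windows descend to 0
  and overlap at most in endpoints.\<close>

definition lacunary :: "real \<Rightarrow> (real \<Rightarrow> real \<Rightarrow> real) \<Rightarrow> real \<Rightarrow> real \<Rightarrow> real \<Rightarrow> (nat \<Rightarrow> nat \<Rightarrow> real) \<Rightarrow> (nat \<Rightarrow> nat) \<Rightarrow> (nat \<Rightarrow> real) \<Rightarrow> (nat \<Rightarrow> real) \<Rightarrow> bool" where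
  "lacunary \<gamma> \<Gamma> s \<kappa> c X M r T \<longleftrightarrow> (\<forall>n. 0 < M n \<and> 0 < T n \<and> T n \<le> r n \<and> r (Suc n) \<le> T n \<and> r n \<le> 1 / real (Suc n)
     \<and> (\<forall>x\<in>{0..\<kappa>}. \<forall>t\<in>{0<..r n}. cmod (P_gamma \<gamma> (\<lambda>\<xi>. complex_of_real (\<Sum>k<n. packet (X k) (M k) \<xi>)) (\<Gamma> x t) t
           - P_gamma \<gamma> (\<lambda>\<xi>. complex_of_real (\<Sum>k<n. packet (X k) (M k) \<xi>)) x 0) \<le> (1/2) ^ n)
     \<and> (LINT \<xi>|lborel. exp (- (r n powr \<gamma> * \<xi>\<^sup>2)) * packet (X n) (M n) \<xi>) \<le> (1/2) ^ n
     \<and> energy (X n) (M n) \<le> (1/16) ^ n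
     \<and> integrable lborel (\<lambda>\<xi>. (1 + \<xi>\<^sup>2) powr s * (packet (X n) (M n) \<xi>)\<^sup>2)
     \<and> (LINT \<xi>|lborel. (1 + \<xi>\<^sup>2) powr s * (packet (X n) (M n) \<xi>)\<^sup>2) \<le> (1/16) ^ n
     \<and> (\<forall>x\<in>{0..\<kappa>}. \<exists>t\<in>{T n..r n}. c \<le> cmod (P_gamma \<gamma> (\<lambda>\<xi>. complex_of_real (packet (X n) (M n) \<xi>)) (\<Gamma> x t) t)))"

text \<open>Packets are chosen inductively: the times of a new packet are so small that the earlier
  packets have almost reached their initial values, and its frequencies are so large that it is
  already damped at the times of the earlier ones.\<close>
lemma lacunary_packets:
  assumes g: "\<gamma> > 0" and a: "\<alpha> > 0" and s: "0 \<le> s" "s \<le> 1"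
    and \<Gamma>: "admissible_curve \<alpha> \<Gamma>" and sup: "packet_supply \<gamma> \<Gamma> s \<kappa> c"
  obtains X M r T where "lacunary \<gamma> \<Gamma> s \<kappa> c X M r T"
proof -
  obtain C3 where C3: "C3 > 0" and hol: "\<And>t t' x. t \<in> {-1..1} \<Longrightarrow> t' \<in> {-1..1} \<Longrightarrow> \<bar>\<Gamma> x t - \<Gamma> x t'\<bar> \<le> C3 * \<bar>t - t'\<bar> powr \<alpha>"
    using admissible_curveE[OF \<Gamma>] by metis
  have G0: "\<Gamma> x 0 = x" for x using \<Gamma> by (simp add: admissible_curve_def)
  \<comment> \<open>The state consists of the sum of the packets so far, the latest frequencies and
    their number, and the upper and lower end of the latest time window.\<close>
  define hh :: "(real \<Rightarrow> real) \<times> (nat \<Rightarrow> real) \<times> nat \<times> real \<times> real \<Rightarrow> real \<Rightarrow> real" where "hh = fst"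
  define xx :: "(real \<Rightarrow> real) \<times> (nat \<Rightarrow> real) \<times> nat \<times> real \<times> real \<Rightarrow> nat \<Rightarrow> real" where "xx = fst \<circ> snd"
  define mm :: "(real \<Rightarrow> real) \<times> (nat \<Rightarrow> real) \<times> nat \<times> real \<times> real \<Rightarrow> nat" where "mm = fst \<circ> snd \<circ> snd"
  define rr :: "(real \<Rightarrow> real) \<times> (nat \<Rightarrow> real) \<times> nat \<times> real \<times> real \<Rightarrow> real" where "rr = fst \<circ> snd \<circ> snd \<circ> snd"
  define tt :: "(real \<Rightarrow> real) \<times> (nat \<Rightarrow> real) \<times> nat \<times> real \<times> real \<Rightarrow> real" where "tt = snd \<circ> snd \<circ> snd \<circ> snd"
  have sel: "hh (h, X, m, r, t) = h" "xx (h, X, m, r, t) = X" "mm (h, X, m, r, t) = m" "rr (h, X, m, r, t) = r" "tt (h, X, m, r, t) = t"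
    for h X m r t by (simp_all add: hh_def xx_def mm_def rr_def tt_def)
  \<comment> \<open>\<open>P\<close> records what the next choice needs of the accumulated sum. Its
    first clause pins the empty sum, from which the sums are recovered by induction
    afterwards.\<close>
  define P where "P n z \<longleftrightarrow> (n = 0 \<longrightarrow> hh z = (\<lambda>_. 0)) \<and> hh z \<in> borel_measurable borel \<and> (\<forall>\<xi>. hh z \<xi> \<ge> 0)
     \<and> integrable lborel (\<lambda>\<xi>. (1 + \<xi>\<^sup>2) * hh z \<xi>) \<and> tt z > 0" for n :: nat and z
  define Q where "Q n z z' \<longleftrightarrow> hh z' = (\<lambda>\<xi>. hh z \<xi> + packet (xx z') (mm z') \<xi>) \<and> 0 < mm z' \<and> 0 < tt z' \<and> tt z' \<le> rr z' \<and> rr z' \<le> tt z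
     \<and> rr z' \<le> 1 / real (Suc n)
     \<and> (\<forall>x\<in>{0..\<kappa>}. \<forall>t\<in>{0<..rr z'}. cmod (P_gamma \<gamma> (\<lambda>\<xi>. complex_of_real (hh z \<xi>)) (\<Gamma> x t) t - P_gamma \<gamma> (\<lambda>\<xi>. complex_of_real (hh z \<xi>)) x 0) \<le> (1/2) ^ n)
     \<and> (LINT \<xi>|lborel. exp (- (rr z' powr \<gamma> * \<xi>\<^sup>2)) * packet (xx z') (mm z') \<xi>) \<le> (1/2) ^ n
     \<and> energy (xx z') (mm z') \<le> (1/16) ^ n
     \<and> integrable lborel (\<lambda>\<xi>. (1 + \<xi>\<^sup>2) powr s * (packet (xx z') (mm z') \<xi>)\<^sup>2)
     \<and> (LINT \<xi>|lborel. (1 + \<xi>\<^sup>2) powr s * (packet (xx z') (mm z') \<xi>)\<^sup>2) \<le> (1/16) ^ n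
     \<and> (\<forall>x\<in>{0..\<kappa>}. \<exists>t\<in>{tt z'..rr z'}. c \<le> cmod (P_gamma \<gamma> (\<lambda>\<xi>. complex_of_real (packet (xx z') (mm z') \<xi>)) (\<Gamma> x t) t))" for n :: nat and z z'
  have "\<exists>st. \<forall>n. P n (st n) \<and> Q n (st n) (st (Suc n))"
  proof (rule dependent_nat_choice)
    \<comment> \<open>Of the initial state only the zero function and the positive last entry
      matter; the latter caps the first time window.\<close>
    show "\<exists>z. P 0 z" by (rule exI[of _ "(\<lambda>_. 0, \<lambda>_. 0, 0, 0, 1)"]) (simp add: P_def sel)
  next
    fix z :: "(real \<Rightarrow> real) \<times> (nat \<Rightarrow> real) \<times> nat \<times> real \<times> real" and n :: nat
    assume Pz: "P n z"
    define h where "h = hh z"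
    have hm[measurable]: "h \<in> borel_measurable borel" and h0: "\<And>\<xi>. h \<xi> \<ge> 0" and h2: "integrable lborel (\<lambda>\<xi>. (1 + \<xi>\<^sup>2) * h \<xi>)" and t0: "tt z > 0"
      using Pz by (auto simp: P_def h_def)
    define m where "m = (LINT \<xi>|lborel. (1 + \<xi>\<^sup>2) * h \<xi>)"
    have m0: "m \<ge> 0" unfolding m_def by (intro Bochner_Integration.integral_nonneg mult_nonneg_nonneg h0) auto
    have "((\<lambda>t::real. (C3 * t powr \<alpha> + t + t powr \<gamma>) * m) \<longlongrightarrow> (C3 * 0 powr \<alpha> + 0 + 0 powr \<gamma>) * m) (at_right 0)"
      by (intro tendsto_intros tendsto_powr') (use a g in \<open>auto simp: eventually_at_filter\<close>)
    then have "((\<lambda>t::real. (C3 * t powr \<alpha> + t + t powr \<gamma>) * m) \<longlongrightarrow> 0) (at_right 0)" by simp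
    then have "\<forall>\<^sub>F t in at_right 0. (C3 * t powr \<alpha> + t + t powr \<gamma>) * m < (1/2) ^ n"
      by (rule order_tendstoD(2)) simp
    then obtain b where b: "b > 0" "\<And>t. 0 < t \<Longrightarrow> t < b \<Longrightarrow> (C3 * t powr \<alpha> + t + t powr \<gamma>) * m < (1/2) ^ n"
      unfolding eventually_at_right_field by blast
    define r where "r = min (b / 2) (min (tt z) (1 / real (Suc n)))"
    have r: "0 < r" "r < b" "r \<le> tt z" "r \<le> 1 / real (Suc n)" using b t0 by (auto simp: r_def)
    have r1: "r \<le> 1" using r(4) by (rule order_trans) (simp add: divide_le_eq)
    have close: "cmod (P_gamma \<gamma> (\<lambda>\<xi>. complex_of_real (h \<xi>)) (\<Gamma> x t) t - P_gamma \<gamma> (\<lambda>\<xi>. complex_of_real (h \<xi>)) x 0) \<le> (1/2) ^ n"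
      if t: "t \<in> {0<..r}" for x t
    proof -
      have "cmod (P_gamma \<gamma> (\<lambda>\<xi>. complex_of_real (h \<xi>)) (\<Gamma> x t) t - P_gamma \<gamma> (\<lambda>\<xi>. complex_of_real (h \<xi>)) x 0)
        \<le> (\<bar>\<Gamma> x t - x\<bar> + t + t powr \<gamma>) * m"
        unfolding m_def using t by (intro P_gamma_close[OF g hm h0 h2]) auto
      also have "\<dots> \<le> (C3 * t powr \<alpha> + t + t powr \<gamma>) * m"
        using hol[of t 0 x] G0[of x] t r1 m0 by (intro mult_right_mono add_right_mono) auto
      also have "\<dots> \<le> (1/2) ^ n" using b(2)[of t] t r by auto
      finally show ?thesis .
    qed
    have "r powr \<gamma> > 0" using r by simp
    from packet_damping[OF this, of "(1/2) ^ n"] obtain A where A: "A > 0" and damp: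
      "\<And>X M. M > 0 \<Longrightarrow> (\<And>m. m < M \<Longrightarrow> A \<le> X m) \<Longrightarrow> (LINT \<xi>|lborel. exp (- (r powr \<gamma> * \<xi>\<^sup>2)) * packet X M \<xi>) \<le> (1/2) ^ n"
      by auto
    \<comment> \<open>Divides by the constant of \<open>packet_sobolev\<close>, so that the Sobolev
      integral comes out below \<open>(1/16) ^ n\<close>.\<close>
    define e where "e = (1/16) ^ n / (6 * sqrt (2 * pi))"
    have sq: "1 \<le> 6 * sqrt (2 * pi)"
    proof -
      have "1 \<le> sqrt (2 * pi)" using pi_ge_two by simp
      then show ?thesis by linarith
    qed
    have e: "e > 0" "6 * sqrt (2 * pi) * e = (1/16) ^ n" using sq by (auto simp: e_def)
    have e2: "e \<le> (1/16) ^ n"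
    proof -
      have "1 * e \<le> 6 * sqrt (2 * pi) * e" using sq e(1) by (intro mult_right_mono) auto
      then show ?thesis using e by simp
    qed
    obtain X M N T where XM: "0 < M" "1 \<le> N" "\<forall>m<M. A \<le> X m \<and> X m \<le> N"
      "energy X M \<le> e" "N powr (2 * s) * energy X M \<le> e" "0 < T" "T \<le> r"
      "\<forall>x\<in>{0..\<kappa>}. \<exists>t\<in>{T..r}. c \<le> cmod (P_gamma \<gamma> (\<lambda>\<xi>. complex_of_real (packet X M \<xi>)) (\<Gamma> x t) t)"
      using sup[unfolded packet_supply_def, rule_format, OF A e(1) r(1)] by (elim exE conjE) (rule that; assumption)
    have Xb: "\<bar>X m\<bar> \<le> N" if "m < M" for m
    proof -
      have "A \<le> X m" "X m \<le> N" using XM(3) that by auto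
      then show ?thesis using A by simp
    qed
    let ?z = "(\<lambda>\<xi>. h \<xi> + packet X M \<xi>, X, M, r, T)"
    have "P (Suc n) ?z"
    proof -
      have "integrable lborel (\<lambda>\<xi>. (1 + \<xi>\<^sup>2) * (h \<xi> + packet X M \<xi>))"
        unfolding distrib_left using h2 packet_moments(2) by (rule Bochner_Integration.integrable_add)
      moreover have "(\<lambda>\<xi>. h \<xi> + packet X M \<xi>) \<in> borel_measurable borel" by measurable
      ultimately show ?thesis using XM h0 packet_nonneg[of X M] by (simp add: P_def sel)
    qed
    moreover have "Q n z ?z"
    proof -
      have "(LINT \<xi>|lborel. (1 + \<xi>\<^sup>2) powr s * (packet X M \<xi>)\<^sup>2) \<le> 6 * sqrt (2 * pi) * (N powr (2 * s) * energy X M)"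
        by (rule packet_sobolev(2)[OF s XM(2) Xb])
      also have "\<dots> \<le> 6 * sqrt (2 * pi) * e" using XM(5) by (intro mult_left_mono) auto
      finally have w: "(LINT \<xi>|lborel. (1 + \<xi>\<^sup>2) powr s * (packet X M \<xi>)\<^sup>2) \<le> (1/16) ^ n" using e by simp
      have wi: "integrable lborel (\<lambda>\<xi>. (1 + \<xi>\<^sup>2) powr s * (packet X M \<xi>)\<^sup>2)"
        by (rule packet_sobolev(1)[OF s XM(2) Xb])
      have dm: "(LINT \<xi>|lborel. exp (- (r powr \<gamma> * \<xi>\<^sup>2)) * packet X M \<xi>) \<le> (1/2) ^ n"
        using XM by (intro damp) auto
      have en: "energy X M \<le> (1/16) ^ n" using XM(4) e2 by linarith
      show ?thesis unfolding Q_def sel h_def[symmetric]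
        by (intro conjI refl ballI XM r w wi dm en close XM(8)[rule_format])
    qed
    ultimately show "\<exists>y. P (Suc n) y \<and> Q n z y" by blast
  qed
  then obtain st where stP: "\<And>n. P n (st n)" and stQ: "\<And>n. Q n (st n) (st (Suc n))" by blast
  define X where "X n = xx (st (Suc n))" for n
  define M where "M n = mm (st (Suc n))" for n
  define r where "r n = rr (st (Suc n))" for n
  define T where "T n = tt (st (Suc n))" for n
  have H: "hh (st n) = (\<lambda>\<xi>. \<Sum>k<n. packet (X k) (M k) \<xi>)" for n
  proof (induction n)
    case 0 then show ?case using stP[of 0] by (simp add: P_def)
  next
    case (Suc n) then show ?case using stQ[of n] by (simp add: Q_def X_def M_def)
  qed
  note QQ = stQ[unfolded Q_def H, folded X_def M_def r_def T_def]
  have "r (Suc n) \<le> T n" for n using stQ[of "Suc n"] by (simp add: Q_def r_def T_def)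
  with QQ have "lacunary \<gamma> \<Gamma> s \<kappa> c X M r T" unfolding lacunary_def by blast
  then show ?thesis by (rule that)
qed

text \<open>The series is formed on the space side, where it converges in L1; its Fourier integral
  is then the pointwise series of packets. Square integrability, with and without the weight,
  follows from uniform bounds on partial sums by Fatou. The bound \<open>(1/4) ^ k\<close> holds
  because a packet is the transform of a function of that L1 norm.\<close>

lemma lacunary_sum_sobolev:
  fixes X :: "nat \<Rightarrow> nat \<Rightarrow> real" and M :: "nat \<Rightarrow> nat"
  assumes M: "\<And>n. 0 < M n" and en: "\<And>n. energy (X n) (M n) \<le> (1/16) ^ n"
    and wi: "\<And>n. integrable lborel (\<lambda>\<xi>. (1 + \<xi>\<^sup>2) powr s * (packet (X n) (M n) \<xi>)\<^sup>2)"
    and wb: "\<And>n. (LINT \<xi>|lborel. (1 + \<xi>\<^sup>2) powr s * (packet (X n) (M n) \<xi>)\<^sup>2) \<le> (1/16) ^ n"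
  defines "f \<equiv> \<lambda>x. \<Sum>k. packet_fun (X k) (M k) x"
  shows "sobolev_with_fourier s f (fourier_int f)"
    and "\<And>\<xi>. (\<lambda>k. complex_of_real (packet (X k) (M k) \<xi>)) sums fourier_int f \<xi>"
    and "\<And>k \<xi>. packet (X k) (M k) \<xi> \<le> (1/4) ^ k"
proof -
  define F where "F k = packet_fun (X k) (M k)" for k
  have [measurable]: "F k \<in> borel_measurable borel" for k unfolding F_def by measurable
  have fF: "f = (\<lambda>x. \<Sum>k. F k x)" by (simp add: f_def F_def)
  have [measurable]: "f \<in> borel_measurable borel" unfolding fF by measurable
  have sq: "((1/4::real) ^ k)\<^sup>2 = (1/16) ^ k" for k
    by (simp add: power2_eq_square power_mult_distrib[symmetric])
  have en': "energy (X k) (M k) \<le> ((1/4) ^ k)\<^sup>2" for k unfolding sq by (rule en)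
  have l: "(0::real) < (1/4) ^ k" for k by simp
  note nm = packet_fun_norms[OF M l en']
  have Fi: "integrable lborel (F k)" for k unfolding F_def by (rule packet_fun_fourier(1))
  have F1: "(LINT x|lborel. norm (F k x)) \<le> (1/4) ^ k" for k unfolding F_def by (rule nm(3))
  have sumF: "summable (\<lambda>k. LINT x|lborel. norm (F k x))"
  proof (rule summable_comparison_test_ev[OF _ summable_geometric[of "1/4::real"]], intro always_eventually allI)
    fix k
    have "0 \<le> (LINT x|lborel. norm (F k x))" by (rule Bochner_Integration.integral_nonneg) simp
    then show "norm (LINT x|lborel. norm (F k x)) \<le> (1/4) ^ k" using F1[of k] by simp
  qed simp
  have ae: "AE x in lborel. summable (\<lambda>k. norm (F k x))" by (rule AE_summable_norm[OF Fi sumF])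
  have f1: "integrable lborel f" unfolding fF by (rule integrable_suminf[OF Fi ae sumF])
  have f2: "integrable lborel (\<lambda>x. (cmod (f x))\<^sup>2)"
  proof (rule fatou_bound(1)[where f = "\<lambda>n x. (cmod (\<Sum>k<n. F k x))\<^sup>2" and C = 4])
    have i: "integrable lborel (\<lambda>x. 1 * (cmod (F k x))\<^sup>2)" "(LINT x|lborel. 1 * (cmod (F k x))\<^sup>2) \<le> (1/16) ^ k" for k
      using nm(1)[of k] nm(2)[of k] by (simp_all add: F_def sq)
    have "integrable lborel (\<lambda>x. 1 * (cmod (\<Sum>k<n. F k x))\<^sup>2)" "(LINT x|lborel. 1 * (cmod (\<Sum>k<n. F k x))\<^sup>2) \<le> 4" for n
      by (rule weighted_partial_sums[OF _ _ _ i]; measurable?; simp)+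
    then show "integrable lborel (\<lambda>x. (cmod (\<Sum>k<n. F k x))\<^sup>2)" "(LINT x|lborel. (cmod (\<Sum>k<n. F k x))\<^sup>2) \<le> 4" for n
      unfolding mult_1 by blast+
    show "AE x in lborel. (\<lambda>n. (cmod (\<Sum>k<n. F k x))\<^sup>2) \<longlonglongrightarrow> (cmod (f x))\<^sup>2"
      using ae unfolding fF
      by eventually_elim (rule tendsto_power, rule tendsto_norm, rule summable_LIMSEQ, rule summable_norm_cancel)
  qed auto
  have fk: "fourier_int (F k) \<xi> = complex_of_real (packet (X k) (M k) \<xi>)" for k \<xi>
    unfolding F_def by (rule packet_fun_fourier(2))
  show pb: "packet (X k) (M k) \<xi> \<le> (1/4) ^ k" for k \<xi>
  proof -
    have "packet (X k) (M k) \<xi> = cmod (fourier_int (F k) \<xi>)" unfolding fk using packet_nonneg by simp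
    also have "\<dots> \<le> (1/4) ^ k" by (rule order_trans[OF fourier_int_bound[OF Fi] F1])
    finally show ?thesis .
  qed
  show sm: "(\<lambda>k. complex_of_real (packet (X k) (M k) \<xi>)) sums fourier_int f \<xi>" for \<xi>
  proof -
    have eF: "integrable lborel (\<lambda>x. exp (- (\<i> * complex_of_real (x * \<xi>))) * F k x)" for k
      by (rule fourier_int_integrable[OF Fi])
    have ne: "norm (exp (- (\<i> * complex_of_real (x * \<xi>))) * F k x) = norm (F k x)" for k x by (simp add: norm_mult)
    have "fourier_int f \<xi> = (LINT x|lborel. (\<Sum>k. exp (- (\<i> * complex_of_real (x * \<xi>))) * F k x))"
      unfolding fourier_int_def
    proof (rule integral_cong_AE)
      show "AE x in lborel. exp (- (\<i> * complex_of_real (x * \<xi>))) * f x = (\<Sum>k. exp (- (\<i> * complex_of_real (x * \<xi>))) * F k x)"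
        using ae unfolding fF by eventually_elim (rule suminf_mult[symmetric], rule summable_norm_cancel)
    qed measurable
    moreover have "(\<lambda>k. LINT x|lborel. exp (- (\<i> * complex_of_real (x * \<xi>))) * F k x) sums (LINT x|lborel. (\<Sum>k. exp (- (\<i> * complex_of_real (x * \<xi>))) * F k x))"
      by (rule sums_integral[OF eF]) (simp_all only: ne ae sumF)
    ultimately show ?thesis by (simp add: fk[symmetric] fourier_int_def)
  qed
  have w: "integrable lborel (\<lambda>\<xi>. (1 + \<xi>\<^sup>2) powr s * (cmod (fourier_int f \<xi>))\<^sup>2)"
  proof (rule fatou_bound(1)[where f = "\<lambda>n \<xi>. (1 + \<xi>\<^sup>2) powr s * (cmod (\<Sum>k<n. complex_of_real (packet (X k) (M k) \<xi>)))\<^sup>2" and C = 4])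
    have i: "integrable lborel (\<lambda>\<xi>. (1 + \<xi>\<^sup>2) powr s * (cmod (complex_of_real (packet (X k) (M k) \<xi>)))\<^sup>2)"
      "(LINT \<xi>|lborel. (1 + \<xi>\<^sup>2) powr s * (cmod (complex_of_real (packet (X k) (M k) \<xi>)))\<^sup>2) \<le> (1/16) ^ k" for k
      using wi[of k] wb[of k] by simp_all
    show "integrable lborel (\<lambda>\<xi>. (1 + \<xi>\<^sup>2) powr s * (cmod (\<Sum>k<n. complex_of_real (packet (X k) (M k) \<xi>)))\<^sup>2)"
      "(LINT \<xi>|lborel. (1 + \<xi>\<^sup>2) powr s * (cmod (\<Sum>k<n. complex_of_real (packet (X k) (M k) \<xi>)))\<^sup>2) \<le> 4" for n
      by (rule weighted_partial_sums[OF _ _ _ i]; measurable?; simp)+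
    show "AE \<xi> in lborel. (\<lambda>n. (1 + \<xi>\<^sup>2) powr s * (cmod (\<Sum>k<n. complex_of_real (packet (X k) (M k) \<xi>)))\<^sup>2) \<longlonglongrightarrow> (1 + \<xi>\<^sup>2) powr s * (cmod (fourier_int f \<xi>))\<^sup>2"
      using sm by (intro AE_I2 tendsto_mult_left tendsto_power tendsto_norm) (simp add: sums_def)
  qed auto
  show "sobolev_with_fourier s f (fourier_int f)"
    unfolding sobolev_with_fourier_def using fourier_L2_fourier_int[OF f1 f2] w by simp
qed

text \<open>At each scale two times are compared: \<open>b n\<close>, where the packet
  \<open>n\<close> is large, and \<open>r n\<close>, where it is damped. Earlier packets contribute
  almost the same at both, later ones almost nothing. Thus at every point of
  \<open>{0..\<kappa>}\<close> the evolution oscillates by nearly \<open>c\<close> along times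
  tending to 0, which excludes any limit, not only \<open>f\<close>.\<close>

lemma divergence_of_packets:
  assumes g: "\<gamma> > 0" and a: "\<alpha> > 0" and s: "0 \<le> s" "s \<le> 1"
    and \<Gamma>: "admissible_curve \<alpha> \<Gamma>" and sup: "packet_supply \<gamma> \<Gamma> s \<kappa> c" and k0: "\<kappa> > 0" and c: "c > 0"
  shows "\<exists>f g. sobolev_with_fourier s f g \<and> \<not> conv_ae \<gamma> \<Gamma> f g"
proof -
  obtain X M r T where lac: "lacunary \<gamma> \<Gamma> s \<kappa> c X M r T"
    by (rule lacunary_packets[OF g a s \<Gamma> sup])
  note lac = lac[unfolded lacunary_def, rule_format]
  have M: "\<And>n. 0 < M n" and T0: "\<And>n. 0 < T n" and Tr: "\<And>n. T n \<le> r n" and rT: "\<And>n. r (Suc n) \<le> T n"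
    and rn: "\<And>n. r n \<le> 1 / real (Suc n)"
    and close: "\<And>n x t. x \<in> {0..\<kappa>} \<Longrightarrow> t \<in> {0<..r n} \<Longrightarrow>
       cmod (P_gamma \<gamma> (\<lambda>\<xi>. complex_of_real (\<Sum>k<n. packet (X k) (M k) \<xi>)) (\<Gamma> x t) t - P_gamma \<gamma> (\<lambda>\<xi>. complex_of_real (\<Sum>k<n. packet (X k) (M k) \<xi>)) x 0) \<le> (1/2) ^ n"
    and damp: "\<And>n. (LINT \<xi>|lborel. exp (- (r n powr \<gamma> * \<xi>\<^sup>2)) * packet (X n) (M n) \<xi>) \<le> (1/2) ^ n"
    and en: "\<And>n. energy (X n) (M n) \<le> (1/16) ^ n"
    and wi: "\<And>n. integrable lborel (\<lambda>\<xi>. (1 + \<xi>\<^sup>2) powr s * (packet (X n) (M n) \<xi>)\<^sup>2)"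
    and wb: "\<And>n. (LINT \<xi>|lborel. (1 + \<xi>\<^sup>2) powr s * (packet (X n) (M n) \<xi>)\<^sup>2) \<le> (1/16) ^ n"
    and big: "\<And>n x. x \<in> {0..\<kappa>} \<Longrightarrow> \<exists>t\<in>{T n..r n}. c \<le> cmod (P_gamma \<gamma> (\<lambda>\<xi>. complex_of_real (packet (X n) (M n) \<xi>)) (\<Gamma> x t) t)"
    using lac by blast+
  define f where "f x = (\<Sum>k. packet_fun (X k) (M k) x)" for x
  define G where "G = fourier_int f"
  note sob = lacunary_sum_sobolev[OF M en wi wb, folded f_def[abs_def], folded G_def]
  define q where "q k = (\<lambda>\<xi>. complex_of_real (packet (X k) (M k) \<xi>))" for k
  define p where "p k y t = P_gamma \<gamma> (q k) y t" for k y t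
  define S where "S n y t = (\<Sum>k<n. p k y t)" for n y t
  have qi: "integrable lborel (q k)" for k unfolding q_def using packet_moments(1)[of "X k" "M k"] by simp
  have wq: "integrable lborel (\<lambda>\<xi>. wave \<gamma> 0 y t \<xi> * q k \<xi>)" for k y t
    by (rule Bochner_Integration.integrable_bound[OF qi[of k]])
       (auto simp: q_def norm_mult cmod_wave intro!: AE_I2 mult_left_le_one_le)
  have SP: "P_gamma \<gamma> (\<lambda>\<xi>. complex_of_real (\<Sum>k<n. packet (X k) (M k) \<xi>)) y t = S n y t" for n y t
  proof -
    have "(LINT \<xi>|lborel. wave \<gamma> 0 y t \<xi> * complex_of_real (\<Sum>k<n. packet (X k) (M k) \<xi>)) = (\<Sum>k<n. LINT \<xi>|lborel. wave \<gamma> 0 y t \<xi> * q k \<xi>)"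
    proof -
      have "wave \<gamma> 0 y t \<xi> * complex_of_real (\<Sum>k<n. packet (X k) (M k) \<xi>) = (\<Sum>k<n. wave \<gamma> 0 y t \<xi> * q k \<xi>)" for \<xi>
        by (simp add: q_def sum_distrib_left)
      then show ?thesis by (simp only: Bochner_Integration.integral_sum[OF wq])
    qed
    then show ?thesis by (simp add: S_def p_def P_gamma_wave sum_distrib_left)
  qed
  have rpos: "r n > 0" for n using T0[of n] Tr[of n] by linarith
  have rmono: "r k \<le> r n" if "n \<le> k" for n k
    using that
  proof (induction rule: dec_induct)
    case (step m) then show ?case using rT[of m] Tr[of m] by linarith
  qed simp
  have pk: "cmod (p k y t) \<le> (1/2) ^ k" and dk: "(LINT \<xi>|lborel. norm (wave \<gamma> 0 y t \<xi> * q k \<xi>)) \<le> (1/2) ^ k"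
    if "r k \<le> t" for k y t
  proof -
    show "cmod (p k y t) \<le> (1/2) ^ k"
      unfolding p_def q_def
      by (rule order_trans[OF P_gamma_norm_le[OF _ packet_nonneg packet_moments(1) rpos that g] damp]) measurable
    have "(LINT \<xi>|lborel. norm (wave \<gamma> 0 y t \<xi> * q k \<xi>)) \<le> (LINT \<xi>|lborel. exp (- (r k powr \<gamma> * \<xi>\<^sup>2)) * packet (X k) (M k) \<xi>)"
    proof (rule integral_mono[OF integrable_norm[OF wq]])
      show "integrable lborel (\<lambda>\<xi>. exp (- (r k powr \<gamma> * \<xi>\<^sup>2)) * packet (X k) (M k) \<xi>)"
        by (rule Bochner_Integration.integrable_bound[OF packet_moments(1)[of "X k" "M k"]])
           (auto simp: packet_nonneg intro!: AE_I2 mult_left_le_one_le)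
      fix \<xi>
      have "r k powr \<gamma> * \<xi>\<^sup>2 \<le> t powr \<gamma> * \<xi>\<^sup>2" using that rpos[of k] g by (intro mult_right_mono powr_mono2) auto
      then show "norm (wave \<gamma> 0 y t \<xi> * q k \<xi>) \<le> exp (- (r k powr \<gamma> * \<xi>\<^sup>2)) * packet (X k) (M k) \<xi>"
        using packet_nonneg[of "X k" "M k" \<xi>] by (auto simp: q_def norm_mult cmod_wave intro!: mult_right_mono)
    qed
    also note damp
    finally show "(LINT \<xi>|lborel. norm (wave \<gamma> 0 y t \<xi> * q k \<xi>)) \<le> (1/2) ^ k" .
  qed
  \<comment> \<open>At a fixed time that exceeds some \<open>r n\<close>, the packets from index
    \<open>n\<close> on are damped geometrically, so the series may be integrated term by
    term.\<close>
  have psums: "(\<lambda>k. p k y t) sums P_gamma \<gamma> G y t" if t: "r n \<le> t" for n y t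
  proof -
    have "(\<lambda>k. LINT \<xi>|lborel. wave \<gamma> 0 y t \<xi> * q k \<xi>) sums (LINT \<xi>|lborel. (\<Sum>k. wave \<gamma> 0 y t \<xi> * q k \<xi>))"
    proof (rule sums_integral[OF wq])
      show "AE \<xi> in lborel. summable (\<lambda>k. norm (wave \<gamma> 0 y t \<xi> * q k \<xi>))"
      proof (rule AE_I2, rule summable_comparison_test_ev[OF _ summable_geometric[of "1/4::real"]], intro always_eventually allI)
        fix \<xi> k
        have "norm (wave \<gamma> 0 y t \<xi> * q k \<xi>) \<le> 1 * packet (X k) (M k) \<xi>"
          unfolding norm_mult by (intro mult_mono) (auto simp: cmod_wave q_def packet_nonneg)
        also have "\<dots> \<le> (1/4) ^ k" using sob(3) by simp
        finally show "norm (norm (wave \<gamma> 0 y t \<xi> * q k \<xi>)) \<le> (1/4) ^ k" by simp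
      qed simp
      show "summable (\<lambda>k. LINT \<xi>|lborel. norm (wave \<gamma> 0 y t \<xi> * q k \<xi>))"
      proof (rule summable_comparison_test_ev[OF _ summable_geometric[of "1/2::real"]])
        show "\<forall>\<^sub>F k in sequentially. norm (LINT \<xi>|lborel. norm (wave \<gamma> 0 y t \<xi> * q k \<xi>)) \<le> (1/2) ^ k"
          using eventually_ge_at_top[of n]
        proof eventually_elim
          case (elim k)
          have "0 \<le> (LINT \<xi>|lborel. norm (wave \<gamma> 0 y t \<xi> * q k \<xi>))"
            by (rule Bochner_Integration.integral_nonneg) simp
          then show ?case using dk[of k t y] rmono[OF elim] t by simp
        qed
      qed simp
    qed
    moreover have "(\<Sum>k. wave \<gamma> 0 y t \<xi> * q k \<xi>) = wave \<gamma> 0 y t \<xi> * G \<xi>" for \<xi>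
      using sums_mult[OF sob(2)[of \<xi>], of "wave \<gamma> 0 y t \<xi>"] unfolding q_def by (rule sums_unique[symmetric])
    ultimately have "(\<lambda>k. LINT \<xi>|lborel. wave \<gamma> 0 y t \<xi> * q k \<xi>) sums (LINT \<xi>|lborel. wave \<gamma> 0 y t \<xi> * G \<xi>)" by simp
    then show ?thesis unfolding p_def P_gamma_wave by (rule sums_mult)
  qed
  have tail: "cmod (P_gamma \<gamma> G y t - S n y t) \<le> 2 * (1/2) ^ n" if t: "r n \<le> t" for n y t
  proof -
    have pn: "norm (p (k + n) y t) \<le> (1/2) ^ (k + n)" for k
      using t rmono[of n "k + n"] by (intro pk) simp
    have gs: "(\<lambda>k. (1/2::real) ^ (k + n)) sums (2 * (1/2) ^ n)"
      using sums_mult2[OF geometric_sums[of "1/2::real"], of "(1/2) ^ n"] by (simp add: power_add)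
    have "(\<lambda>k. p (k + n) y t) sums (P_gamma \<gamma> G y t - S n y t)"
      unfolding S_def by (rule sums_split_initial_segment[OF psums[OF t]])
    then have "P_gamma \<gamma> G y t - S n y t = (\<Sum>k. p (k + n) y t)" by (rule sums_unique)
    also have "cmod \<dots> \<le> (\<Sum>k. (1/2) ^ (k + n))"
      using pn sums_summable[OF gs] by (rule norm_suminf_le)
    also have "\<dots> = 2 * (1/2) ^ n" using gs by (rule sums_unique[symmetric])
    finally show ?thesis .
  qed
  have nolim: "\<not> ((\<lambda>t. P_gamma \<gamma> G (\<Gamma> x t) t) \<longlongrightarrow> L) (at_right 0)" if x: "x \<in> {0..\<kappa>}" for x L
  proof
    assume lim: "((\<lambda>t. P_gamma \<gamma> G (\<Gamma> x t) t) \<longlongrightarrow> L) (at_right 0)"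
    obtain b where b: "\<And>n. b n \<in> {T n..r n}" and bc: "\<And>n. c \<le> cmod (p n (\<Gamma> x (b n)) (b n))"
      using big[OF x] unfolding p_def q_def by metis
    have seq: "(\<lambda>n. P_gamma \<gamma> G (\<Gamma> x (z n)) (z n)) \<longlonglongrightarrow> L" if z: "\<And>n. 0 < z n" "\<And>n. z n \<le> r n" for z
    proof (rule filterlim_compose[OF lim])
      have "z \<longlonglongrightarrow> 0"
      proof (rule tendsto_sandwich[OF _ _ tendsto_const LIMSEQ_Suc[OF lim_1_over_n]])
        show "\<forall>\<^sub>F n in sequentially. 0 \<le> z n" using z(1) by (auto intro!: always_eventually less_imp_le)
        show "\<forall>\<^sub>F n in sequentially. z n \<le> 1 / real (Suc n)" using order_trans[OF z(2) rn] by (auto intro!: always_eventually)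
      qed
      moreover have "z n \<in> {0<..} \<and> z n \<noteq> 0" for n using z(1)[of n] by simp
      ultimately show "filterlim z (at_right 0) sequentially"
        unfolding filterlim_at by (simp only: eventually_True simp_thms)
    qed
    have bpos: "0 < b n" "b n \<le> r n" for n using b[of n] T0[of n] by auto
    have "(\<lambda>n. P_gamma \<gamma> G (\<Gamma> x (b n)) (b n) - P_gamma \<gamma> G (\<Gamma> x (r n)) (r n)) \<longlonglongrightarrow> L - L"
      by (intro tendsto_diff seq bpos rpos order_refl)
    then have D: "(\<lambda>n. cmod (P_gamma \<gamma> G (\<Gamma> x (b n)) (b n) - P_gamma \<gamma> G (\<Gamma> x (r n)) (r n))) \<longlonglongrightarrow> 0"
      by (simp add: tendsto_norm_zero)
    \<comment> \<open>The 5 counts errors in units of \<open>(1/2) ^ n\<close>: two from the tail at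
      \<open>r n\<close>, one from the tail after the packet \<open>n\<close> at \<open>b n\<close>,
      and one at each time from the earlier packets.\<close>
    have low: "c - 5 * (1/2) ^ n \<le> cmod (P_gamma \<gamma> G (\<Gamma> x (b n)) (b n) - P_gamma \<gamma> G (\<Gamma> x (r n)) (r n))" for n
    proof -
      let ?A = "P_gamma \<gamma> G (\<Gamma> x (r n)) (r n)" and ?B = "P_gamma \<gamma> G (\<Gamma> x (b n)) (b n)"
      let ?SA = "S n (\<Gamma> x (r n)) (r n)" and ?SB = "S n (\<Gamma> x (b n)) (b n)" and ?S0 = "S n x 0" and ?p = "p n (\<Gamma> x (b n)) (b n)"
      have 1: "cmod (?A - ?SA) \<le> 2 * (1/2) ^ n" by (rule tail) simp
      have 2: "cmod (?SA - ?S0) \<le> (1/2) ^ n" "cmod (?SB - ?S0) \<le> (1/2) ^ n"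
        using close[OF x, of "r n" n, unfolded SP] close[OF x, of "b n" n, unfolded SP] rpos bpos by simp_all
      have "r (Suc n) \<le> b n" using rT[of n] b[of n] by simp
      from tail[OF this, of "\<Gamma> x (b n)"] have 3: "cmod (?B - (?SB + ?p)) \<le> (1/2) ^ n" by (simp add: S_def)
      have "?p = (?B - ?A) - (?B - (?SB + ?p)) + (?A - ?SA) + (?SA - ?S0) - (?SB - ?S0)" by simp
      then have "cmod ?p \<le> cmod (?B - ?A) + cmod (?B - (?SB + ?p)) + cmod (?A - ?SA) + cmod (?SA - ?S0) + cmod (?SB - ?S0)"
        by (smt (verit) norm_triangle_ineq norm_triangle_ineq4)
      then show ?thesis using 1 2 3 bc[of n] by linarith
    qed
    have "(\<lambda>n. c - 5 * (1/2::real) ^ n) \<longlonglongrightarrow> c - 5 * 0"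
      by (intro tendsto_intros LIMSEQ_realpow_zero) auto
    then have "c - 5 * 0 \<le> 0" by (rule LIMSEQ_le[OF _ D]) (use low in blast)
    then show False using c by simp
  qed
  have "\<not> conv_ae \<gamma> \<Gamma> f G"
  proof
    assume "conv_ae \<gamma> \<Gamma> f G"
    then have "AE x in lborel. x \<notin> {0..\<kappa>}"
      unfolding conv_ae_def by eventually_elim (use nolim in blast)
    then have "emeasure lborel {0..\<kappa>} = 0"
      by (subst (asm) AE_iff_measurable[of "{0..\<kappa>}"]) auto
    then show False using k0 by simp
  qed
  then show ?thesis using sob(1) by blast
qed

section \<open>Packets in phase\<close>

text \<open>At offset \<open>\<eta>\<close> from its centre, each bump agrees with the common phase
  \<Theta> modulo \<open>2 * pi\<close> up to \<open>1/4 * (1 + \<eta>\<^sup>2)\<close>, damping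
  included. The Gaussian has equal mass and second moment, so the total error is half the mass
  \<open>sqrt (2 * pi)\<close>, and half remains.\<close>

lemma packet_lower_bound:
  fixes \<gamma> y t \<Theta> :: real
  assumes M: "M > 0" and t: "t \<ge> 0"
    and ph: "\<And>m \<eta>. m < M \<Longrightarrow> \<bar>y * (X m + \<eta>) + t * (X m + \<eta>)\<^sup>2 - (\<Theta> + 2 * pi * of_int (k m))\<bar> + t powr \<gamma> * (X m + \<eta>)\<^sup>2 \<le> 1/4 * (1 + \<eta>\<^sup>2)"
  shows "sqrt (2 * pi) / (4 * pi) \<le> cmod (P_gamma \<gamma> (\<lambda>\<xi>. complex_of_real (packet X M \<xi>)) y t)"
proof -
  define r where "r = sqrt (2 * pi)"
  have r: "r > 0" by (simp add: r_def)
  define G :: "real \<Rightarrow> real" where "G \<eta> = exp (- (1/2 * \<eta>\<^sup>2))" for \<eta>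
  have G1: "has_bochner_integral lborel G r"
    using gaussian_has_integral[of "1/2" 0] by (simp add: G_def[abs_def] r_def mult.commute)
  have "has_bochner_integral lborel (\<lambda>x. r * (std_normal_density x * x ^ (2 * 1))) (r * (fact (2 * 1) / (2 ^ 1 * fact 1)))"
    by (intro has_bochner_integral_mult_right std_normal_moment_even)
  moreover have "r * (std_normal_density x * x ^ (2 * 1)) = x\<^sup>2 * G x" for x
    using r by (simp add: std_normal_density_def G_def r_def)
  ultimately have "has_bochner_integral lborel (\<lambda>x. x\<^sup>2 * G x) (r * (fact (2 * 1) / (2 ^ 1 * fact 1)))" by (simp only:)
  moreover have "r * (fact (2 * 1) / (2 ^ 1 * fact 1)) = r" by simp
  ultimately have G2: "has_bochner_integral lborel (\<lambda>x. x\<^sup>2 * G x) r" by (simp only:)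
  have "has_bochner_integral lborel (\<lambda>\<eta>. 1/4 * (G \<eta> + \<eta>\<^sup>2 * G \<eta>)) (1/4 * (r + r))"
    by (intro has_bochner_integral_mult_right has_bochner_integral_add G1 G2)
  then have G3: "has_bochner_integral lborel (\<lambda>\<eta>. 1/4 * (1 + \<eta>\<^sup>2) * G \<eta>) (r / 2)" by (simp add: algebra_simps)
  have sh: "has_bochner_integral lborel (\<lambda>\<xi>. f (\<xi> - a)) v" if "has_bochner_integral lborel f v" for f :: "real \<Rightarrow> real" and a v
    using lborel_has_bochner_integral_real_affine_iff[of 1 f v "- a"] that by simp
  have "has_bochner_integral lborel (\<lambda>\<xi>. (\<Sum>m<M. G (\<xi> - X m)) / real M) ((\<Sum>m<M. r) / real M)"
    by (intro has_bochner_integral_divide has_bochner_integral_sum sh G1)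
  moreover have "(\<lambda>\<xi>. (\<Sum>m<M. G (\<xi> - X m)) / real M) = packet X M" by (simp add: packet_def[abs_def] G_def)
  ultimately have pI: "has_bochner_integral lborel (packet X M) r" using M by simp
  define B where "B \<xi> = (\<Sum>m<M. 1/4 * (1 + (\<xi> - X m)\<^sup>2) * G (\<xi> - X m)) / real M" for \<xi>
  have "has_bochner_integral lborel B ((\<Sum>m<M. r / 2) / real M)"
    unfolding B_def by (intro has_bochner_integral_divide has_bochner_integral_sum sh[OF G3])
  then have BI: "has_bochner_integral lborel B (r / 2)" using M by simp
  define E where "E = exp (\<i> * complex_of_real \<Theta>)"
  have pt: "cmod (wave \<gamma> 0 y t \<xi> * complex_of_real (packet X M \<xi>) - E * complex_of_real (packet X M \<xi>)) \<le> B \<xi>" for \<xi>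
  proof -
    have w: "cmod (wave \<gamma> 0 y t \<xi> - E) \<le> 1/4 * (1 + (\<xi> - X m)\<^sup>2)" if "m < M" for m
    proof -
      have "exp (\<i> * complex_of_real (\<Theta> + 2 * pi * of_int (k m))) = E * exp (\<i> * (of_int (k m) * (of_real pi * 2)))"
        unfolding E_def by (simp add: exp_add[symmetric] algebra_simps)
      then have "exp (\<i> * complex_of_real (\<Theta> + 2 * pi * of_int (k m))) = E"
        by (simp add: exp_integer_2pi mult.commute)
      then have "cmod (wave \<gamma> 0 y t \<xi> - E) \<le> \<bar>y * \<xi> + t * \<xi>\<^sup>2 - (\<Theta> + 2 * pi * of_int (k m))\<bar> + t powr \<gamma> * \<xi>\<^sup>2"
        using wave_diff_le[OF t, of \<gamma> y \<xi> "\<Theta> + 2 * pi * of_int (k m)"] by simp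
      also have "\<dots> \<le> 1/4 * (1 + (\<xi> - X m)\<^sup>2)" using ph[OF that, of "\<xi> - X m"] by simp
      finally show ?thesis .
    qed
    have "cmod (wave \<gamma> 0 y t \<xi> * complex_of_real (packet X M \<xi>) - E * complex_of_real (packet X M \<xi>)) = cmod (wave \<gamma> 0 y t \<xi> - E) * packet X M \<xi>"
      by (simp add: left_diff_distrib[symmetric] norm_mult packet_nonneg)
    also have "\<dots> = (\<Sum>m<M. cmod (wave \<gamma> 0 y t \<xi> - E) * G (\<xi> - X m)) / real M"
      by (simp add: packet_def G_def sum_distrib_left)
    also have "\<dots> \<le> B \<xi>" unfolding B_def
      using w by (intro divide_right_mono sum_mono mult_right_mono) (auto simp: G_def)
    finally show ?thesis .
  qed
  have pi1: "integrable lborel (packet X M)" "(LINT \<xi>|lborel. packet X M \<xi>) = r" using pI by (simp_all only: has_bochner_integral_iff)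
  have wi: "integrable lborel (\<lambda>\<xi>. wave \<gamma> 0 y t \<xi> * complex_of_real (packet X M \<xi>))"
    by (rule Bochner_Integration.integrable_bound[OF pi1(1)])
       (auto simp: norm_mult cmod_wave intro!: AE_I2 mult_left_le_one_le)
  have ei: "integrable lborel (\<lambda>\<xi>. E * complex_of_real (packet X M \<xi>))" using pi1 by simp
  define W where "W = (LINT \<xi>|lborel. wave \<gamma> 0 y t \<xi> * complex_of_real (packet X M \<xi>))"
  have "(LINT \<xi>|lborel. wave \<gamma> 0 y t \<xi> * complex_of_real (packet X M \<xi>) - E * complex_of_real (packet X M \<xi>)) = W - E * complex_of_real r"
    unfolding W_def by (subst Bochner_Integration.integral_diff[OF wi ei]) (simp add: pi1)
  then have "cmod (W - E * complex_of_real r) \<le> (LINT \<xi>|lborel. norm (wave \<gamma> 0 y t \<xi> * complex_of_real (packet X M \<xi>) - E * complex_of_real (packet X M \<xi>)))"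
    by (metis integral_norm_bound)
  also have "\<dots> \<le> (LINT \<xi>|lborel. B \<xi>)"
    using BI by (intro integral_mono integrable_norm Bochner_Integration.integrable_diff wi ei pt) (simp add: has_bochner_integral_iff)
  also have "\<dots> = r / 2" using BI by (simp only: has_bochner_integral_iff)
  finally have d: "cmod (W - E * complex_of_real r) \<le> r / 2" .
  have "cmod (E * complex_of_real r) = r" using r by (simp add: E_def norm_mult)
  then have "r / 2 \<le> cmod W" using d norm_triangle_ineq2[of "E * complex_of_real r" W] by (simp add: norm_minus_commute)
  then have "r / 2 / (2 * pi) \<le> cmod W / (2 * pi)" by (intro divide_right_mono) auto
  moreover have "cmod (P_gamma \<gamma> (\<lambda>\<xi>. complex_of_real (packet X M \<xi>)) y t) = cmod W / (2 * pi)"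
    by (simp add: P_gamma_wave W_def norm_mult norm_divide)
  ultimately show ?thesis by (simp add: r_def)
qed

lemma powr_scale_tendsto_zero: "c > 0 \<Longrightarrow> ((\<lambda>N::real. N powr (- c)) \<longlongrightarrow> 0) at_top"
  by (rule tendsto_neg_powr) (auto simp: filterlim_ident)

text \<open>The number of bumps will be about \<open>\<delta> * N powr p\<close> and the times about
  \<open>N powr (- q)\<close>. The assumption \<open>2 * s < p\<close> makes the Sobolev cost per
  packet arbitrarily small; this is where \<open>s < s_crit \<alpha> \<gamma>\<close> takes effect,
  \<open>p\<close> being twice the critical exponent.\<close>

lemma choose_scale:
  fixes A r \<epsilon> \<delta> p q s :: real
  assumes "r > 0" "\<epsilon> > 0" "\<delta> > 0" and pq: "p > 0" "q > 0" "2 * s < p"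
  obtains N where "1 \<le> N" "A \<le> N" "N powr (- q) \<le> r" "max 1 A \<le> \<delta> * N powr p / 2" "N powr (2 * s) / (\<delta> * N powr p) \<le> \<epsilon>"
proof -
  have 1: "\<forall>\<^sub>F N in at_top. N powr (- q) < r"
    using order_tendstoD(2)[OF powr_scale_tendsto_zero[OF pq(2)]] assms by blast
  have 2: "\<forall>\<^sub>F N in at_top. N powr (- p) < \<delta> / (2 * max 1 A)"
    using order_tendstoD(2)[OF powr_scale_tendsto_zero[OF pq(1)], of "\<delta> / (2 * max 1 A)"] assms by simp
  have 3: "\<forall>\<^sub>F N in at_top. N powr (- (p - 2 * s)) < \<epsilon> * \<delta>"
    using order_tendstoD(2)[OF powr_scale_tendsto_zero[of "p - 2 * s"], of "\<epsilon> * \<delta>"] assms by simp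
  have ev: "\<forall>\<^sub>F N in at_top. N powr (- q) < r \<and> N powr (- p) < \<delta> / (2 * max 1 A) \<and> N powr (- (p - 2 * s)) < \<epsilon> * \<delta> \<and> max 1 A \<le> N"
    using 1 2 3 eventually_ge_at_top by (intro eventually_conj)
  obtain N where N: "N powr (- q) < r" "N powr (- p) < \<delta> / (2 * max 1 A)" "N powr (- (p - 2 * s)) < \<epsilon> * \<delta>" "max 1 A \<le> N"
    using eventually_happens[OF ev] by auto
  have N0: "N > 0" using N(4) by simp
  show ?thesis
  proof (rule that[of N])
    have "1 / N powr p < \<delta> / (2 * max 1 A)" using N(2) N0 by (simp add: powr_minus_divide)
    then have "2 * max 1 A < \<delta> * N powr p" using N0 by (simp add: field_simps split: if_splits)
    then show "max 1 A \<le> \<delta> * N powr p / 2" by simp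
    have "N powr (2 * s) / N powr p < \<epsilon> * \<delta>" using N(3) N0 by (simp add: powr_diff powr_minus_divide)
    then show "N powr (2 * s) / (\<delta> * N powr p) \<le> \<epsilon>" using assms N0 by (simp add: field_simps)
  qed (use N in auto)
qed

text \<open>For an arithmetic progression with step \<open>d \<ge> 2\<close> the energy is at most
  \<open>4 / M\<close> by \<open>energy_separated\<close>. As \<open>N \<ge> 1\<close> and
  \<open>s \<ge> 0\<close>, smallness of the weighted energy implies that of the plain one.\<close>

lemma packet_supplyI:
  assumes s: "s \<ge> 0"
    and ex: "\<And>A \<epsilon> r. A > 0 \<Longrightarrow> \<epsilon> > 0 \<Longrightarrow> r > 0 \<Longrightarrow> \<exists>d B M N T. 2 \<le> d \<and> 0 < M \<and> 1 \<le> N \<and> A \<le> B \<and> B + d * real M \<le> N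
     \<and> N powr (2 * s) * (4 / real M) \<le> \<epsilon> \<and> 0 < T \<and> T \<le> r
     \<and> (\<forall>x\<in>{0..\<kappa>}. \<exists>t\<in>{T..r}. c \<le> cmod (P_gamma \<gamma> (\<lambda>\<xi>. complex_of_real (packet (\<lambda>m. B + d * real m) M \<xi>)) (\<Gamma> x t) t))"
  shows "packet_supply \<gamma> \<Gamma> s \<kappa> c"
  unfolding packet_supply_def
proof (intro allI impI)
  fix A \<epsilon> r :: real assume pos: "A > 0" "\<epsilon> > 0" "r > 0"
  obtain d B M N T where d: "2 \<le> d" and M: "0 < M" and N: "1 \<le> N" and AB: "A \<le> B" and BN: "B + d * real M \<le> N"
    and en: "N powr (2 * s) * (4 / real M) \<le> \<epsilon>" and T: "0 < T" "T \<le> r"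
    and big: "\<forall>x\<in>{0..\<kappa>}. \<exists>t\<in>{T..r}. c \<le> cmod (P_gamma \<gamma> (\<lambda>\<xi>. complex_of_real (packet (\<lambda>m. B + d * real m) M \<xi>)) (\<Gamma> x t) t)"
    using ex[OF pos] by (elim exE conjE) (rule that; assumption)
  define X where "X m = B + d * real m" for m
  have e1: "energy X M \<le> 4 / real M"
  proof (rule energy_separated[OF M])
    fix m n
    have "X m - X n = d * (real m - real n)" by (simp add: X_def algebra_simps)
    then have "\<bar>X m - X n\<bar> = d * \<bar>real m - real n\<bar>" using d by (simp add: abs_mult)
    then show "2 * \<bar>real m - real n\<bar> \<le> \<bar>X m - X n\<bar>" using d by (simp add: mult_right_mono)
  qed
  have N1: "1 \<le> N powr (2 * s)" using N s by (simp add: ge_one_powr_ge_zero)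
  have e2: "N powr (2 * s) * energy X M \<le> \<epsilon>"
    by (rule order_trans[OF mult_left_mono[OF e1] en]) simp
  have "1 * energy X M \<le> N powr (2 * s) * energy X M" using N1 energy_nonneg by (intro mult_right_mono) auto
  then have e3: "energy X M \<le> \<epsilon>" using e2 by simp
  have fr: "\<forall>m<M. A \<le> X m \<and> X m \<le> N"
  proof (intro allI impI conjI)
    fix m assume "m < M"
    then have "0 \<le> d * real m" "d * real m \<le> d * real M" using d by (auto intro: mult_left_mono)
    then show "A \<le> X m" "X m \<le> N" using AB BN by (auto simp: X_def)
  qed
  show "\<exists>X M N T. 0 < M \<and> 1 \<le> N \<and> (\<forall>m<M. A \<le> X m \<and> X m \<le> N) \<and> energy X M \<le> \<epsilon> \<and> N powr (2 * s) * energy X M \<le> \<epsilon> \<and> 0 < T \<and> T \<le> r \<and>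
    (\<forall>x\<in>{0..\<kappa>}. \<exists>t\<in>{T..r}. c \<le> cmod (P_gamma \<gamma> (\<lambda>\<xi>. complex_of_real (packet X M \<xi>)) (\<Gamma> x t) t))"
    by (rule exI[of _ X], rule exI[of _ M], rule exI[of _ N], rule exI[of _ T], intro conjI M N fr e3 e2 T big[folded X_def[abs_def]])
qed


section \<open>Phase agreement on the vertical line and on the Hoelder curve\<close>

lemma floor_half:
  fixes z :: real
  assumes "1 \<le> z"
  shows "z / 2 \<le> real (nat \<lfloor>z\<rfloor>)" and "real (nat \<lfloor>z\<rfloor>) \<le> z" and "0 < nat \<lfloor>z\<rfloor>"
proof -
  have f: "1 \<le> \<lfloor>z\<rfloor>" using assms by simp
  then have r: "real (nat \<lfloor>z\<rfloor>) = of_int \<lfloor>z\<rfloor>" by simp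
  have "(1::real) \<le> of_int \<lfloor>z\<rfloor>" using f by (metis of_int_1 of_int_le_iff)
  then show "z / 2 \<le> real (nat \<lfloor>z\<rfloor>)" unfolding r using real_of_int_floor_add_one_gt[of z] by linarith
  show "real (nat \<lfloor>z\<rfloor>) \<le> z" unfolding r by simp
  show "0 < nat \<lfloor>z\<rfloor>" using f by simp
qed

text \<open>The wave packets travel along the direction \<open>x + 2 t N = const\<close>, and refocus at the
  points of \<open>L \<int>\<close>, where all frequencies \<open>N + 2 \<pi> m / L\<close> are in phase.\<close>
lemma packet_supply_vertical:
  fixes \<gamma> s :: real
  assumes g: "\<gamma> > 1" and s: "0 \<le> s" "2 * s < 1 - 1 / min \<gamma> 2"
  shows "packet_supply \<gamma> (\<lambda>x t. x) s (1/10) (sqrt (2 * pi) / (4 * pi))"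
proof (rule packet_supplyI[OF s(1)])
  fix A \<epsilon> r :: real assume pos: "A > 0" "\<epsilon> > 0" "r > 0"
  \<comment> \<open>Above 2 a larger \<gamma> brings no gain: the spacing \<open>L\<close>, of order
    \<open>N powr (1 - 2 / g')\<close>, must stay bounded, which requires
    \<open>g' \<le> 2\<close>.\<close>
  define g' where "g' = min \<gamma> 2"
  define p where "p = 1 - 1 / g'"
  have g': "1 < g'" "g' \<le> 2" "g' \<le> \<gamma>" using g by (auto simp: g'_def)
  have p: "p > 0" "2 * s < p" using g' s by (auto simp: p_def g'_def)
  \<comment> \<open>Normalised so that the bandwidth \<open>d * z\<close> is exactly
    \<open>N powr (1 / g')\<close>.\<close>
  define \<delta> where "\<delta> = 1 / (200 * pi)"
  have dl: "\<delta> > 0" by (simp add: \<delta>_def)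
  have q: "2 / g' > 0" using g' by simp
  have sg: "2 powr (2 * s) > 0" by simp
  obtain N where N: "1 \<le> N" "A \<le> N" "N powr (- (2 / g')) \<le> r" "max 1 A \<le> \<delta> * N powr p / 2"
    and Ne: "N powr (2 * s) / (\<delta> * N powr p) \<le> \<epsilon> / (8 * 2 powr (2 * s))"
    by (rule choose_scale[OF pos(3) _ dl p(1) q p(2), of "\<epsilon> / (8 * 2 powr (2 * s))" A]) (use pos in auto)
  have N0: "N > 0" using N by simp
  define z where "z = \<delta> * N powr p"
  have z1: "1 \<le> z" using N(4) by (simp add: z_def)
  define M where "M = nat \<lfloor>z\<rfloor>"
  note Mz = floor_half[OF z1, folded M_def]
  \<comment> \<open>The times used are at most \<open>L / N = N powr (- (2 / g')) / 100\<close>. At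
    such times the damping exponent at frequency \<open>N\<close> is at most 1/100, and so is
    \<open>t * h\<^sup>2\<close> for offsets \<open>h\<close> up to the bandwidth
    \<open>N powr (1 / g')\<close>.\<close>
  define L where "L = N powr (1 - 2 / g') / 100"
  have L: "0 < L" "L \<le> 1/100"
  proof -
    show "0 < L" using N0 by (simp add: L_def)
    have "N powr (1 - 2 / g') \<le> N powr 0" using N g' by (intro powr_mono) (auto simp: field_simps)
    then show "L \<le> 1/100" using N0 by (simp add: L_def)
  qed
  define d where "d = 2 * pi / L"
  have dp: "d > 0" using L by (simp add: d_def)
  have d2: "2 \<le> d"
  proof -
    have "2 * L \<le> 2 * pi" using L pi_ge_two by linarith
    then show ?thesis using L by (simp add: d_def field_simps)
  qed
  have dz: "d * z = N powr (1 / g')"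
  proof -
    have "d * z = N powr p / N powr (1 - 2 / g')"
      using N0 by (simp add: d_def z_def \<delta>_def L_def field_simps)
    also have "\<dots> = N powr (p - (1 - 2 / g'))" by (simp add: powr_diff)
    also have "p - (1 - 2 / g') = 1 / g'" by (simp add: p_def)
    finally show ?thesis .
  qed
  have h: "d * real m \<le> N powr (1 / g')" "0 \<le> d * real m" if "m \<le> M" for m
  proof -
    have "real m \<le> z" using that Mz(2) by (meson of_nat_le_iff order_trans)
    then show "d * real m \<le> N powr (1 / g')" unfolding dz[symmetric] using dp by (intro mult_left_mono) auto
    show "0 \<le> d * real m" using dp by simp
  qed
  have N1: "N powr (1 / g') \<le> N"
  proof -
    have "N powr (1 / g') \<le> N powr 1" using N g' by (intro powr_mono) auto
    then show ?thesis using N0 by simp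
  qed
  have LN: "L / N = N powr (- (2 / g')) / 100"
  proof -
    have "N powr (1 - 2 / g') = N * N powr (- (2 / g'))" using N0 by (simp add: powr_diff powr_minus_divide)
    then show ?thesis using N0 by (simp add: L_def)
  qed
  have en: "(2 * N) powr (2 * s) * (4 / real M) \<le> \<epsilon>"
  proof -
    have "4 / real M \<le> 4 / (z / 2)" using Mz z1 by (intro divide_left_mono mult_pos_pos) auto
    then have "(2 * N) powr (2 * s) * (4 / real M) \<le> (2 * N) powr (2 * s) * (8 / z)" by (intro mult_left_mono) auto
    also have "\<dots> = 8 * 2 powr (2 * s) * (N powr (2 * s) / z)" by (simp add: powr_mult)
    also have "\<dots> \<le> 8 * 2 powr (2 * s) * (\<epsilon> / (8 * 2 powr (2 * s)))"
      using Ne unfolding z_def by (intro mult_left_mono) auto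
    also have "\<dots> = \<epsilon>" by simp
    finally show ?thesis .
  qed
  have wave: "\<exists>t\<in>{L / (2 * N)..r}. sqrt (2 * pi) / (4 * pi) \<le> cmod (P_gamma \<gamma> (\<lambda>\<xi>. complex_of_real (packet (\<lambda>m. N + d * real m) M \<xi>)) x t)"
    if x: "x \<in> {0..1/10}" for x
  proof -
    \<comment> \<open>The extra \<open>L\<close> inside the ceiling keeps the distance to travel
      between \<open>L\<close> and \<open>2 * L\<close>, which yields a lower time independent of
      \<open>x\<close>.\<close>
    define k where "k = \<lceil>(x + L) / L\<rceil>"
    have k: "x + L \<le> of_int k * L" "of_int k * L \<le> x + 2 * L"
    proof -
      have 1: "(x + L) / L \<le> of_int k" and 2: "of_int k - 1 \<le> (x + L) / L" unfolding k_def by linarith+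
      show "x + L \<le> of_int k * L" using 1 L by (simp only: pos_divide_le_eq)
      have "(of_int k - 1) * L \<le> x + L" using 2 L by (simp only: pos_le_divide_eq)
      then show "of_int k * L \<le> x + 2 * L" by (simp add: algebra_simps)
    qed
    define t where "t = (of_int k * L - x) / (2 * N)"
    have "2 * t * N = of_int k * L - x" using N0 by (simp add: t_def field_simps)
    then have tk: "x + 2 * t * N = of_int k * L" by simp
    have t1: "L / (2 * N) \<le> t" unfolding t_def using k N0 by (intro divide_right_mono) auto
    have t2: "t \<le> N powr (- (2 / g')) / 100"
    proof -
      have "t \<le> 2 * L / (2 * N)" unfolding t_def using k N0 by (intro divide_right_mono) auto
      then show ?thesis using LN by simp
    qed
    have t0: "0 \<le> t" by (rule order_trans[OF _ t1]) (use L N0 in simp)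
    have tr: "t \<le> r" using t2 N(3) t0 by linarith
    have nn: "N powr (- a) \<le> 1" if "a \<ge> 0" for a
      using powr_mono[of "- a" 0 N] N that by simp
    have t3: "t \<le> 1/100" using t2 nn[of "2 / g'"] q by linarith
    have tg: "t powr \<gamma> \<le> 1/100 * (1 / N\<^sup>2)"
    proof -
      have "t powr \<gamma> \<le> (N powr (- (2 / g')) / 100) powr \<gamma>" using t0 t2 g by (intro powr_mono2) auto
      also have "\<dots> = (1/100) powr \<gamma> * N powr (- (2 * (\<gamma> / g')))"
        using powr_mult[of "1/100" "N powr (- (2 / g'))" \<gamma>] by (simp add: powr_powr mult.commute)
      also have "\<dots> \<le> (1/100) powr 1 * N powr (- 2)"
      proof (intro mult_mono)
        show "(1/100::real) powr \<gamma> \<le> (1/100) powr 1" using g by (intro powr_mono') auto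
        have "1 \<le> \<gamma> / g'" using g' by (simp add: le_divide_eq)
        then show "N powr (- (2 * (\<gamma> / g'))) \<le> N powr (- 2)" using N by (intro powr_mono) auto
      qed auto
      also have "N powr (- 2) = 1 / N\<^sup>2" using N0 by (simp add: powr_minus_divide powr_numeral)
      finally show ?thesis by simp
    qed
    have "sqrt (2 * pi) / (4 * pi) \<le> cmod (P_gamma \<gamma> (\<lambda>\<xi>. complex_of_real (packet (\<lambda>m. N + d * real m) M \<xi>)) x t)"
    \<comment> \<open>The phase at \<open>N + h\<close> splits into \<Theta>, the linear part
      \<open>(x + 2 * t * N) * h\<close> and \<open>t * h\<^sup>2\<close>. As
      \<open>x + 2 * t * N\<close> is a multiple of \<open>L\<close> and \<open>h\<close> one of
      \<open>2 * pi / L\<close>, the linear part is a multiple of \<open>2 * pi\<close>.\<close>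
    proof (rule packet_lower_bound[where k = "\<lambda>m. k * int m" and \<Theta> = "x * N + t * N\<^sup>2", OF Mz(3) t0])
      fix m and \<eta> :: real assume m: "m < M"
      define h where "h = d * real m"
      have hb: "0 \<le> h" "h \<le> N powr (1 / g')" "h \<le> N" using h[of m] m N1 by (auto simp: h_def)
      have th: "t * h \<le> 1/100"
      proof -
        have "t * h \<le> (N powr (- (2 / g')) / 100) * N powr (1 / g')" using t0 t2 hb by (intro mult_mono) auto
        also have "\<dots> = N powr (- (1 / g')) / 100" by (simp add: powr_add[symmetric])
        also have "\<dots> \<le> 1/100" using nn[of "1 / g'"] g' by simp
        finally show ?thesis .
      qed
      have th2: "t * h\<^sup>2 \<le> 1/100"
      proof -
        have "h * h \<le> N powr (1 / g') * N powr (1 / g')" using hb by (intro mult_mono) auto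
        then have "t * (h * h) \<le> (N powr (- (2 / g')) / 100) * (N powr (1 / g') * N powr (1 / g'))"
          using t0 t2 hb by (intro mult_mono) auto
        also have "\<dots> = 1/100" using N0 by (simp add: powr_add[symmetric])
        finally show ?thesis by (simp add: power2_eq_square)
      qed
      have kh: "of_int k * L * h = 2 * pi * of_int (k * int m)" using L by (simp add: h_def d_def)
      have "x * (N + h + \<eta>) + t * (N + h + \<eta>)\<^sup>2 - (x * N + t * N\<^sup>2 + (x + 2 * t * N) * h)
         = t * h\<^sup>2 + ((x + 2 * t * N) + 2 * (t * h)) * \<eta> + t * \<eta>\<^sup>2"
        by (simp add: power2_eq_square algebra_simps)
      then have e: "x * (N + h + \<eta>) + t * (N + h + \<eta>)\<^sup>2 - (x * N + t * N\<^sup>2 + 2 * pi * of_int (k * int m))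
         = t * h\<^sup>2 + (of_int k * L + 2 * (t * h)) * \<eta> + t * \<eta>\<^sup>2"
        unfolding tk kh .
      \<comment> \<open>The coefficient of \<open>\<eta>\<close> is the refocusing point, at most
        12/100, plus at most 2/100 from dispersion. Restricting \<open>x\<close> to
        \<open>{0..1/10}\<close> is what keeps it small.\<close>
      have v: "0 \<le> of_int k * L + 2 * (t * h)" "of_int k * L + 2 * (t * h) \<le> 14/100"
      proof -
        have "0 \<le> t * h" using t0 hb by simp
        then show "0 \<le> of_int k * L + 2 * (t * h)" using k x L by simp
        show "of_int k * L + 2 * (t * h) \<le> 14/100" using k x L th by simp
      qed
      have ab: "2 * \<bar>\<eta>\<bar> \<le> 1 + \<eta>\<^sup>2" using sum_squares_bound[of 1 "\<bar>\<eta>\<bar>"] by simp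
      have "\<bar>t * h\<^sup>2 + (of_int k * L + 2 * (t * h)) * \<eta> + t * \<eta>\<^sup>2\<bar> \<le> t * h\<^sup>2 + (of_int k * L + 2 * (t * h)) * \<bar>\<eta>\<bar> + t * \<eta>\<^sup>2"
      proof -
        have "\<bar>(of_int k * L + 2 * (t * h)) * \<eta>\<bar> = (of_int k * L + 2 * (t * h)) * \<bar>\<eta>\<bar>" using v by (simp add: abs_mult)
        moreover have "0 \<le> t * h\<^sup>2" "0 \<le> t * \<eta>\<^sup>2" using t0 by auto
        ultimately show ?thesis by linarith
      qed
      also have "\<dots> \<le> 1/100 + 14/100 * \<bar>\<eta>\<bar> + 1/100 * \<eta>\<^sup>2"
        using th2 v t3 by (intro add_mono mult_right_mono) auto
      finally have A1: "\<bar>x * (N + h + \<eta>) + t * (N + h + \<eta>)\<^sup>2 - (x * N + t * N\<^sup>2 + 2 * pi * of_int (k * int m))\<bar> \<le> 1/100 + 14/100 * \<bar>\<eta>\<bar> + 1/100 * \<eta>\<^sup>2"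
        unfolding e .
      have A2: "t powr \<gamma> * (N + h + \<eta>)\<^sup>2 \<le> 8/100 + 2/100 * \<eta>\<^sup>2"
      proof -
        have "0 \<le> (N + h - \<eta>)\<^sup>2" by simp
        then have "(N + h + \<eta>)\<^sup>2 \<le> 2 * (N + h)\<^sup>2 + 2 * \<eta>\<^sup>2" by (simp add: power2_eq_square algebra_simps)
        moreover have "(N + h)\<^sup>2 \<le> (2 * N)\<^sup>2" using hb N0 by (intro power_mono) auto
        moreover have "\<eta>\<^sup>2 * 1 \<le> \<eta>\<^sup>2 * N\<^sup>2" using N(1) by (intro mult_left_mono one_le_power) auto
        ultimately have "(N + h + \<eta>)\<^sup>2 \<le> N\<^sup>2 * (8 + 2 * \<eta>\<^sup>2)" by (simp add: power_mult_distrib algebra_simps)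
        then have "t powr \<gamma> * (N + h + \<eta>)\<^sup>2 \<le> (1/100 * (1 / N\<^sup>2)) * (N\<^sup>2 * (8 + 2 * \<eta>\<^sup>2))"
          using tg by (intro mult_mono) auto
        also have "\<dots> = 8/100 + 2/100 * \<eta>\<^sup>2" using N0 by simp
        finally show ?thesis .
      qed
      have "\<bar>x * (N + h + \<eta>) + t * (N + h + \<eta>)\<^sup>2 - (x * N + t * N\<^sup>2 + 2 * pi * of_int (k * int m))\<bar> + t powr \<gamma> * (N + h + \<eta>)\<^sup>2 \<le> 1/4 * (1 + \<eta>\<^sup>2)"
      proof -
        have "P + Q \<le> 1/4 * (1 + v)"
          if "P \<le> 1/100 + 14/100 * u + 1/100 * v" "Q \<le> 8/100 + 2/100 * v" "2 * u \<le> 1 + v" "0 \<le> v" for P Q u v :: real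
          using that by (simp add: field_simps)
        from this[OF A1 A2 ab zero_le_power2] show ?thesis .
      qed
      then show "\<bar>x * (N + d * real m + \<eta>) + t * (N + d * real m + \<eta>)\<^sup>2 - (x * N + t * N\<^sup>2 + 2 * pi * of_int (k * int m))\<bar> + t powr \<gamma> * (N + d * real m + \<eta>)\<^sup>2 \<le> 1/4 * (1 + \<eta>\<^sup>2)"
        unfolding h_def .
    qed
    then show ?thesis using t1 tr by auto
  qed
  have Tr: "L / (2 * N) \<le> r"
  proof -
    have "L / (2 * N) \<le> L / N" using L N0 by (simp add: field_simps)
    also have "\<dots> \<le> N powr (- (2 / g'))" unfolding LN by simp
    finally show ?thesis using N(3) by linarith
  qed
  show "\<exists>d B M N T. 2 \<le> d \<and> 0 < M \<and> 1 \<le> N \<and> A \<le> B \<and> B + d * real M \<le> N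
     \<and> N powr (2 * s) * (4 / real M) \<le> \<epsilon> \<and> 0 < T \<and> T \<le> r
     \<and> (\<forall>x\<in>{0..1/10}. \<exists>t\<in>{T..r}. sqrt (2 * pi) / (4 * pi) \<le> cmod (P_gamma \<gamma> (\<lambda>\<xi>. complex_of_real (packet (\<lambda>m. B + d * real m) M \<xi>)) x t))"
  proof (rule exI[of _ d], rule exI[of _ N], rule exI[of _ M], rule exI[of _ "2 * N"], rule exI[of _ "L / (2 * N)"], intro conjI ballI wave d2 Mz(3) en Tr N(2))
    show "1 \<le> 2 * N" using N by simp
    show "N + d * real M \<le> 2 * N" using h(1)[of M] N1 by simp
    show "0 < L / (2 * N)" using L N0 by simp
  qed
qed


text \<open>Along the curve \<open>x - t powr \<alpha> \<in> L \<int>\<close> all frequencies \<open>2 \<pi> (m + M) / L\<close> are in phase, during times so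
  short that there is no dispersion.\<close>
lemma packet_supply_hoelder:
  fixes \<gamma> \<alpha> s :: real
  assumes a: "0 < \<alpha>" "\<alpha> < 1/2" and g: "\<gamma> > 2 * \<alpha>" and s: "0 \<le> s" "s < 1/2 - \<alpha> / min \<gamma> 1"
  shows "packet_supply \<gamma> (\<lambda>x t. x - \<bar>t\<bar> powr \<alpha>) s (1/10) (sqrt (2 * pi) / (4 * pi))"
proof (rule packet_supplyI[OF s(1)])
  fix A \<epsilon> r :: real assume pos: "A > 0" "\<epsilon> > 0" "r > 0"
  \<comment> \<open>Times of order \<open>N powr (- (2 / g'))\<close> make both
    \<open>t * N\<^sup>2\<close> and \<open>t powr \<gamma> * N\<^sup>2\<close> small: damping is
    the stricter demand for \<gamma> below 1, dispersion above.\<close>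
  define g' where "g' = min \<gamma> 1"
  define p where "p = 1 - 2 * \<alpha> / g'"
  have g': "2 * \<alpha> < g'" "g' \<le> 1" "g' \<le> \<gamma>" "0 < g'" using g a by (auto simp: g'_def)
  have p: "p > 0" "2 * s < p" using g' s by (auto simp: p_def g'_def field_simps)
  \<comment> \<open>Normalised so that \<open>2 * (d * z) = N\<close>: the frequencies run from
    \<open>d * M\<close> up to \<open>2 * d * M\<close>, which is at most \<open>N\<close>.\<close>
  define \<delta> where "\<delta> = 1 / (400 * pi)"
  have dl: "\<delta> > 0" by (simp add: \<delta>_def)
  have q: "2 / g' > 0" using g' by simp
  obtain N where N: "1 \<le> N" "A \<le> N" "N powr (- (2 / g')) \<le> r" "max 1 A \<le> \<delta> * N powr p / 2"
    and Ne: "N powr (2 * s) / (\<delta> * N powr p) \<le> \<epsilon> / 8"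
    by (rule choose_scale[OF pos(3) _ dl p(1) q p(2), of "\<epsilon> / 8" A]) (use pos in auto)
  have N0: "N > 0" using N by simp
  define z where "z = \<delta> * N powr p"
  have z1: "1 \<le> z" using N(4) by (simp add: z_def)
  define M where "M = nat \<lfloor>z\<rfloor>"
  note Mz = floor_half[OF z1, folded M_def]
  \<comment> \<open>The displacement of the curve during times of order
    \<open>N powr (- (2 / g'))\<close>. A spacing of this size leaves room for about
    \<open>N * L\<close> frequencies, of order \<open>N powr p\<close>.\<close>
  define L where "L = N powr (- (2 * \<alpha> / g')) / 100"
  have nn: "N powr (- b) \<le> 1" if "b \<ge> 0" for b
    using powr_mono[of "- b" 0 N] N that by simp
  have L: "0 < L" "L \<le> 1/100"
    using N0 nn[of "2 * \<alpha> / g'"] a g' by (auto simp: L_def)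
  define d where "d = 2 * pi / L"
  have dp: "d > 0" using L by (simp add: d_def)
  have d2: "2 \<le> d"
  proof -
    have "2 * L \<le> 2 * pi" using L pi_ge_two by linarith
    then show ?thesis using L by (simp add: d_def field_simps)
  qed
  have dz: "2 * (d * z) = N"
  proof -
    have "2 * (d * z) = N powr p / N powr (- (2 * \<alpha> / g'))"
      using N0 by (simp add: d_def z_def \<delta>_def L_def field_simps)
    also have "\<dots> = N powr (p - - (2 * \<alpha> / g'))" by (simp only: powr_diff)
    also have "p - - (2 * \<alpha> / g') = 1" by (simp add: p_def)
    finally show ?thesis using N0 by simp
  qed
  have dM: "2 * (d * real M) \<le> N" unfolding dz[symmetric] using Mz(2) dp by simp
  have AB: "A \<le> d * real M"
  proof -
    have "A \<le> real M" using N(4) Mz(1) unfolding z_def by simp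
    also have "1 * real M \<le> d * real M" using d2 by (intro mult_right_mono) auto
    finally show ?thesis by simp
  qed
  have en: "N powr (2 * s) * (4 / real M) \<le> \<epsilon>"
  proof -
    have "4 / real M \<le> 4 / (z / 2)" using Mz z1 by (intro divide_left_mono mult_pos_pos) auto
    then have "N powr (2 * s) * (4 / real M) \<le> N powr (2 * s) * (8 / z)" by (intro mult_left_mono) auto
    also have "\<dots> = 8 * (N powr (2 * s) / z)" by simp
    also have "\<dots> \<le> 8 * (\<epsilon> / 8)" using Ne unfolding z_def by (intro mult_left_mono) auto
    finally show ?thesis by simp
  qed
  have N2: "N powr (- 2) = 1 / N\<^sup>2" using N0 by (simp add: powr_minus_divide powr_numeral)
  \<comment> \<open>For \<open>t = w powr (1 / \<alpha>)\<close> the case \<open>b = 1\<close>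
    bounds \<open>t\<close> and the case \<open>b = \<gamma>\<close> bounds
    \<open>t powr \<gamma>\<close>.\<close>
  have short: "w powr (b / \<alpha>) \<le> 2/100 * N powr (- (2 * b / g'))" if w: "0 \<le> w" "w \<le> 2 * L" and b: "\<alpha> \<le> b" for w b
  proof -
    have "w powr (b / \<alpha>) \<le> (2/100 * N powr (- (2 * \<alpha> / g'))) powr (b / \<alpha>)"
      using w b a by (intro powr_mono2) (auto simp: L_def)
    also have "\<dots> = (2/100) powr (b / \<alpha>) * N powr (- (2 * b / g'))"
    proof -
      have "- (2 * \<alpha> / g') * (b / \<alpha>) = - (2 * b / g')" using a by (simp add: field_simps)
      then show ?thesis by (simp only: powr_mult powr_powr)
    qed
    also have "\<dots> \<le> (2/100) powr 1 * N powr (- (2 * b / g'))"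
      using b a by (intro mult_right_mono powr_mono') (auto simp: le_divide_eq)
    finally show ?thesis by simp
  qed
  define T where "T = L powr (1 / \<alpha>)"
  have wave: "\<exists>t\<in>{T..r}. sqrt (2 * pi) / (4 * pi) \<le> cmod (P_gamma \<gamma> (\<lambda>\<xi>. complex_of_real (packet (\<lambda>m. d * real M + d * real m) M \<xi>)) (x - \<bar>t\<bar> powr \<alpha>) t)"
    if x: "x \<in> {0..1/10}" for x
  proof -
    \<comment> \<open>Subtracting \<open>L\<close> before rounding puts the displacement
      \<open>w\<close> between \<open>L\<close> and \<open>2 * L\<close>, so the time at which the
      curve meets \<open>k * L\<close> is at least \<open>T\<close>. Here \<open>k\<close> may be
      negative.\<close>
    define k where "k = \<lfloor>(x - L) / L\<rfloor>"
    define w where "w = x - of_int k * L"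
    have w: "L \<le> w" "w \<le> 2 * L"
    proof -
      have 1: "of_int k \<le> (x - L) / L" and 2: "(x - L) / L \<le> of_int k + 1" unfolding k_def by linarith+
      have "of_int k * L \<le> x - L" using 1 L by (simp only: pos_le_divide_eq)
      then show "L \<le> w" by (simp add: w_def)
      have "x - L \<le> (of_int k + 1) * L" using 2 L by (simp only: pos_divide_le_eq)
      then show "w \<le> 2 * L" by (simp add: w_def algebra_simps)
    qed
    have w0: "w > 0" using w L by linarith
    define t where "t = w powr (1 / \<alpha>)"
    have t0: "t > 0" using w0 by (simp add: t_def)
    have ta: "\<bar>t\<bar> powr \<alpha> = w" using w0 a by (simp add: t_def powr_powr)
    have y: "x - \<bar>t\<bar> powr \<alpha> = of_int k * L" unfolding ta by (simp add: w_def)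
    have yb: "\<bar>of_int k * L\<bar> \<le> 12/100"
    proof -
      have "of_int k * L = x - w" by (simp add: w_def)
      moreover have "0 \<le> x" "x \<le> 1/10" using x by auto
      ultimately show ?thesis using w L by linarith
    qed
    have t1: "T \<le> t" unfolding T_def t_def using w L a by (intro powr_mono2) auto
    have t2: "t \<le> 2/100 * N powr (- (2 / g'))"
      using short[of w 1] w w0 a by (simp add: t_def)
    have tr: "t \<le> r" using t2 N(3) t0 powr_ge_zero[of N "- (2 / g')"] by linarith
    have t3: "t \<le> 2/100 * (1 / N\<^sup>2)"
    proof -
      have "N powr (- (2 / g')) \<le> N powr (- 2)" using N g' by (intro powr_mono) (auto simp: field_simps)
      then show ?thesis using t2 N2 by linarith
    qed
    have tg: "t powr \<gamma> \<le> 2/100 * (1 / N\<^sup>2)"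
    proof -
      have "t powr \<gamma> = w powr (\<gamma> / \<alpha>)" by (simp add: t_def powr_powr)
      also have "\<dots> \<le> 2/100 * N powr (- (2 * \<gamma> / g'))" using w w0 g a by (intro short) auto
      also have "N powr (- (2 * \<gamma> / g')) \<le> N powr (- 2)" using N g' by (intro powr_mono) (auto simp: field_simps)
      finally show ?thesis using N2 by simp
    qed
    have "sqrt (2 * pi) / (4 * pi) \<le> cmod (P_gamma \<gamma> (\<lambda>\<xi>. complex_of_real (packet (\<lambda>m. d * real M + d * real m) M \<xi>)) (x - \<bar>t\<bar> powr \<alpha>) t)"
      unfolding y
    proof (rule packet_lower_bound[where k = "\<lambda>m. k * int (M + m)" and \<Theta> = 0, OF Mz(3) less_imp_le[OF t0]])
      fix m and \<eta> :: real assume m: "m < M"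
      \<comment> \<open>The base \<open>d * M\<close> is itself a multiple of \<open>d\<close>, so
        every centre is a multiple of \<open>2 * pi / L\<close> and the common phase is 0.\<close>
      define h where "h = d * real M + d * real m"
      have hb: "0 \<le> h" "h \<le> N"
      proof -
        have "d * real m \<le> d * real M" "0 \<le> d * real m" "0 \<le> d * real M" using m dp by auto
        then show "0 \<le> h" "h \<le> N" using dM by (auto simp: h_def)
      qed
      have kh: "of_int k * L * h = 2 * pi * of_int (k * int (M + m))" using L by (simp add: h_def d_def field_simps)
      have h2: "(h + \<eta>)\<^sup>2 \<le> N\<^sup>2 * (2 + 2 * \<eta>\<^sup>2)"
      proof -
        have "0 \<le> (h - \<eta>)\<^sup>2" by simp
        then have "(h + \<eta>)\<^sup>2 \<le> 2 * h\<^sup>2 + 2 * \<eta>\<^sup>2" by (simp add: power2_eq_square algebra_simps)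
        moreover have "h\<^sup>2 \<le> N\<^sup>2" using hb by (intro power_mono) auto
        moreover have "\<eta>\<^sup>2 * 1 \<le> \<eta>\<^sup>2 * N\<^sup>2" using N(1) by (intro mult_left_mono one_le_power) auto
        ultimately show ?thesis by (simp add: algebra_simps)
      qed
      have small: "u * (h + \<eta>)\<^sup>2 \<le> 4/100 + 4/100 * \<eta>\<^sup>2" if "0 \<le> u" "u \<le> 2/100 * (1 / N\<^sup>2)" for u
      proof -
        have "u * (h + \<eta>)\<^sup>2 \<le> (2/100 * (1 / N\<^sup>2)) * (N\<^sup>2 * (2 + 2 * \<eta>\<^sup>2))"
          using that h2 by (intro mult_mono) auto
        also have "\<dots> = 4/100 + 4/100 * \<eta>\<^sup>2" using N0 by simp
        finally show ?thesis .
      qed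
      have ab: "2 * \<bar>\<eta>\<bar> \<le> 1 + \<eta>\<^sup>2" using sum_squares_bound[of 1 "\<bar>\<eta>\<bar>"] by simp
      have yeta: "\<bar>of_int k * L * \<eta>\<bar> \<le> 12/100 * \<bar>\<eta>\<bar>" unfolding abs_mult[of "of_int k * L"] using yb by (intro mult_right_mono) auto
      have e: "of_int k * L * (h + \<eta>) + t * (h + \<eta>)\<^sup>2 - (0 + 2 * pi * of_int (k * int (M + m))) = of_int k * L * \<eta> + t * (h + \<eta>)\<^sup>2"
        unfolding distrib_left kh by simp
      have "0 \<le> t * (h + \<eta>)\<^sup>2" using t0 by simp
      have "\<bar>of_int k * L * (h + \<eta>) + t * (h + \<eta>)\<^sup>2 - (0 + 2 * pi * of_int (k * int (M + m)))\<bar> + t powr \<gamma> * (h + \<eta>)\<^sup>2 \<le> 1/4 * (1 + \<eta>\<^sup>2)"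
      proof -
        have "\<bar>a + b\<bar> + Q \<le> 1/4 * (1 + v)"
          if "\<bar>a\<bar> \<le> 12/100 * u" "0 \<le> b" "b \<le> 4/100 + 4/100 * v" "Q \<le> 4/100 + 4/100 * v" "2 * u \<le> 1 + v" "0 \<le> v" for a b Q u v :: real
        proof -
          have "\<bar>a + b\<bar> \<le> \<bar>a\<bar> + b" using that(2) by simp
          then show ?thesis using that by (simp add: field_simps)
        qed
        from this[OF yeta \<open>0 \<le> t * (h + \<eta>)\<^sup>2\<close> small[OF less_imp_le[OF t0] t3] small[OF powr_ge_zero tg] ab zero_le_power2]
        show ?thesis unfolding e .
      qed
      then show "\<bar>of_int k * L * (d * real M + d * real m + \<eta>) + t * (d * real M + d * real m + \<eta>)\<^sup>2 - (0 + 2 * pi * of_int (k * int (M + m)))\<bar> + t powr \<gamma> * (d * real M + d * real m + \<eta>)\<^sup>2 \<le> 1/4 * (1 + \<eta>\<^sup>2)"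
        unfolding h_def .
    qed
    then show ?thesis using t1 tr by auto
  qed
  have Tr: "T \<le> r"
  proof -
    have "T \<le> 2/100 * N powr (- (2 * 1 / g'))" unfolding T_def using L a by (intro short) auto
    then have "T \<le> 2/100 * N powr (- (2 / g'))" by simp
    then show ?thesis using N(3) powr_ge_zero[of N "- (2 / g')"] by linarith
  qed
  show "\<exists>d B M N T. 2 \<le> d \<and> 0 < M \<and> 1 \<le> N \<and> A \<le> B \<and> B + d * real M \<le> N
     \<and> N powr (2 * s) * (4 / real M) \<le> \<epsilon> \<and> 0 < T \<and> T \<le> r
     \<and> (\<forall>x\<in>{0..1/10}. \<exists>t\<in>{T..r}. sqrt (2 * pi) / (4 * pi) \<le> cmod (P_gamma \<gamma> (\<lambda>\<xi>. complex_of_real (packet (\<lambda>m. B + d * real m) M \<xi>)) (x - \<bar>t\<bar> powr \<alpha>) t))"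
  proof (rule exI[of _ d], rule exI[of _ "d * real M"], rule exI[of _ M], rule exI[of _ N], rule exI[of _ T], intro conjI ballI wave d2 Mz(3) en Tr N(1) AB)
    show "d * real M + d * real M \<le> N" using dM by simp
    show "0 < T" using L by (simp add: T_def)
  qed
qed

section \<open>Admissibility of the two extremal curves\<close>

lemma powr_add_le:
  fixes a b \<alpha> :: real
  assumes "0 \<le> a" "0 \<le> b" "0 < \<alpha>" "\<alpha> \<le> 1"
  shows "(a + b) powr \<alpha> \<le> a powr \<alpha> + b powr \<alpha>"
proof (cases "a + b = 0")
  case False
  then have ab: "a + b > 0" using assms by simp
  \<comment> \<open>After normalisation by \<open>a + b\<close> the fractions lie in the unit
    interval, where a power with exponent at most 1 does not decrease a number.\<close>
  have le: "c / (a + b) \<le> (c / (a + b)) powr \<alpha>" if "0 \<le> c" "c \<le> a + b" for c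
  proof -
    have "(c / (a + b)) powr 1 \<le> (c / (a + b)) powr \<alpha>" using that ab assms by (intro powr_mono') auto
    then show ?thesis using that ab by simp
  qed
  have "1 = a / (a + b) + b / (a + b)" using ab by (simp add: add_divide_distrib[symmetric])
  also have "\<dots> \<le> (a / (a + b)) powr \<alpha> + (b / (a + b)) powr \<alpha>" using assms by (intro add_mono le) auto
  also have "\<dots> = (a powr \<alpha> + b powr \<alpha>) / (a + b) powr \<alpha>" using assms by (simp add: powr_divide add_divide_distrib)
  finally show ?thesis using ab by (simp add: le_divide_eq)
qed (use assms in auto)

lemma admissible_curve_vertical: "0 < \<alpha> \<Longrightarrow> admissible_curve \<alpha> (\<lambda>x t. x)"
  unfolding admissible_curve_def
  by (intro conjI exI[of _ 1]) (auto intro!: continuous_intros simp: case_prod_beta)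

text \<open>For fixed \<open>t\<close> the curve is a translation, so it is bilipschitz with
  constants 1; the Hoelder bound is the subadditivity of \<open>powr_add_le\<close>.\<close>

lemma admissible_curve_hoelder:
  assumes a: "0 < \<alpha>" "\<alpha> \<le> 1"
  shows "admissible_curve \<alpha> (\<lambda>x t. x - \<bar>t\<bar> powr \<alpha>)"
proof -
  have hol: "\<bar>\<bar>t\<bar> powr \<alpha> - \<bar>t'\<bar> powr \<alpha>\<bar> \<le> \<bar>t - t'\<bar> powr \<alpha>" for t t' :: real
  proof -
    have *: "\<bar>u\<bar> powr \<alpha> \<le> \<bar>v\<bar> powr \<alpha> + \<bar>u - v\<bar> powr \<alpha>" for u v :: real
    proof -
      have "\<bar>u\<bar> powr \<alpha> \<le> (\<bar>v\<bar> + \<bar>u - v\<bar>) powr \<alpha>" using a by (intro powr_mono2) auto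
      also have "\<dots> \<le> \<bar>v\<bar> powr \<alpha> + \<bar>u - v\<bar> powr \<alpha>" using a by (intro powr_add_le) auto
      finally show ?thesis .
    qed
    show ?thesis using *[of t t'] *[of t' t] by (simp add: abs_minus_commute abs_le_iff)
  qed
  have "continuous_on (UNIV \<times> {-1..1}) (\<lambda>(x::real, t::real). x - \<bar>t\<bar> powr \<alpha>)"
    unfolding case_prod_beta using a by (intro continuous_intros continuous_on_powr') auto
  moreover have "\<bar>x - \<bar>t\<bar> powr \<alpha> - (x - \<bar>t'\<bar> powr \<alpha>)\<bar> \<le> 1 * \<bar>t - t'\<bar> powr \<alpha>" for x t t' :: real
    using hol[of t' t] by (simp add: abs_minus_commute)
  ultimately show ?thesis unfolding admissible_curve_def using a
    by (intro conjI exI[of _ "1::real"]) auto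
qed

theorem theorem3:
  fixes \<gamma> \<alpha> :: real
  assumes "\<gamma> > 0" and "1/4 < \<alpha>" and "\<alpha> < 1/2"
  shows "(\<forall>\<Gamma>. admissible_curve \<alpha> \<Gamma> \<longrightarrow>
            (\<forall>s. s > s_crit \<alpha> \<gamma> \<longrightarrow>
               (\<forall>f g. sobolev_with_fourier s f g \<longrightarrow> conv_ae \<gamma> \<Gamma> f g)))
       \<and> (\<exists>\<Gamma>. admissible_curve \<alpha> \<Gamma> \<and>
            (\<forall>s. 0 \<le> s \<and> s < s_crit \<alpha> \<gamma> \<longrightarrow>
               (\<exists>f g. sobolev_with_fourier s f g \<and> \<not> conv_ae \<gamma> \<Gamma> f g)))"
proof
  show "\<forall>\<Gamma>. admissible_curve \<alpha> \<Gamma> \<longrightarrow> (\<forall>s. s > s_crit \<alpha> \<gamma> \<longrightarrow>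
      (\<forall>f g. sobolev_with_fourier s f g \<longrightarrow> conv_ae \<gamma> \<Gamma> f g))"
    using convergence_above_critical[OF assms] by blast
  have c: "sqrt (2 * pi) / (4 * pi) > 0" by simp
  have a: "\<alpha> > 0" using assms by simp
  show "\<exists>\<Gamma>. admissible_curve \<alpha> \<Gamma> \<and> (\<forall>s. 0 \<le> s \<and> s < s_crit \<alpha> \<gamma> \<longrightarrow>
      (\<exists>f g. sobolev_with_fourier s f g \<and> \<not> conv_ae \<gamma> \<Gamma> f g))"
  proof (cases "\<gamma> < 1 / (2 * \<alpha>)")
    case True
    have adm: "admissible_curve \<alpha> (\<lambda>x t. x - \<bar>t\<bar> powr \<alpha>)"
      using assms by (intro admissible_curve_hoelder) auto
    have "\<exists>f g. sobolev_with_fourier s f g \<and> \<not> conv_ae \<gamma> (\<lambda>x t. x - \<bar>t\<bar> powr \<alpha>) f g"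
      if s: "0 \<le> s" "s < s_crit \<alpha> \<gamma>" for s
    proof -
      \<comment> \<open>Up to and including \<open>2 * \<alpha>\<close> the critical exponent is 0,
        at the endpoint because \<open>1/2 - \<alpha> / \<gamma>\<close> vanishes there, so no
        \<open>s \<ge> 0\<close> lies below it.\<close>
      have g: "\<gamma> > 2 * \<alpha>"
      proof (rule ccontr)
        assume "\<not> \<gamma> > 2 * \<alpha>"
        then have "\<gamma> < 2 * \<alpha> \<or> \<gamma> = 2 * \<alpha>" by auto
        then have "s_crit \<alpha> \<gamma> = 0" using assms by (auto simp: s_crit_def)
        then show False using s by simp
      qed
      \<comment> \<open>The minimum with 1 merges the second and the third branch of
        \<open>s_crit\<close>.\<close>
      have "s < 1/2 - \<alpha> / min \<gamma> 1"
        using s True g by (auto simp: s_crit_def min_def split: if_splits)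
      then have sup: "packet_supply \<gamma> (\<lambda>x t. x - \<bar>t\<bar> powr \<alpha>) s (1/10) (sqrt (2 * pi) / (4 * pi))"
        using assms s g by (intro packet_supply_hoelder) auto
      have "0 < \<alpha> / min \<gamma> 1" using assms by simp
      then have "s \<le> 1" using \<open>s < 1/2 - \<alpha> / min \<gamma> 1\<close> by linarith
      then show ?thesis by (intro divergence_of_packets[OF assms(1) a s(1) _ adm sup _ c]) auto
    qed
    then show ?thesis using adm by blast
  next
    case False
    have adm: "admissible_curve \<alpha> (\<lambda>x t. x)" by (rule admissible_curve_vertical[OF a])
    have "1 < 1 / (2 * \<alpha>)" using assms by simp
    then have g: "\<gamma> > 1" using False by linarith
    have "\<exists>f g. sobolev_with_fourier s f g \<and> \<not> conv_ae \<gamma> (\<lambda>x t. x) f g"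
      if s: "0 \<le> s" "s < s_crit \<alpha> \<gamma>" for s
    proof -
      \<comment> \<open>The minimum with 2 merges the last two branches of \<open>s_crit\<close>: at
        2 the right side is 1/2, twice the final value 1/4.\<close>
      have "2 * s < 1 - 1 / min \<gamma> 2"
        using s False g assms by (auto simp: s_crit_def min_def split: if_splits)
      then have sup: "packet_supply \<gamma> (\<lambda>x t. x) s (1/10) (sqrt (2 * pi) / (4 * pi))"
        using s g by (intro packet_supply_vertical) auto
      have "0 < 1 / min \<gamma> 2" using g by simp
      then have "s \<le> 1" using \<open>2 * s < 1 - 1 / min \<gamma> 2\<close> s by linarith
      then show ?thesis by (intro divergence_of_packets[OF assms(1) a s(1) _ adm sup _ c]) auto
    qed
    then show ?thesis using adm by blast
  qed
qed

end
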